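(* Suppose $(I_n^0,J_n^0)_{n\in\mathbb{Z}}$ is an i.i.d. sequence with marginal $\tilde\mu\times\mu=\mathrm{Gam}(\lambda_1+\lambda_2,c)\times\mathrm{Gam}(\lambda_1,c)$ (law of $I_n^0$ is $\tilde\mu$, of $J_n^0$ is $\mu$) for some $\lambda_1,\lambda_2>0$ and $c>0$. Then $\mathcal{T}_{dT}(I^0,J^0)\overset{d}{=}(I^0,J^0)$. Moreover, there are no other non-trivial measures for which $(I_n^0,J_n^0)_{n\in\mathbb{Z}}$ is i.i.d., with $I_n^0$ independent of $J_n^0$, and $\mathcal{T}_{dT}(I^0,J^0)\overset{d}{=}(I^0,J^0)$.
   Context: The discrete Toda equation: $(0,\infty)$-valued variables $(I_n^t,J_n^t,U_n^t)_{n,t\in\mathbb{Z}}$ with $I_n^{t+1}=J_n^t+U_n^t$, $J_n^{t+1}=I_{n+1}^tJ_n^t(I_n^{t+1})^{-1}$, $U_{n+1}^t=I_{n+1}^tU_n^t(I_n^{t+1})^{-1}$ for all $n,t$. For initial data $(I^0,J^0)\in((0,\infty)^2)^{\mathbb{Z}}$ for which there is a unique family $(I_n^t,J_n^t,U_n^t)_{n,t\in\mathbb{Z}}$ solving these equations, $\mathcal{T}_{dT}(I^0,J^0):=(I^1,J^1)$; the invariance statement includes that such unique solvability holds almost surely. "Non-trivial" means the marginals are not both Dirac masses. $\mathrm{Gam}(\lambda,c)$ has density proportional to $x^{\lambda-1}e^{-cx}\mathbf{1}_{(0,\infty)}(x)$. *)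

theory Defs
  imports "HOL-Probability.Probability" "HOL-Analysis.Gamma_Function"
begin

definition gamma_measure :: "real \<Rightarrow> real \<Rightarrow> real measure" where
  "gamma_measure l c = density lborel
     (\<lambda>x. ennreal (if x > 0 then c powr l * x powr (l - 1) * exp (- c * x) / Gamma l else 0))"

text \<open>Discrete Toda equations; I n t stands for I_n^t, etc.\<close>
definition dT_eqs :: "(int \<Rightarrow> int \<Rightarrow> real) \<Rightarrow> (int \<Rightarrow> int \<Rightarrow> real) \<Rightarrow> (int \<Rightarrow> int \<Rightarrow> real) \<Rightarrow> bool" where
  "dT_eqs I J U \<longleftrightarrow> (\<forall>n t. I n t > 0 \<and> J n t > 0 \<and> U n t > 0 \<and>
      I n (t + 1) = J n t + U n t \<and>
      J n (t + 1) = I (n + 1) t * J n t / I n (t + 1) \<and>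
      U (n + 1) t = I (n + 1) t * U n t / I n (t + 1))"

definition dT_solution ::
  "(int \<Rightarrow> real \<times> real) \<Rightarrow> (int \<Rightarrow> int \<Rightarrow> real) \<times> (int \<Rightarrow> int \<Rightarrow> real) \<times> (int \<Rightarrow> int \<Rightarrow> real) \<Rightarrow> bool" where
  "dT_solution x s \<longleftrightarrow> (case s of (I, J, U) \<Rightarrow>
      dT_eqs I J U \<and> (\<forall>n. I n 0 = fst (x n) \<and> J n 0 = snd (x n)))"

definition dT_uniquely_solvable :: "(int \<Rightarrow> real \<times> real) \<Rightarrow> bool" where
  "dT_uniquely_solvable x \<longleftrightarrow> (\<exists>!s. dT_solution x s)"

text \<open>T_dT(I^0,J^0) = (I^1,J^1), meaningful when the solution is unique.\<close>
definition T_dT :: "(int \<Rightarrow> real \<times> real) \<Rightarrow> (int \<Rightarrow> real \<times> real)" where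
  "T_dT x = (case (THE s. dT_solution x s) of (I, J, U) \<Rightarrow> (\<lambda>n. (I n 1, J n 1)))"

definition iid_law :: "real measure \<Rightarrow> real measure \<Rightarrow> (int \<Rightarrow> real \<times> real) measure" where
  "iid_law \<nu> \<mu> = PiM UNIV (\<lambda>_::int. \<nu> \<Otimes>\<^sub>M \<mu>)"

definition dT_invariant :: "real measure \<Rightarrow> real measure \<Rightarrow> bool" where
  "dT_invariant \<nu> \<mu> \<longleftrightarrow>
     (AE x in iid_law \<nu> \<mu>. dT_uniquely_solvable x) \<and>
     T_dT \<in> measurable (completion (iid_law \<nu> \<mu>)) (iid_law \<nu> \<mu>) \<and>
     distr (completion (iid_law \<nu> \<mu>)) (iid_law \<nu> \<mu>) T_dT = iid_law \<nu> \<mu>"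

end

theory Submission
  imports Defs
begin

text \<open>Let \<open>U\<close> be the carrier at time \<open>0\<close>. One time step at site \<open>n\<close> applies the involution
  \<open>(I, J, U) \<mapsto> (J + U, I J / (J + U), I U / (J + U))\<close> to \<open>(I (n + 1), J n, U n)\<close>. For independent gamma
  variables \<open>J, U\<close> of the same scale, \<open>J + U\<close> is independent of \<open>J / (J + U)\<close> and has the law of \<open>I\<close>, so the
  product law is invariant under the involution; sweeping the carrier in from \<open>-\<infinity>\<close> yields
  the invariance of the i.i.d. law, and reflection takes care of negative times.

  Conversely, a solution that lives for two time steps forces \<open>U\<close> to be the function \<open>carrier_of\<close> of the
  past, because otherwise \<open>I k\<close> would tend to \<open>\<infinity>\<close> as \<open>k\<close> tends to \<open>-\<infinity>\<close>. Hence \<open>U 0\<close> is independent of \<open>J 0\<close>. Applying the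
  same fact to the reversed dynamics, \<open>U 1\<close> is a function of the output at sites \<open>n > 0\<close>, so that
  \<open>J 0 + U 0\<close> is independent of \<open>J 0 / (J 0 + U 0)\<close>. By Lukacs' theorem, proved with Laplace
  transforms, \<open>J 0\<close> and \<open>U 0\<close> are gamma distributed with the same scale unless everything is constant.\<close>

subsection \<open>Deterministic dynamics\<close>

text \<open>One time step leaves the carrier undetermined: the affine recursion for
  \<open>I n / U n\<close> has a half-line of positive solutions. Only the existence of a further
  step excludes all but the minimal one, which is why uniqueness is stated for two consecutive
  steps. The remaining requirement, that \<open>I\<close> does not tend to \<infinity> on the left,
  holds almost surely for every i.i.d. law. Existence is a different matter, since the series has to
  converge. For gamma laws \<open>J / I\<close> may have infinite mean (when
  \<open>l1 + l2 \<le> 1\<close>), so convergence is derived from a fractional moment of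
  \<open>J / I\<close> below 1, which exists because \<open>ln Gamma\<close> is strictly convex. The
  carrier coming from -\<infinity> is only a limit of sweeps started at finite sites, so invariance
  passes to the limit through continuous test functions. In the converse no moments are given; the
  Laplace variable \<open>s > 0\<close> supplies the integrability.\<close>

definition toda_step :: "(int \<Rightarrow> real \<times> real) \<Rightarrow> (int \<Rightarrow> real) \<Rightarrow> (int \<Rightarrow> real \<times> real) \<Rightarrow> bool" where
  "toda_step x u x' \<longleftrightarrow> (\<forall>n. fst (x n) > 0 \<and> snd (x n) > 0 \<and> u n > 0 \<and>
      fst (x' n) = snd (x n) + u n \<and>
      snd (x' n) = fst (x (n + 1)) * snd (x n) / fst (x' n) \<and>
      u (n + 1) = fst (x (n + 1)) * u n / fst (x' n))"

lemma dT_eqs_iff_step: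
  "dT_eqs I J U \<longleftrightarrow> (\<forall>t. toda_step (\<lambda>n. (I n t, J n t)) (\<lambda>n. U n t) (\<lambda>n. (I n (t + 1), J n (t + 1))))"
  unfolding dT_eqs_def toda_step_def by auto

text \<open>Writing \<open>S n = I n / U n\<close>, the recursion for the carrier \<open>U\<close> becomes affine:
  \<open>S (n + 1) = 1 + (J n / I n) * S n\<close>. Its positive solutions form a half-line whose end point is the
  series \<open>toda_sum\<close>. If the series diverges, Isabelle's \<open>suminf\<close> is an unspecified value; hence
  the hypothesis \<open>contractive\<close> below.\<close>

definition toda_weight :: "(int \<Rightarrow> real \<times> real) \<Rightarrow> int \<Rightarrow> nat \<Rightarrow> real" where
  "toda_weight x n k = (\<Prod>i<k. snd (x (n - 1 - int i)) / fst (x (n - 1 - int i)))"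

definition toda_sum :: "(int \<Rightarrow> real \<times> real) \<Rightarrow> int \<Rightarrow> real" where
  "toda_sum x n = (\<Sum>k. toda_weight x n k)"

definition carrier_of :: "(int \<Rightarrow> real \<times> real) \<Rightarrow> int \<Rightarrow> real" where
  "carrier_of x n = fst (x n) / toda_sum x n"

definition toda_next :: "real \<times> real \<Rightarrow> real \<Rightarrow> real \<times> real" where
  "toda_next z u = (snd z + u, fst z * snd z / (snd z + u))"

text \<open>The pair \<open>(I (n + 1), J n)\<close> is what the carrier \<open>U n\<close> meets at site \<open>n\<close>.\<close>

definition shift_pair :: "(int \<Rightarrow> real \<times> real) \<Rightarrow> int \<Rightarrow> real \<times> real" where
  "shift_pair x n = (fst (x (n + 1)), snd (x n))"

definition toda_map :: "(int \<Rightarrow> real \<times> real) \<Rightarrow> int \<Rightarrow> real \<times> real" where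
  "toda_map x n = toda_next (shift_pair x n) (carrier_of x n)"

text \<open>The local map is an involution, so the dynamics run backwards in time are the same dynamics
  for the spatially reflected configuration; the offset between the two components is forced by the pairing
  \<open>(I (n + 1), J n)\<close>.\<close>

definition reflect :: "(int \<Rightarrow> real \<times> real) \<Rightarrow> int \<Rightarrow> real \<times> real" where
  "reflect x n = (fst (x (- n)), snd (x (- n - 1)))"

text \<open>The level \<open>M\<close> is chosen before \<open>m\<close>: this is exactly the
  negation of \<open>I k\<close> tending to \<infinity> as \<open>k\<close> tends to
  -\<infinity>.\<close>

definition recurrent :: "(int \<Rightarrow> real \<times> real) \<Rightarrow> bool" where
  "recurrent x \<longleftrightarrow> (\<exists>M. \<forall>m. \<exists>k\<le>m. fst (x k) \<le> M)"

definition positive_config :: "(int \<Rightarrow> real \<times> real) \<Rightarrow> bool" where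
  "positive_config x \<longleftrightarrow> (\<forall>n. fst (x n) > 0 \<and> snd (x n) > 0)"

definition contractive :: "(int \<Rightarrow> real \<times> real) \<Rightarrow> bool" where
  "contractive x \<longleftrightarrow> positive_config x \<and> (\<forall>n. summable (toda_weight x n))"

lemma toda_weight_0 [simp]: "toda_weight x n 0 = 1"
  by (simp add: toda_weight_def)

lemma toda_weight_Suc:
  "toda_weight x n (Suc k) = toda_weight x n k * (snd (x (n - 1 - int k)) / fst (x (n - 1 - int k)))"
  by (simp add: toda_weight_def)

lemma toda_weight_Suc_left:
  "toda_weight x (n + 1) (Suc k) = snd (x n) / fst (x n) * toda_weight x n k"
  unfolding toda_weight_def by (subst prod.lessThan_Suc_shift) (simp add: algebra_simps)

lemma toda_weight_pos: "positive_config x \<Longrightarrow> toda_weight x n k > 0"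
  unfolding toda_weight_def positive_config_def by (intro prod_pos) auto

lemma toda_sum_pos: "contractive x \<Longrightarrow> toda_sum x n > 0"
  unfolding toda_sum_def contractive_def by (intro suminf_pos) (auto intro: toda_weight_pos)

lemma toda_sum_rec:
  assumes "contractive x"
  shows "toda_sum x (n + 1) = 1 + snd (x n) / fst (x n) * toda_sum x n"
proof -
  have s: "summable (toda_weight x (n + 1))" "summable (toda_weight x n)"
    using assms by (auto simp: contractive_def)
  have "toda_sum x (n + 1) = 1 + (\<Sum>k. toda_weight x (n + 1) (Suc k))"
    unfolding toda_sum_def using suminf_split_head[OF s(1)] by simp
  also have "\<dots> = 1 + snd (x n) / fst (x n) * toda_sum x n"
    unfolding toda_sum_def toda_weight_Suc_left by (subst suminf_mult[OF s(2)]) simp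
  finally show ?thesis .
qed

lemma toda_step_toda_map:
  assumes "contractive x"
  shows "toda_step x (carrier_of x) (toda_map x)"
  unfolding toda_step_def
proof (intro allI conjI)
  fix n
  have pos: "fst (x n) > 0" "snd (x n) > 0" "fst (x (n + 1)) > 0"
    using assms by (auto simp: contractive_def positive_config_def)
  have S: "toda_sum x n > 0" using assms by (rule toda_sum_pos)
  show "fst (x n) > 0" "snd (x n) > 0" by fact+
  show u: "carrier_of x n > 0" unfolding carrier_of_def using pos S by simp
  show *: "fst (toda_map x n) = snd (x n) + carrier_of x n"
    by (simp add: toda_map_def toda_next_def shift_pair_def)
  show "snd (toda_map x n) = fst (x (n + 1)) * snd (x n) / fst (toda_map x n)"
    by (simp add: toda_map_def toda_next_def shift_pair_def)
  have "toda_sum x (n + 1) = (snd (x n) + carrier_of x n) / carrier_of x n"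
    unfolding toda_sum_rec[OF assms] carrier_of_def using pos S by (simp add: field_simps)
  then show "carrier_of x (n + 1) = fst (x (n + 1)) * carrier_of x n / fst (toda_map x n)"
    unfolding * using u pos by (simp add: carrier_of_def[of x "n + 1"])
qed

lemma step_positive_config:
  assumes "toda_step x u x'"
  shows "positive_config x" "positive_config x'"
  using assms unfolding toda_step_def positive_config_def by (auto intro!: divide_pos_pos mult_pos_pos add_pos_pos)

lemma toda_step_quotient:
  assumes "toda_step x u x'"
  shows "fst (x (n + 1)) / u (n + 1) = 1 + snd (x n) / fst (x n) * (fst (x n) / u n)"
proof -
  have "fst (x n) > 0" "snd (x n) > 0" "u n > 0" "fst (x' n) = snd (x n) + u n" "fst (x (n + 1)) > 0"
     "u (n + 1) = fst (x (n + 1)) * u n / fst (x' n)"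
    using assms unfolding toda_step_def by blast+
  then show ?thesis by (simp add: add_divide_distrib)
qed

text \<open>The recursion iterated to the left. For positive \<open>S\<close> the last term is
  positive, so \<open>S n\<close> dominates every partial sum; the limit of that term is the excess
  of \<open>S n\<close> over the minimal solution.\<close>

lemma affine_unroll:
  assumes "positive_config x"
    and rec: "\<And>n. S (n + 1) = 1 + snd (x n) / fst (x n) * S n"
  shows "S n = (\<Sum>k<N. toda_weight x n k) + toda_weight x n N * S (n - int N)"
proof (induction N)
  case (Suc N)
  have "S (n - int N) = 1 + snd (x (n - 1 - int N)) / fst (x (n - 1 - int N)) * S (n - 1 - int N)"
    using rec[of "n - 1 - int N"] by simp
  with Suc show ?case
    by (simp add: toda_weight_Suc algebra_simps)
qed simp

text \<open>Any positive carrier bounds all partial sums of the series by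
  \<open>fst (x n) / u n\<close>, so the mere existence of a step forces convergence.\<close>

lemma toda_step_contractive:
  assumes "toda_step x u x'"
  shows "contractive x"
  unfolding contractive_def
proof (intro conjI allI)
  show p: "positive_config x" using step_positive_config[OF assms] by simp
  fix n
  let ?S = "\<lambda>n. fst (x n) / u n"
  have S: "?S n > 0" for n using assms unfolding toda_step_def by simp
  have "(\<Sum>k<N. toda_weight x n k) \<le> ?S n" for N
  proof -
    have "?S n = (\<Sum>k<N. toda_weight x n k) + toda_weight x n N * ?S (n - int N)"
      by (rule affine_unroll[OF p]) (rule toda_step_quotient[OF assms])
    moreover have "toda_weight x n N * ?S (n - int N) > 0"
      using toda_weight_pos[OF p] S by (intro mult_pos_pos) auto
    ultimately show ?thesis by linarith
  qed
  then show "summable (toda_weight x n)"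
    by (intro summableI_nonneg_bounded[where x="?S n"]) (auto intro: less_imp_le toda_weight_pos[OF p])
qed

text \<open>Summability of these weights is what the existence of one further step amounts to.\<close>

lemma toda_step_weight:
  assumes "toda_step x u x'"
  defines "S \<equiv> \<lambda>n. fst (x n) / u n"
  shows "toda_weight x' n k =
    toda_weight x n k * (fst (x n) / fst (x (n - int k))) * (S (n - int k) / S n)\<^sup>2"
proof (induction k)
  case 0
  have "fst (x n) > 0" "u n > 0" using assms unfolding toda_step_def by blast+
  then show ?case by (simp add: S_def)
next
  case (Suc k)
  define m where "m = n - 1 - int k"
  have m1: "n - int k = m + 1" by (simp add: m_def)
  have e: "fst (x n) > 0" "u n > 0" "fst (x m) > 0" "snd (x m) > 0" "u m > 0" "fst (x' m) = snd (x m) + u m" "fst (x (m + 1)) > 0"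
     "u (m + 1) = fst (x (m + 1)) * u m / fst (x' m)" "snd (x' m) = fst (x (m + 1)) * snd (x m) / fst (x' m)"
    using assms unfolding toda_step_def by blast+
  define y where "y = fst (x' m)"
  have y: "y > 0" "fst (x' m) = y" using e by (auto simp: y_def)
  have Sm: "S (m + 1) = y / u m" "S m = fst (x m) / u m"
    unfolding S_def e using e y by simp_all
  have Sn: "S n > 0" unfolding S_def using e by simp
  have "toda_weight x' n (Suc k) = toda_weight x' n k * (snd (x' m) / fst (x' m))"
    by (simp add: toda_weight_Suc m_def)
  also have "\<dots> = toda_weight x n k * (fst (x n) / fst (x (m + 1))) * (S (m + 1) / S n)\<^sup>2 * (snd (x' m) / fst (x' m))"
    using Suc by (simp add: m1)
  \<comment> \<open>Here \<open>S (m + 1) / S m = I' m / I m\<close>, while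
    \<open>J' m / I' m\<close> equals \<open>I (m + 1) * J m\<close> divided by the square of
    \<open>I' m\<close>. The squared quotient therefore absorbs the unknown
    \<open>I' m\<close>.\<close>
  also have "(S (m + 1) / S n)\<^sup>2 * (snd (x' m) / fst (x' m)) =
      (S m / S n)\<^sup>2 * (fst (x (m + 1)) * snd (x m) / (fst (x m))\<^sup>2)"
    unfolding Sm e(9) y using e(3-5,7) y Sn by (simp add: field_simps power2_eq_square)
  then have "toda_weight x n k * (fst (x n) / fst (x (m + 1))) * (S (m + 1) / S n)\<^sup>2 * (snd (x' m) / fst (x' m))
     = toda_weight x n k * (fst (x n) / fst (x (m + 1))) * ((S m / S n)\<^sup>2 * (fst (x (m + 1)) * snd (x m) / (fst (x m))\<^sup>2))"
    by (simp only: mult.assoc)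
  also have "\<dots> = toda_weight x n (Suc k) * (fst (x n) / fst (x m)) * (S m / S n)\<^sup>2"
    unfolding toda_weight_Suc m_def[symmetric] using e by (simp add: power2_eq_square mult_ac)
  finally show ?case by (simp add: m_def algebra_simps)
qed

text \<open>If \<open>S\<close> exceeded the minimal solution, \<open>toda_weight x n k * S (n - k)\<close> would have a positive limit.
  Together with the decay of the weights of \<open>x\<close> and of \<open>x'\<close> this forces \<open>I k \<longlongrightarrow> \<infinity>\<close> as \<open>k\<close> tends to \<open>-\<infinity>\<close>.\<close>

theorem toda_step_unique:
  assumes s1: "toda_step x u x'" and s2: "toda_step x' u' x''" and rc: "recurrent x"
  shows "u = carrier_of x" "x' = toda_map x"
proof -
  define S where "S n = fst (x n) / u n" for n
  have p: "positive_config x" and c: "contractive x" and c': "contractive x'"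
    using step_positive_config[OF s1] toda_step_contractive[OF s1] toda_step_contractive[OF s2] by auto
  have S: "S n > 0" for n using s1 unfolding S_def toda_step_def by simp
  have I: "fst (x n) > 0" for n using p by (auto simp: positive_config_def)
  have un: "S n = (\<Sum>k<N. toda_weight x n k) + toda_weight x n N * S (n - int N)" for n N
    by (rule affine_unroll[OF p]) (simp add: S_def toda_step_quotient[OF s1])
  have SS: "S n = toda_sum x n" for n
  proof (rule ccontr)
    assume ne: "S n \<noteq> toda_sum x n"
    define l where "l = S n - toda_sum x n"
    let ?w = "\<lambda>k. toda_weight x n k"
    have w: "?w k > 0" for k by (rule toda_weight_pos[OF p])
    have sm: "summable ?w" using c by (simp add: contractive_def)
    have "(\<lambda>N. S n - (\<Sum>k<N. ?w k)) \<longlonglongrightarrow> l"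
      unfolding l_def toda_sum_def by (intro tendsto_intros summable_LIMSEQ sm)
    moreover have "S n - (\<Sum>k<N. ?w k) = ?w N * S (n - int N)" for N
      using un[of n N] by linarith
    ultimately have lim1: "(\<lambda>N. ?w N * S (n - int N)) \<longlonglongrightarrow> l" by simp
    have "l \<ge> 0" using lim1 by (rule LIMSEQ_le_const) (auto intro!: less_imp_le mult_pos_pos w S)
    with ne have l: "l > 0" by (simp add: l_def)
    have w0: "?w \<longlonglongrightarrow> 0" by (rule summable_LIMSEQ_zero[OF sm])
    have "toda_weight x' n = (\<lambda>k. ?w k * (fst (x n) / fst (x (n - int k))) * (S (n - int k) / S n)\<^sup>2)"
      unfolding S_def by (rule ext) (rule toda_step_weight[OF s1])
    moreover have "toda_weight x' n \<longlonglongrightarrow> 0" using c' by (auto simp: contractive_def intro: summable_LIMSEQ_zero)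
    ultimately have lim2: "(\<lambda>k. ?w k * (fst (x n) / fst (x (n - int k))) * (S (n - int k) / S n)\<^sup>2) \<longlonglongrightarrow> 0"
      by simp
    \<comment> \<open>The product of the two null sequences contains exactly the square of
      \<open>?w k * S (n - int k)\<close>, whose limit is the square of \<open>l > 0\<close>.
      Dividing by it leaves \<open>1 / I (n - k)\<close>, which must therefore tend to 0.\<close>
    have "(\<lambda>k. (?w k * (fst (x n) / fst (x (n - int k))) * (S (n - int k) / S n)\<^sup>2) * ?w k) \<longlonglongrightarrow> 0 * 0"
      by (intro tendsto_mult lim2 w0)
    from tendsto_divide[OF tendsto_mult[OF this tendsto_const[of "(S n)\<^sup>2 / fst (x n)"]] tendsto_power[OF lim1, of 2]] have "(\<lambda>k. (?w k * (fst (x n) / fst (x (n - int k))) * (S (n - int k) / S n)\<^sup>2) * ?w k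
        * ((S n)\<^sup>2 / fst (x n)) / (?w k * S (n - int k))\<^sup>2) \<longlonglongrightarrow> 0 * 0 * ((S n)\<^sup>2 / fst (x n)) / l\<^sup>2"
      using l by simp
    moreover have "(?w k * (fst (x n) / fst (x (n - int k))) * (S (n - int k) / S n)\<^sup>2) * ?w k
        * ((S n)\<^sup>2 / fst (x n)) / (?w k * S (n - int k))\<^sup>2 = inverse (fst (x (n - int k)))" for k
      using S[of n] S[of "n - int k"] w[of k] I[of n] I[of "n - int k"]
      by (simp add: field_simps power2_eq_square)
    ultimately have i0: "(\<lambda>k. inverse (fst (x (n - int k)))) \<longlonglongrightarrow> 0" by simp
    obtain M where M: "\<forall>m. \<exists>k\<le>m. fst (x k) \<le> M" using rc by (auto simp: recurrent_def)
    have "M > 0" using M I by (metis less_le_trans)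
    then have "eventually (\<lambda>k. inverse (fst (x (n - int k))) < inverse M) sequentially"
      by (intro order_tendstoD(2)[OF i0]) simp
    then obtain K where K: "\<And>k. k \<ge> K \<Longrightarrow> inverse (fst (x (n - int k))) < inverse M"
      by (auto simp: eventually_sequentially)
    obtain k where k: "k \<le> n - int K" "fst (x k) \<le> M" using M by blast
    have "inverse (fst (x (n - int (nat (n - k))))) < inverse M"
      using k by (intro K) linarith
    moreover have "n - int (nat (n - k)) = k" using k by simp
    ultimately show False using k(2) I[of k] \<open>M > 0\<close> by (simp add: field_simps)
  qed
  show u: "u = carrier_of x"
  proof
    fix n
    have "u n > 0" using s1 unfolding toda_step_def by simp
    then show "u n = carrier_of x n"
      unfolding carrier_of_def SS[symmetric] S_def using I[of n] by simp
  qed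
  show "x' = toda_map x"
  proof
    fix n
    have "fst (x' n) = snd (x n) + u n" "snd (x' n) = fst (x (n + 1)) * snd (x n) / fst (x' n)"
      using s1 unfolding toda_step_def by blast+
    then show "x' n = toda_map x n"
      unfolding toda_map_def toda_next_def shift_pair_def u by (simp add: prod_eq_iff)
  qed
qed

section \<open>Time reversal by spatial reflection\<close>

lemma reflect_reflect [simp]: "reflect (reflect x) = x"
  by (auto simp: reflect_def fun_eq_iff)

lemma toda_step_reflect:
  assumes "toda_step x u x'"
  shows "toda_step (reflect x') (\<lambda>n. u (- n)) (reflect x)"
  unfolding toda_step_def
proof (intro allI conjI)
  fix n :: int
  have p: "positive_config x" "positive_config x'" using step_positive_config[OF assms] by auto
  then show "fst (reflect x' n) > 0" "snd (reflect x' n) > 0" by (auto simp: reflect_def positive_config_def)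
  show "u (- n) > 0" using assms by (simp add: toda_step_def)
  \<comment> \<open>The reversed step at site \<open>n\<close> undoes the original one at site
    \<open>- n - 1\<close>: the outgoing carrier \<open>u (m + 1) = u (- n)\<close> becomes the
    incoming one.\<close>
  define m where "m = - n - 1"
  have m: "- n = m + 1" "- (n + 1) = m" "m + 1 - 1 = m" by (simp_all add: m_def)
  have e: "fst (x m) > 0" "snd (x m) > 0" "u m > 0" "fst (x' m) = snd (x m) + u m" "fst (x (m + 1)) > 0" "u (m + 1) > 0"
     "u (m + 1) = fst (x (m + 1)) * u m / fst (x' m)" "snd (x' m) = fst (x (m + 1)) * snd (x m) / fst (x' m)"
    using assms unfolding toda_step_def by blast+
  define y where "y = fst (x' m)"
  have y: "y > 0" "fst (x' m) = y" "snd (x m) = y - u m" using e by (auto simp: y_def)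
  have "fst (x (m + 1)) * snd (x m) / y + fst (x (m + 1)) * u m / y = fst (x (m + 1)) * (snd (x m) + u m) / y"
    by (simp add: add_divide_distrib distrib_left)
  also have "\<dots> = fst (x (m + 1))" using y by simp
  finally show a: "fst (reflect x n) = snd (reflect x' n) + u (- n)"
    unfolding reflect_def m fst_conv snd_conv e(8) e(7) y(2) by simp
  show "snd (reflect x n) = fst (reflect x' (n + 1)) * snd (reflect x' n) / fst (reflect x n)"
    unfolding reflect_def m fst_conv snd_conv e(8) y using e y(1) by (simp add: field_simps)
  show "u (- (n + 1)) = fst (reflect x' (n + 1)) * u (- n) / fst (reflect x n)"
    unfolding reflect_def m fst_conv snd_conv e(7) y using e y(1) by (simp add: field_simps)
qed

subsection \<open>Configurations with independent entries\<close>

type_synonym config = "int \<Rightarrow> real \<times> real"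

definition config_space :: "config measure" where
  "config_space = PiM UNIV (\<lambda>_. borel \<Otimes>\<^sub>M borel)"

lemma space_config [simp]: "space config_space = UNIV"
  by (auto simp: config_space_def space_PiM space_pair_measure PiE_def extensional_def)

lemma measurable_config_component [measurable]: "(\<lambda>x. x n) \<in> measurable config_space (borel \<Otimes>\<^sub>M borel)"
  unfolding config_space_def by simp

lemma measurable_configI:
  assumes "\<And>n. (\<lambda>\<omega>. f \<omega> n) \<in> measurable M (borel \<Otimes>\<^sub>M borel)"
  shows "f \<in> measurable M config_space"
  unfolding config_space_def using assms
  by (intro measurable_PiM_single') (auto simp: space_PiM space_pair_measure)

lemma measurable_toda_weight [measurable]: "(\<lambda>x. toda_weight x n k) \<in> borel_measurable config_space"
  unfolding toda_weight_def by measurable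

lemma measurable_toda_sum [measurable]: "(\<lambda>x. toda_sum x n) \<in> borel_measurable config_space"
  unfolding toda_sum_def by measurable

lemma measurable_carrier_of [measurable]: "(\<lambda>x. carrier_of x n) \<in> borel_measurable config_space"
  unfolding carrier_of_def by measurable

lemma measurable_shift_pair [measurable]: "shift_pair \<in> measurable config_space config_space"
  unfolding shift_pair_def by (intro measurable_configI) measurable

lemma measurable_reflect [measurable]: "reflect \<in> measurable config_space config_space"
  unfolding reflect_def by (intro measurable_configI) measurable

lemma measurable_toda_map [measurable]: "toda_map \<in> measurable config_space config_space"
  unfolding toda_map_def toda_next_def shift_pair_def by (intro measurable_configI) measurable

section \<open>Splitting each site into two real coordinates\<close>

definition pair_up :: "(int \<times> bool \<Rightarrow> real) \<Rightarrow> config" where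
  "pair_up z n = (z (n, True), z (n, False))"

definition unpair :: "config \<Rightarrow> int \<times> bool \<Rightarrow> real" where
  "unpair x = (\<lambda>(n, b). if b then fst (x n) else snd (x n))"

lemma unpair_pair_up [simp]: "unpair (pair_up z) = z"
  by (auto simp: unpair_def pair_up_def)

lemma pair_up_unpair [simp]: "pair_up (unpair x) = x"
  by (auto simp: unpair_def pair_up_def)

locale iid =
  fixes \<nu> \<mu> :: "real measure"
  assumes nu: "prob_space \<nu>" "sets \<nu> = sets borel" and mu: "prob_space \<mu>" "sets \<mu> = sets borel"
begin

lemma sets_nu [simp, measurable_cong]: "sets \<nu> = sets borel" and sets_mu [simp, measurable_cong]: "sets \<mu> = sets borel"
  using nu mu by auto

lemma space_nu [simp]: "space \<nu> = UNIV" and space_mu [simp]: "space \<mu> = UNIV"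
  using sets_eq_imp_space_eq[OF nu(2)] sets_eq_imp_space_eq[OF mu(2)] by auto

sublocale nu: prob_space \<nu> by (rule nu)
sublocale mu: prob_space \<mu> by (rule mu)
sublocale site: pair_prob_space \<nu> \<mu> ..

abbreviation "P \<equiv> iid_law \<nu> \<mu>"
abbreviation "site \<equiv> \<nu> \<Otimes>\<^sub>M \<mu>"

lemma sets_site [simp, measurable_cong]: "sets site = sets (borel \<Otimes>\<^sub>M borel)"
  by (intro sets_pair_measure_cong) auto

lemma measurable_site: "f \<in> measurable (borel \<Otimes>\<^sub>M borel) N \<Longrightarrow> f \<in> measurable site N"
  unfolding measurable_cong_sets[OF sets_site refl] .

lemma space_site [simp]: "space site = UNIV"
  by (simp add: space_pair_measure)

lemma sets_P [simp, measurable_cong]: "sets P = sets config_space"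
  unfolding iid_law_def config_space_def by (intro sets_PiM_cong) auto

lemma space_P [simp]: "space P = UNIV"
  using sets_eq_imp_space_eq[OF sets_P] by simp

sublocale prod: product_prob_space "\<lambda>_::int. site" UNIV ..

sublocale P: prob_space P
  unfolding iid_law_def by (rule prod.prob_space_axioms)

text \<open>Reflection and shift treat the two components of a site differently, so the site-indexed product is
  unravelled into a product of real-valued coordinates.\<close>

definition Q :: "(int \<times> bool \<Rightarrow> real) measure" where
  "Q = PiM UNIV (\<lambda>(_, b). if b then \<nu> else \<mu>)"

lemma prob_Q_component: "prob_space (case i of (n::int, b) \<Rightarrow> if b then \<nu> else \<mu>)"
  using nu mu by (auto split: prod.split)

sublocale Q: product_prob_space "\<lambda>(_::int, b). if b then \<nu> else \<mu>" UNIV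
  by (intro product_prob_spaceI prob_Q_component)

sublocale Q': prob_space Q
  unfolding Q_def by (rule Q.prob_space_axioms)

lemma sets_Q [simp, measurable_cong]: "sets Q = sets (PiM UNIV (\<lambda>_. borel))"
  unfolding Q_def by (intro sets_PiM_cong) (auto split: if_splits)

lemma space_Q [simp]: "space Q = UNIV"
  using sets_eq_imp_space_eq[OF sets_Q] by (simp add: space_PiM)

lemma distr_Q_component: "distr Q borel (\<lambda>z. z (n, b)) = (if b then \<nu> else \<mu>)"
proof -
  have "distr Q borel (\<lambda>z. z (n, b)) = distr Q (if b then \<nu> else \<mu>) (\<lambda>z. z (n, b))"
    by (intro distr_cong) auto
  also have "\<dots> = (if b then \<nu> else \<mu>)"
    using Q.PiM_component[of "(n, b)"] unfolding Q_def by simp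
  finally show ?thesis .
qed

lemma indep_Q: "Q'.indep_vars (\<lambda>_. borel) (\<lambda>i z. z i) UNIV"
proof (subst Q'.indep_vars_iff_distr_eq_PiM)
  have "distr Q (PiM UNIV (\<lambda>_. borel)) (\<lambda>x. restrict x UNIV) = distr Q Q (\<lambda>x. x)"
    by (intro distr_cong) auto
  also have "\<dots> = Q" by (rule distr_id)
  also have "\<dots> = PiM UNIV (\<lambda>i. distr Q borel (\<lambda>z. z i))"
    unfolding Q_def[unfolded split_def] using distr_Q_component
    by (intro PiM_cong) (auto simp: split_def Q_def)
  finally show "distr Q (PiM UNIV (\<lambda>_. borel)) (\<lambda>x. \<lambda>i\<in>UNIV. x i) = PiM UNIV (\<lambda>i. distr Q borel (\<lambda>z. z i))" .
qed auto

lemma measurable_pair_up [measurable]: "pair_up \<in> measurable (PiM UNIV (\<lambda>_. borel)) config_space"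
  unfolding pair_up_def by (intro measurable_configI) measurable

lemma measurable_pair_up_Q [measurable]: "pair_up \<in> measurable Q config_space"
  using measurable_pair_up by (simp cong: measurable_cong_sets)

lemma distr_Q_pair: "distr Q (borel \<Otimes>\<^sub>M borel) (\<lambda>z. (z (n, True), z (n, False))) = site"
proof -
  have "Q'.indep_var borel (\<lambda>z. z (n, True)) borel (\<lambda>z. z (n, False))"
    using Q'.indep_var_compose[OF Q'.indep_var_restrict[OF indep_Q, of "{(n, True)}" "{(n, False)}"],
        of "\<lambda>w. w (n, True)" borel "\<lambda>w. w (n, False)" borel] by (simp add: comp_def)
  then show ?thesis
    unfolding Q'.indep_var_distribution_eq by (simp add: distr_Q_component)
qed

text \<open>Disjoint blocks of independent coordinates are independent, and each block of two has
  the law of a site.\<close>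

lemma distr_Q: "distr Q config_space pair_up = P"
proof -
  let ?K = "\<lambda>n::int. {(n, True), (n, False)}"
  have "Q'.indep_vars (\<lambda>n. PiM (?K n) (\<lambda>_. borel)) (\<lambda>n z. restrict z (?K n)) UNIV"
    by (intro Q'.indep_vars_restrict[OF indep_Q]) (auto simp: disjoint_family_on_def)
  from Q'.indep_vars_compose2[OF this, of "\<lambda>n w. (w (n, True), w (n, False))" "\<lambda>_. borel \<Otimes>\<^sub>M borel"]
  have "Q'.indep_vars (\<lambda>_. borel \<Otimes>\<^sub>M borel) (\<lambda>n z. (z (n, True), z (n, False))) UNIV"
    by (simp add: measurable_component_singleton)
  then have "distr Q config_space pair_up = PiM UNIV (\<lambda>n::int. distr Q (borel \<Otimes>\<^sub>M borel) (\<lambda>z. (z (n, True), z (n, False))))"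
    by (subst (asm) Q'.indep_vars_iff_distr_eq_PiM) (auto simp: config_space_def pair_up_def[abs_def] restrict_def)
  also have "\<dots> = P"
    unfolding distr_Q_pair iid_law_def ..
  finally show ?thesis .
qed

text \<open>Injectivity of \<open>g\<close> is what counts: distinct output coordinates read
  distinct, hence independent, input coordinates, and keeping the Boolean keeps the marginal
  law.\<close>

lemma distr_reindex:
  fixes f :: "config \<Rightarrow> config" and g :: "int \<times> bool \<Rightarrow> int \<times> bool"
  assumes g: "inj g" "\<And>n b. snd (g (n, b)) = b"
    and f: "\<And>x. unpair (f x) = unpair x \<circ> g"
    and fm [measurable]: "f \<in> measurable config_space config_space"
  shows "distr P P f = P"
proof -
  have eq: "f (pair_up z) = pair_up (z \<circ> g)" for z
    using f[of "pair_up z"] by (metis pair_up_unpair unpair_pair_up)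
  have gQ: "(case g i of (n, b) \<Rightarrow> if b then \<nu> else \<mu>) = (case i of (n, b) \<Rightarrow> if b then \<nu> else \<mu>)" for i
    using g(2)[of "fst i" "snd i"] by (simp add: split_beta)
  have "distr Q Q (\<lambda>\<omega>. \<omega> \<circ> g) = Q"
    using distr_PiM_reindex[of UNIV "\<lambda>(_::int, b). if b then \<nu> else \<mu>" g UNIV] g prob_Q_component
    unfolding gQ by (simp add: Q_def comp_def restrict_def)
  have "distr P P f = distr (distr Q config_space pair_up) config_space f"
    unfolding distr_Q by (intro distr_cong) auto
  also have "\<dots> = distr Q config_space (f \<circ> pair_up)"
    by (subst distr_distr) auto
  also have "\<dots> = distr Q config_space (pair_up \<circ> (\<lambda>\<omega>. \<omega> \<circ> g))"
    by (intro distr_cong) (auto simp: eq)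
  also have "\<dots> = distr (distr Q Q (\<lambda>\<omega>. \<omega> \<circ> g)) config_space pair_up"
    by (subst distr_distr) (auto simp: comp_def intro!: measurable_PiM_single' cong: measurable_cong_sets)
  also have "\<dots> = P" unfolding \<open>distr Q Q _ = Q\<close> by (rule distr_Q)
  finally show ?thesis .
qed

lemma distr_reflect: "distr P P reflect = P"
  by (rule distr_reindex[where g="\<lambda>(n, b). if b then (- n, b) else (- n - 1, b)"])
     (auto simp: inj_def unpair_def reflect_def fun_eq_iff split: if_splits)

lemma distr_shift: "distr P P shift_pair = P"
  by (rule distr_reindex[where g="\<lambda>(n, b). if b then (n + 1, b) else (n, b)"])
     (auto simp: inj_def unpair_def shift_pair_def fun_eq_iff split: if_splits)

lemma indep_disjoint:
  fixes f g :: "config \<Rightarrow> real"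
  assumes [measurable]: "f \<in> borel_measurable config_space" "g \<in> borel_measurable config_space"
    and f: "\<And>x y. (\<And>i. i \<in> A \<Longrightarrow> unpair x i = unpair y i) \<Longrightarrow> f x = f y"
    and g: "\<And>x y. (\<And>i. i \<in> B \<Longrightarrow> unpair x i = unpair y i) \<Longrightarrow> g x = g y"
    and AB: "A \<inter> B = {}"
  shows "P.indep_var borel f borel g"
proof -
  \<comment> \<open>Coordinates outside \<open>C\<close> are filled with 0. By the locality
    hypotheses this does not change \<open>f\<close> or \<open>g\<close>, which turns them into
    functions of the restrictions to \<open>A\<close> and \<open>B\<close>.\<close>
  define ext where "ext C w i = (if i \<in> C then w i else 0)" for C and w :: "int \<times> bool \<Rightarrow> real" and i
  have ext [measurable]: "ext C \<in> measurable (PiM C (\<lambda>_. borel)) (PiM UNIV (\<lambda>_. borel))" for C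
  proof (intro measurable_PiM_single')
    show "(\<lambda>w. ext C w i) \<in> borel_measurable (PiM C (\<lambda>_. borel))" for i
      by (cases "i \<in> C") (simp_all add: ext_def)
  qed (auto simp: space_PiM)
  have "Q'.indep_var (PiM A (\<lambda>_. borel)) (\<lambda>z. restrict z A) (PiM B (\<lambda>_. borel)) (\<lambda>z. restrict z B)"
    by (intro Q'.indep_var_restrict[OF indep_Q] AB) auto
  from Q'.indep_var_compose[OF this, of "f \<circ> pair_up \<circ> ext A" borel "g \<circ> pair_up \<circ> ext B" borel]
  have "Q'.indep_var borel (\<lambda>z. f (pair_up (ext A (restrict z A)))) borel (\<lambda>z. g (pair_up (ext B (restrict z B))))"
    by (simp add: comp_def)
  moreover have "f (pair_up (ext A (restrict z A))) = f (pair_up z)" for z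
    by (intro f) (auto simp: ext_def)
  moreover have "g (pair_up (ext B (restrict z B))) = g (pair_up z)" for z
    by (intro g) (auto simp: ext_def)
  ultimately have "Q'.indep_var borel (\<lambda>z. f (pair_up z)) borel (\<lambda>z. g (pair_up z))"
    by simp
  then have "distr Q borel (\<lambda>z. f (pair_up z)) \<Otimes>\<^sub>M distr Q borel (\<lambda>z. g (pair_up z)) =
     distr Q (borel \<Otimes>\<^sub>M borel) (\<lambda>z. (f (pair_up z), g (pair_up z)))"
    unfolding Q'.indep_var_distribution_eq by simp
  then have "distr (distr Q config_space pair_up) borel f \<Otimes>\<^sub>M distr (distr Q config_space pair_up) borel g =
     distr (distr Q config_space pair_up) (borel \<Otimes>\<^sub>M borel) (\<lambda>z. (f z, g z))"
    by (simp add: distr_distr comp_def)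
  then show ?thesis
    unfolding P.indep_var_distribution_eq distr_Q by simp
qed

end

text \<open>\<open>T_dT\<close> is defined by a definite description and is only known to agree
  almost surely with the measurable \<open>toda_map\<close>. Passing to the completion makes it
  measurable without changing the image law.\<close>

lemma AE_eq_distr_completion:
  assumes g: "g \<in> measurable M N" and eq: "AE x in M. f x = g x" and f: "f \<in> space M \<rightarrow> space N"
  shows "f \<in> measurable (completion M) N" "distr (completion M) N f = distr M N g"
proof -
  show f': "f \<in> measurable (completion M) N"
  proof (rule measurableI)
    show "x \<in> space (completion M) \<Longrightarrow> f x \<in> space N" for x using f by auto
    fix A assume A: "A \<in> sets N"
    have gA: "g -` A \<inter> space (completion M) \<in> sets (completion M)"
      using measurable_sets[OF measurable_completion[OF g] A] .
    show "f -` A \<inter> space (completion M) \<in> sets (completion M)"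
      using AE_completion[OF eq] by (intro completion.in_sets_AE[OF _ gA]) auto
  qed
  have "distr (completion M) N f = distr (completion M) N g"
    using AE_completion[OF eq] f' measurable_completion[OF g] by (intro distr_cong_AE) auto
  also have "\<dots> = distr M N g" by (rule distr_completion[OF g])
  finally show "distr (completion M) N f = distr M N g" .
qed

subsection \<open>Gamma laws are preserved by the local map\<close>

definition gamma_density :: "real \<Rightarrow> real \<Rightarrow> real \<Rightarrow> real" where
  "gamma_density l c x = (if x > 0 then c powr l * x powr (l - 1) * exp (- c * x) / Gamma l else 0)"

lemma gamma_measure_density: "gamma_measure l c = density lborel (gamma_density l c)"
  unfolding gamma_measure_def gamma_density_def ..

lemma gamma_density_nonneg: "l > 0 \<Longrightarrow> gamma_density l c x \<ge> 0"
  by (auto simp: gamma_density_def intro!: divide_nonneg_pos mult_nonneg_nonneg Gamma_real_pos)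

lemma measurable_gamma_density [measurable]: "gamma_density l c \<in> borel_measurable borel"
  unfolding gamma_density_def by measurable

lemma sets_gamma_measure [simp, measurable_cong]: "sets (gamma_measure l c) = sets borel"
  by (simp add: gamma_measure_def)

lemma space_gamma_measure [simp]: "space (gamma_measure l c) = UNIV"
  by (simp add: gamma_measure_def)

lemma nn_integral_gamma_measure:
  assumes [measurable]: "f \<in> borel_measurable borel"
  shows "(\<integral>\<^sup>+x. f x \<partial>gamma_measure l c) = (\<integral>\<^sup>+x. ennreal (gamma_density l c x) * f x \<partial>lborel)"
  unfolding gamma_measure_density by (subst nn_integral_density) auto

lemma nn_integral_gamma_density:
  assumes l: "l > 0" and c: "c > 0"
  shows "(\<integral>\<^sup>+x. ennreal (gamma_density l c x) \<partial>lborel) = 1"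
proof -
  have "((\<lambda>t. t powr (l - 1) / exp t / Gamma l) has_integral (Gamma l / Gamma l)) {0..}"
    by (intro has_integral_divide Gamma_integral_real l)
  moreover have "Gamma l > 0" using l by (rule Gamma_real_pos)
  ultimately have "((\<lambda>t. t powr (l - 1) / exp t / Gamma l) has_integral 1) {0..}"
    by simp
  then have "1 = (\<integral>\<^sup>+t. ennreal (indicator {0..} t * (t powr (l - 1) / exp t / Gamma l)) \<partial>lborel)"
    using \<open>Gamma l > 0\<close> by (subst nn_integral_has_integral_lebesgue) auto
  also have "(\<integral>\<^sup>+t. ennreal (indicator {0..} t * (t powr (l - 1) / exp t / Gamma l)) \<partial>lborel) =
     (\<integral>\<^sup>+t. ennreal (gamma_density l 1 t) \<partial>lborel)"
    by (intro nn_integral_cong) (auto simp: gamma_density_def indicator_def exp_minus field_simps)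
  also have "\<dots> = ennreal \<bar>c\<bar> * (\<integral>\<^sup>+t. ennreal (gamma_density l 1 (0 + c * t)) \<partial>lborel)"
    using c by (intro nn_integral_real_affine) auto
  also have "\<dots> = (\<integral>\<^sup>+t. ennreal \<bar>c\<bar> * ennreal (gamma_density l 1 (0 + c * t)) \<partial>lborel)"
    by (subst nn_integral_cmult) auto
  also have "\<dots> = (\<integral>\<^sup>+t. ennreal (gamma_density l c t) \<partial>lborel)"
  proof (intro nn_integral_cong)
    fix t
    have "c * c powr (l - 1) = c powr l" using c by (simp add: powr_diff)
    then have "c * gamma_density l 1 (c * t) = gamma_density l c t"
      using c by (auto simp: gamma_density_def powr_mult zero_less_mult_iff)
    then show "ennreal \<bar>c\<bar> * ennreal (gamma_density l 1 (0 + c * t)) = ennreal (gamma_density l c t)"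
      using c l by (simp add: ennreal_mult[symmetric] gamma_density_nonneg)
  qed
  finally show ?thesis ..
qed

lemma prob_space_gamma_measure:
  assumes "l > 0" "c > 0"
  shows "prob_space (gamma_measure l c)"
  by (rule prob_spaceI)
    (use nn_integral_gamma_measure[of "\<lambda>_. 1" l c] nn_integral_gamma_density[OF assms] in simp)

lemma AE_gamma_measure_pos: "AE x in gamma_measure l c. x > 0"
  unfolding gamma_measure_density by (subst AE_density) (auto simp: gamma_density_def)

text \<open>A power times an exponential turns one gamma density into a multiple of another. The
  case \<open>t = 0\<close> gives the fractional moments, \<open>s = 0\<close> the Laplace
  transform.\<close>

lemma nn_integral_gamma_tilt:
  assumes "l > 0" "c > 0" "l + s > 0" "c + t > 0"
  shows "(\<integral>\<^sup>+x. ennreal (x powr s * exp (- t * x)) \<partial>gamma_measure l c) =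
     ennreal (c powr l * Gamma (l + s) / (Gamma l * (c + t) powr (l + s)))"
    (is "_ = ennreal ?K")
proof -
  have G: "Gamma l > 0" "Gamma (l + s) > 0" using assms by (auto intro: Gamma_real_pos)
  have K: "?K \<ge> 0" using G by simp
  have eq: "gamma_density l c x * (x powr s * exp (- t * x)) = ?K * gamma_density (l + s) (c + t) x" for x
  proof (cases "x > 0")
    case True
    have "x powr (l - 1) * x powr s = x powr (l + s - 1)"
      using powr_add[of x "l - 1" s] by (simp add: algebra_simps)
    moreover have "exp (- c * x) * exp (- t * x) = exp (- (c + t) * x)"
      by (simp add: exp_add[symmetric] algebra_simps)
    moreover have "gamma_density l c x * (x powr s * exp (- t * x)) =
      c powr l / Gamma l * ((x powr (l - 1) * x powr s) * (exp (- c * x) * exp (- t * x)))"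
      using True by (simp add: gamma_density_def)
    moreover have "?K * ((c + t) powr (l + s) * y / Gamma (l + s)) = c powr l / Gamma l * y" for y
      using less_imp_neq[OF G(1)] less_imp_neq[OF G(2)] assms by simp
    ultimately show ?thesis
      using True by (simp add: gamma_density_def mult.assoc)
  qed (simp add: gamma_density_def)
  have "(\<integral>\<^sup>+x. ennreal (x powr s * exp (- t * x)) \<partial>gamma_measure l c) =
     (\<integral>\<^sup>+x. ennreal (gamma_density l c x) * ennreal (x powr s * exp (- t * x)) \<partial>lborel)"
    by (intro nn_integral_gamma_measure) auto
  also have "\<dots> = (\<integral>\<^sup>+x. ennreal ?K * ennreal (gamma_density (l + s) (c + t) x) \<partial>lborel)"
    using assms K by (intro nn_integral_cong) (simp only: eq ennreal_mult[symmetric] gamma_density_nonneg powr_ge_zero exp_ge_zero mult_nonneg_nonneg)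
  also have "\<dots> = ennreal ?K"
    using assms by (simp add: nn_integral_cmult nn_integral_gamma_density)
  finally show ?thesis .
qed

text \<open>Substituting \<open>J = S r\<close>, \<open>U = S (1 - r)\<close>: the sum of two independent gamma variables with the same
  scale is independent of their ratio. The normalisation of the law of \<open>r\<close> is irrelevant.\<close>

definition beta_weight :: "real \<Rightarrow> real \<Rightarrow> real \<Rightarrow> real" where
  "beta_weight a b r = (if 0 < r \<and> r < 1 then r powr (a - 1) * (1 - r) powr (b - 1) * Gamma (a + b) / (Gamma a * Gamma b) else 0)"

lemma measurable_beta_weight [measurable]: "beta_weight a b \<in> borel_measurable borel"
  unfolding beta_weight_def by measurable

lemma beta_weight_nonneg: "a > 0 \<Longrightarrow> b > 0 \<Longrightarrow> beta_weight a b r \<ge> 0"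
  by (auto simp: beta_weight_def intro!: divide_nonneg_pos mult_nonneg_nonneg mult_pos_pos Gamma_real_pos less_imp_le)

text \<open>The leading factor \<open>s\<close> is the Jacobian of \<open>j = s * r\<close> at fixed
  \<open>s\<close>.\<close>

lemma gamma_density_split:
  assumes "a > 0" "b > 0" "c > 0" "s > 0"
  shows "s * (gamma_density a c (s * r) * gamma_density b c (s - s * r)) =
    gamma_density (a + b) c s * beta_weight a b r"
proof (cases "0 < r \<and> r < 1")
  case True
  then have r: "0 < s * r" "0 < s - s * r" "s - s * r = s * (1 - r)"
    using assms by (auto simp: algebra_simps)
  have "Gamma a > 0" "Gamma b > 0" "Gamma (a + b) > 0" using assms by (auto intro: Gamma_real_pos)
  then have G: "Gamma a \<noteq> 0" "Gamma b \<noteq> 0" "Gamma (a + b) \<noteq> 0" by linarith+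
  have "s * (s powr (a - 1) * s powr (b - 1)) = s powr (a + b - 1)"
    using assms by (simp add: powr_add[symmetric] powr_mult_base)
  moreover have "exp (- c * (s * r)) * exp (- c * (s * (1 - r))) = exp (- c * s)"
    by (simp add: exp_add[symmetric] algebra_simps)
  moreover have "s * (gamma_density a c (s * r) * gamma_density b c (s - s * r)) =
    c powr a * c powr b / (Gamma a * Gamma b) * (s * (s powr (a - 1) * s powr (b - 1))) *
    (exp (- c * (s * r)) * exp (- c * (s * (1 - r)))) * (r powr (a - 1) * (1 - r) powr (b - 1))"
    using r True assms unfolding gamma_density_def by (simp add: powr_mult)
  ultimately show ?thesis
    using True assms by (simp add: gamma_density_def beta_weight_def powr_add G)
next
  case False
  then have "\<not> (0 < s * r \<and> 0 < s - s * r)"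
    using assms by (auto simp: zero_less_mult_iff algebra_simps)
  with False show ?thesis by (auto simp: gamma_density_def beta_weight_def)
qed

lemma measurable_pair_lborel:
  fixes f :: "real \<times> real \<Rightarrow> 'a"
  assumes "f \<in> measurable (borel \<Otimes>\<^sub>M borel) N"
  shows "f \<in> measurable (borel \<Otimes>\<^sub>M lborel) N" "f \<in> measurable (lborel \<Otimes>\<^sub>M lborel) N"
proof -
  have s: "sets (borel \<Otimes>\<^sub>M lborel) = sets (borel \<Otimes>\<^sub>M (borel :: real measure))"
    "sets (lborel \<Otimes>\<^sub>M lborel) = sets (borel \<Otimes>\<^sub>M (borel :: real measure))"
    by (intro sets_pair_measure_cong; simp)+
  show "f \<in> measurable (borel \<Otimes>\<^sub>M lborel) N" "f \<in> measurable (lborel \<Otimes>\<^sub>M lborel) N"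
    using assms measurable_cong_sets[OF s(1) refl] measurable_cong_sets[OF s(2) refl] by auto
qed

lemma gamma_beta_nn_integral:
  assumes a: "a > 0" "b > 0" "c > 0" and [measurable]: "case_prod k \<in> borel_measurable (borel \<Otimes>\<^sub>M borel)"
  shows "(\<integral>\<^sup>+j. \<integral>\<^sup>+u. k j u \<partial>gamma_measure b c \<partial>gamma_measure a c) =
    (\<integral>\<^sup>+s. \<integral>\<^sup>+r. ennreal (beta_weight a b r) * k (s * r) (s - s * r) \<partial>lborel \<partial>gamma_measure (a + b) c)"
proof -
  let ?f = "\<lambda>a x. ennreal (gamma_density a c x)"
  have "(\<integral>\<^sup>+j. \<integral>\<^sup>+u. k j u \<partial>gamma_measure b c \<partial>gamma_measure a c) =
    (\<integral>\<^sup>+j. (\<integral>\<^sup>+u. ?f b u * k j u \<partial>lborel) \<partial>gamma_measure a c)"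
    by (simp add: nn_integral_gamma_measure)
  also have "\<dots> = (\<integral>\<^sup>+j. ?f a j * (\<integral>\<^sup>+u. ?f b u * k j u \<partial>lborel) \<partial>lborel)"
    by (intro nn_integral_gamma_measure lborel.borel_measurable_nn_integral measurable_pair_lborel(1)) measurable
  also have "\<dots> = (\<integral>\<^sup>+j. (\<integral>\<^sup>+u. ?f a j * (?f b u * k j u) \<partial>lborel) \<partial>lborel)"
    by (simp add: nn_integral_cmult)
  \<comment> \<open>The planar substitution is done by one-dimensional affine ones:
    \<open>u = s - j\<close> at fixed \<open>j\<close>, then an exchange of the integrals, then
    \<open>j = s * r\<close> at fixed \<open>s\<close>.\<close>
  also have "\<dots> = (\<integral>\<^sup>+j. (\<integral>\<^sup>+s. ?f a j * (?f b (s - j) * k j (s - j)) \<partial>lborel) \<partial>lborel)"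
  proof (rule nn_integral_cong)
    fix j
    show "(\<integral>\<^sup>+u. ?f a j * (?f b u * k j u) \<partial>lborel) = (\<integral>\<^sup>+s. ?f a j * (?f b (s - j) * k j (s - j)) \<partial>lborel)"
      by (subst nn_integral_real_affine[where c=1 and t="- j"]) auto
  qed
  also have "\<dots> = (\<integral>\<^sup>+s. (\<integral>\<^sup>+j. ?f a j * (?f b (s - j) * k j (s - j)) \<partial>lborel) \<partial>lborel)"
    by (intro lborel_pair.Fubini' measurable_pair_lborel(2)) measurable
  also have "\<dots> = (\<integral>\<^sup>+s. ?f (a + b) s * (\<integral>\<^sup>+r. ennreal (beta_weight a b r) * k (s * r) (s - s * r) \<partial>lborel) \<partial>lborel)"
  proof (intro nn_integral_cong)
    fix s :: real
    show "(\<integral>\<^sup>+j. ?f a j * (?f b (s - j) * k j (s - j)) \<partial>lborel) =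
      ?f (a + b) s * (\<integral>\<^sup>+r. ennreal (beta_weight a b r) * k (s * r) (s - s * r) \<partial>lborel)"
    proof (cases "s > 0")
      case True
      have "(\<integral>\<^sup>+j. ?f a j * (?f b (s - j) * k j (s - j)) \<partial>lborel) =
         ennreal s * (\<integral>\<^sup>+r. ?f a (s * r) * (?f b (s - s * r) * k (s * r) (s - s * r)) \<partial>lborel)"
        using True by (subst nn_integral_real_affine[where c=s and t=0]) auto
      also have "\<dots> = (\<integral>\<^sup>+r. (ennreal s * (?f a (s * r) * ?f b (s - s * r))) * k (s * r) (s - s * r) \<partial>lborel)"
        by (subst nn_integral_cmult[symmetric]) (auto simp: mult_ac)
      also have "\<dots> = (\<integral>\<^sup>+r. ?f (a + b) s * (ennreal (beta_weight a b r) * k (s * r) (s - s * r)) \<partial>lborel)"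
      proof (intro nn_integral_cong)
        fix r
        have "ennreal s * (?f a (s * r) * ?f b (s - s * r)) = ?f (a + b) s * ennreal (beta_weight a b r)"
          using a True gamma_density_split[OF a True, of r]
          by (simp add: ennreal_mult[symmetric] gamma_density_nonneg beta_weight_nonneg)
        then show "(ennreal s * (?f a (s * r) * ?f b (s - s * r))) * k (s * r) (s - s * r) =
           ?f (a + b) s * (ennreal (beta_weight a b r) * k (s * r) (s - s * r))"
          by (simp add: mult.assoc)
      qed
      also have "\<dots> = ?f (a + b) s * (\<integral>\<^sup>+r. ennreal (beta_weight a b r) * k (s * r) (s - s * r) \<partial>lborel)"
        by (subst nn_integral_cmult) auto
      finally show ?thesis .
    next
      case False
      then have "?f a j * (?f b (s - j) * k j (s - j)) = 0" for j
        by (auto simp: gamma_density_def)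
      moreover have "?f (a + b) s = 0" using False by (simp add: gamma_density_def)
      ultimately show ?thesis by (simp only: nn_integral_const mult_zero_left)
    qed
  qed
  also have "\<dots> = (\<integral>\<^sup>+s. \<integral>\<^sup>+r. ennreal (beta_weight a b r) * k (s * r) (s - s * r) \<partial>lborel \<partial>gamma_measure (a + b) c)"
    by (intro nn_integral_gamma_measure[symmetric] lborel.borel_measurable_nn_integral measurable_pair_lborel(1)) measurable
  finally show ?thesis .
qed

text \<open>After the substitution the local Toda map merely swaps \<open>I\<close> and \<open>S\<close>.\<close>

definition toda_local :: "(real \<times> real) \<times> real \<Rightarrow> (real \<times> real) \<times> real" where
  "toda_local = (\<lambda>(z, u). (toda_next z u, fst z * u / (snd z + u)))"

lemma measurable_toda_next [measurable]:
  "case_prod toda_next \<in> measurable ((borel \<Otimes>\<^sub>M borel) \<Otimes>\<^sub>M borel) (borel \<Otimes>\<^sub>M borel)"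
  unfolding toda_next_def by measurable

lemma measurable_toda_local [measurable]:
  "toda_local \<in> measurable ((borel \<Otimes>\<^sub>M borel) \<Otimes>\<^sub>M borel) ((borel \<Otimes>\<^sub>M borel) \<Otimes>\<^sub>M borel)"
  unfolding toda_local_def toda_next_def by measurable

text \<open>The swap preserves the law because \<open>I\<close> and \<open>J + U\<close> are
  independent and both have law \<open>gamma_measure (a + b) c\<close>. This is what ties the shape
  of \<open>I\<close> to the sum of the other two shapes.\<close>

lemma gamma_detailed_balance:
  assumes a: "a > 0" "b > 0" "c > 0"
    and [measurable]: "h \<in> borel_measurable ((borel \<Otimes>\<^sub>M borel) \<Otimes>\<^sub>M borel)"
  defines "\<pi> \<equiv> gamma_measure (a + b) c \<Otimes>\<^sub>M gamma_measure a c"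
  shows "(\<integral>\<^sup>+z. \<integral>\<^sup>+u. h (toda_local (z, u)) \<partial>gamma_measure b c \<partial>\<pi>) = (\<integral>\<^sup>+z. \<integral>\<^sup>+u. h (z, u) \<partial>gamma_measure b c \<partial>\<pi>)"
proof -
  let ?A = "gamma_measure (a + b) c"
  interpret A: prob_space ?A using a by (intro prob_space_gamma_measure) auto
  interpret B: prob_space "gamma_measure a c" using a by (intro prob_space_gamma_measure) auto
  interpret C: prob_space "gamma_measure b c" using a by (intro prob_space_gamma_measure) auto
  interpret AA: pair_sigma_finite ?A ?A ..
  have fold: "(\<integral>\<^sup>+z. \<integral>\<^sup>+u. g (z, u) \<partial>gamma_measure b c \<partial>\<pi>) =
      (\<integral>\<^sup>+i. \<integral>\<^sup>+j. \<integral>\<^sup>+u. g ((i, j), u) \<partial>gamma_measure b c \<partial>gamma_measure a c \<partial>?A)"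
    if [measurable]: "g \<in> borel_measurable ((borel \<Otimes>\<^sub>M borel) \<Otimes>\<^sub>M borel)" for g :: "(real \<times> real) \<times> real \<Rightarrow> ennreal"
    unfolding \<pi>_def by (subst B.nn_integral_fst[symmetric]) measurable
  \<comment> \<open>Both sides of the claim are double integrals of \<open>?G\<close>, with its two
    arguments interchanged.\<close>
  let ?G = "\<lambda>s i. \<integral>\<^sup>+r. ennreal (beta_weight a b r) * h ((i, s * r), s - s * r) \<partial>lborel"
  have G [measurable]: "(\<lambda>(s, i). ?G s i) \<in> borel_measurable (borel \<Otimes>\<^sub>M borel)"
    by measurable
  have "(\<integral>\<^sup>+z. \<integral>\<^sup>+u. h (toda_local (z, u)) \<partial>gamma_measure b c \<partial>\<pi>) =
     (\<integral>\<^sup>+i. \<integral>\<^sup>+j. \<integral>\<^sup>+u. h ((j + u, i * j / (j + u)), i * u / (j + u)) \<partial>gamma_measure b c \<partial>gamma_measure a c \<partial>?A)"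
    by (subst fold) (simp_all add: toda_local_def toda_next_def)
  also have "\<dots> = (\<integral>\<^sup>+i. \<integral>\<^sup>+s. \<integral>\<^sup>+r. ennreal (beta_weight a b r) *
       h ((s * r + (s - s * r), i * (s * r) / (s * r + (s - s * r))), i * (s - s * r) / (s * r + (s - s * r))) \<partial>lborel \<partial>?A \<partial>?A)"
    by (intro nn_integral_cong gamma_beta_nn_integral a) measurable
  also have "\<dots> = (\<integral>\<^sup>+i. \<integral>\<^sup>+s. ?G i s \<partial>?A \<partial>?A)"
  proof (rule nn_integral_cong, rule nn_integral_cong_AE)
    fix i
    show "AE s in ?A. (\<integral>\<^sup>+r. ennreal (beta_weight a b r) *
       h ((s * r + (s - s * r), i * (s * r) / (s * r + (s - s * r))), i * (s - s * r) / (s * r + (s - s * r))) \<partial>lborel) = ?G i s"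
      using AE_gamma_measure_pos
    proof eventually_elim
      case (elim s)
      have "s * r + (s - s * r) = s" "i * (s * r) / s = i * r" "i * (s - s * r) / s = i - i * r" for r
        using elim by (auto simp: field_simps)
      then show ?case by simp
    qed
  qed
  also have "\<dots> = (\<integral>\<^sup>+s. \<integral>\<^sup>+i. ?G i s \<partial>?A \<partial>?A)"
    by (intro AA.Fubini') measurable
  also have "\<dots> = (\<integral>\<^sup>+i. \<integral>\<^sup>+j. \<integral>\<^sup>+u. h ((i, j), u) \<partial>gamma_measure b c \<partial>gamma_measure a c \<partial>?A)"
    by (intro nn_integral_cong gamma_beta_nn_integral[symmetric] a) measurable
  also have "\<dots> = (\<integral>\<^sup>+z. \<integral>\<^sup>+u. h (z, u) \<partial>gamma_measure b c \<partial>\<pi>)"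
    by (subst fold) simp_all
  finally show ?thesis .
qed

text \<open>Strict convexity of \<open>ln Gamma\<close>: moving two arguments towards each other
  decreases the product. This puts a fractional moment of \<open>J / I\<close> below 1.\<close>

lemma Gamma_product_less:
  assumes "0 < a" "a + s < b - s" "0 < s"
  shows "Gamma (a + s) * Gamma (b - s) < Gamma a * Gamma (b::real)"
proof -
  let ?f = "\<lambda>s. ln_Gamma (a + s) + ln_Gamma (b - s)"
  have "?f s < ?f 0"
  proof (rule DERIV_neg_imp_decreasing[OF \<open>0 < s\<close>])
    fix t assume t: "0 \<le> t" "t \<le> s"
    have "(?f has_real_derivative (Digamma (a + t) - Digamma (b - t))) (at t)"
      using assms t by (auto intro!: derivative_eq_intros)
    moreover have "Digamma (a + t) < Digamma (b - t)"
      using assms t by (intro Digamma_real_strict_mono) auto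
    ultimately show "\<exists>y. (?f has_real_derivative y) (at t) \<and> y < 0"
      by (intro exI[of _ "Digamma (a + t) - Digamma (b - t)"]) auto
  qed
  then have "exp (?f s) < exp (?f 0)" by simp
  then show ?thesis
    using assms by (simp add: exp_add Gamma_real_pos_exp)
qed

subsection \<open>Almost sure properties of independent configurations\<close>

text \<open>For the dynamics of \<open>x\<close> the argument \<open>z\<close> is
  \<open>shift_pair x\<close>, so that \<open>z m\<close> is what the carrier meets at site
  \<open>m\<close>. The recursion peels off the first site, as the induction in
  \<open>window_law\<close> does; \<open>carrier_from_Suc\<close> peels off the last.\<close>

fun carrier_from :: "config \<Rightarrow> int \<Rightarrow> real \<Rightarrow> nat \<Rightarrow> real" where
  "carrier_from z m u 0 = u"
| "carrier_from z m u (Suc k) = carrier_from z (m + 1) (snd (toda_local (z m, u))) k"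

lemma carrier_from_cong:
  "(\<And>j. j \<ge> m \<Longrightarrow> x j = y j) \<Longrightarrow> carrier_from x m u k = carrier_from y m u k"
  by (induction k arbitrary: m u) simp_all

lemma carrier_from_Suc:
  "carrier_from z m u (Suc k) = snd (toda_local (z (m + int k), carrier_from z m u k))"
proof (induction k arbitrary: m u)
  case (Suc k)
  have "carrier_from z m u (Suc (Suc k)) = carrier_from z (m + 1) (snd (toda_local (z m, u))) (Suc k)"
    by simp
  also have "\<dots> = snd (toda_local (z (m + 1 + int k), carrier_from z (m + 1) (snd (toda_local (z m, u))) k))"
    by (rule Suc)
  finally show ?case by (simp add: algebra_simps)
qed simp

lemma measurable_carrier_from [measurable]:
  assumes [measurable]: "f \<in> measurable M config_space" "g \<in> borel_measurable M"
  shows "(\<lambda>\<omega>. carrier_from (f \<omega>) m (g \<omega>) k) \<in> borel_measurable M"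
  using assms
proof (induction k arbitrary: m g)
  case (Suc k)
  note Suc(2,3) [measurable]
  have "(\<lambda>\<omega>. snd (toda_local (f \<omega> m, g \<omega>))) \<in> borel_measurable M"
    by measurable
  from Suc.IH[OF Suc.prems(1) this] show ?case by simp
qed simp

lemma carrier_from_pos:
  assumes "positive_config x" "u > 0"
  shows "carrier_from (shift_pair x) m u k > 0"
proof (induction k)
  case (Suc k)
  then show ?case
    using assms by (auto simp del: carrier_from.simps simp add: carrier_from_Suc toda_local_def shift_pair_def positive_config_def
        intro!: divide_pos_pos mult_pos_pos add_pos_pos)
qed (use assms in simp)

text \<open>A finite sweep obeys the affine recursion of the carrier, started from
  \<open>fst (x m) / u\<close> instead of coming from -\<infinity>; the starting value survives only
  in the last term.\<close>

lemma carrier_from_quotient: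
  assumes "positive_config x" "u > 0"
  shows "fst (x (m + int k)) / carrier_from (shift_pair x) m u k =
    (\<Sum>i<k. toda_weight x (m + int k) i) + toda_weight x (m + int k) k * fst (x m) / u"
proof (induction k)
  case (Suc k)
  define n where "n = m + int k"
  define v where "v = carrier_from (shift_pair x) m u k"
  have n: "m + int (Suc k) = n + 1" by (simp add: n_def)
  have pos: "fst (x n) > 0" "snd (x n) > 0" "fst (x (n + 1)) > 0" "v > 0"
    using assms carrier_from_pos[OF assms] by (auto simp: positive_config_def v_def)
  have "carrier_from (shift_pair x) m u (Suc k) = fst (x (n + 1)) * v / (snd (x n) + v)"
    unfolding carrier_from_Suc by (simp add: n_def v_def toda_local_def shift_pair_def)
  then have "fst (x (n + 1)) / carrier_from (shift_pair x) m u (Suc k) = 1 + snd (x n) / fst (x n) * (fst (x n) / v)"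
    using pos by (simp add: add_divide_distrib)
  also have "fst (x n) / v = (\<Sum>i<k. toda_weight x n i) + toda_weight x n k * fst (x m) / u"
    using Suc by (simp add: n_def v_def)
  also have "1 + snd (x n) / fst (x n) * \<dots> =
      (\<Sum>i<Suc k. toda_weight x (n + 1) i) + toda_weight x (n + 1) (Suc k) * fst (x m) / u"
    unfolding sum.lessThan_Suc_shift toda_weight_Suc_left by (simp add: sum_distrib_left sum_divide_distrib algebra_simps)
  finally show ?case unfolding n .
qed simp

text \<open>The shifted ratios are \<open>J m / I (m + 1)\<close>, so the two products differ only
  by boundary factors. This absorbs the unbounded \<open>fst (x m)\<close> in the remainder of
  \<open>carrier_from_quotient\<close>.\<close>

lemma toda_weight_shift_pair:
  assumes "positive_config x"
  shows "toda_weight x n k * fst (x (n - int k)) = fst (x n) * toda_weight (shift_pair x) n k"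
proof (induction k)
  case (Suc k)
  define m where "m = n - 1 - int k"
  have m: "n - int k = m + 1" "n - int (Suc k) = m" by (simp_all add: m_def)
  have "fst (x m) > 0" "fst (x (m + 1)) > 0" using assms by (auto simp: positive_config_def)
  then show ?case
    using Suc unfolding toda_weight_Suc m m_def[symmetric] by (simp add: shift_pair_def[of x m] field_simps)
qed simp

text \<open>The starting value enters through \<open>toda_weight (shift_pair x) n N / u\<close>;
  contractivity of \<open>shift_pair x\<close> makes this vanish, so the sweep forgets
  \<open>u\<close>.\<close>

lemma carrier_from_limit:
  assumes "contractive x" "contractive (shift_pair x)" "u > 0"
  shows "(\<lambda>N. carrier_from (shift_pair x) (n - int N) u N) \<longlonglongrightarrow> carrier_of x n"
proof -
  have p: "positive_config x" using assms by (simp add: contractive_def)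
  have I: "fst (x n) > 0" using p by (simp add: positive_config_def)
  have eq: "fst (x n) / carrier_from (shift_pair x) (n - int N) u N =
      (\<Sum>i<N. toda_weight x n i) + fst (x n) * toda_weight (shift_pair x) n N / u" for N
    using carrier_from_quotient[OF p assms(3), of "n - int N" N] toda_weight_shift_pair[OF p, of n N] by simp
  have "(\<lambda>N. (\<Sum>i<N. toda_weight x n i) + fst (x n) * toda_weight (shift_pair x) n N / u) \<longlonglongrightarrow>
      toda_sum x n + fst (x n) * 0 / u"
    unfolding toda_sum_def using assms
    by (intro tendsto_intros summable_LIMSEQ summable_LIMSEQ_zero) (auto simp: contractive_def)
  then have "(\<lambda>N. fst (x n) / (fst (x n) / carrier_from (shift_pair x) (n - int N) u N)) \<longlonglongrightarrow>
      fst (x n) / (toda_sum x n + fst (x n) * 0 / u)"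
    unfolding eq[symmetric] using toda_sum_pos[OF assms(1), of n] by (intro tendsto_divide tendsto_const) auto
  then show ?thesis using I by (simp add: carrier_of_def)
qed

section \<open>Recurrence and convergence of the carrier series\<close>

context iid
begin

text \<open>Source of geometric decay: for indicators it bounds long runs of large \<open>I\<close>,
  for powers of \<open>J / I\<close> it gives the moments of \<open>toda_weight\<close>.\<close>

lemma nn_integral_prod_sites:
  assumes [measurable]: "f \<in> borel_measurable (borel \<Otimes>\<^sub>M borel)"
  shows "(\<integral>\<^sup>+x. (\<Prod>i<k. f (x (n - 1 - int i))) \<partial>P) = (\<integral>\<^sup>+z. f z \<partial>site) ^ k"
proof -
  let ?h = "\<lambda>i::nat. n - 1 - int i"
  let ?J = "?h ` {..<k}"
  have inj: "inj_on ?h {..<k}" by (auto simp: inj_on_def)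
  have f: "f \<in> borel_measurable site" by (rule measurable_site) fact
  have "(\<integral>\<^sup>+x. (\<Prod>i<k. f (x (?h i))) \<partial>P) = (\<integral>\<^sup>+x. (\<Prod>j\<in>?J. f (restrict x ?J j)) \<partial>P)"
    by (simp add: prod.reindex[OF inj])
  also have "\<dots> = (\<integral>\<^sup>+x. (\<Prod>j\<in>?J. f (x j)) \<partial>distr P (PiM ?J (\<lambda>_. site)) (\<lambda>x. restrict x ?J))"
    unfolding iid_law_def by (subst nn_integral_distr) (auto intro!: borel_measurable_prod_ennreal measurable_restrict_subset measurable_compose[OF _ f])
  also have "distr P (PiM ?J (\<lambda>_. site)) (\<lambda>x. restrict x ?J) = PiM ?J (\<lambda>_. site)"
    unfolding iid_law_def by (intro prod.distr_PiM_restrict_finite) auto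
  also have "(\<integral>\<^sup>+x. (\<Prod>j\<in>?J. f (x j)) \<partial>PiM ?J (\<lambda>_. site)) = (\<Prod>j\<in>?J. \<integral>\<^sup>+z. f z \<partial>site)"
    by (intro prod.product_nn_integral_prod) (auto intro: f)
  also have "\<dots> = (\<integral>\<^sup>+z. f z \<partial>site) ^ k"
    using inj by (simp add: card_image)
  finally show ?thesis .
qed

lemma distr_component: "distr P (borel \<Otimes>\<^sub>M borel) (\<lambda>x. x n) = site"
proof -
  have "distr P (borel \<Otimes>\<^sub>M borel) (\<lambda>x. x n) = distr P site (\<lambda>x. x n)"
    by (intro distr_cong) auto
  then show ?thesis using prod.PiM_component[of n] by (simp add: iid_law_def)
qed

lemma distr_fst: "distr P borel (\<lambda>x. fst (x n)) = \<nu>" and distr_snd: "distr P borel (\<lambda>x. snd (x n)) = \<mu>"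
proof -
  have "distr P borel (\<lambda>x. fst (x n)) = distr site borel fst"
    using distr_distr[of fst "borel \<Otimes>\<^sub>M borel" borel "\<lambda>x. x n" P] by (simp add: distr_component comp_def)
  also have "\<dots> = distr site \<nu> fst" by (intro distr_cong) auto
  finally show "distr P borel (\<lambda>x. fst (x n)) = \<nu>" by (simp add: mu.distr_pair_fst)
  have "distr P borel (\<lambda>x. snd (x n)) = distr site borel snd"
    using distr_distr[of snd "borel \<Otimes>\<^sub>M borel" borel "\<lambda>x. x n" P] by (simp add: distr_component comp_def)
  also have "\<dots> = \<mu>"
  proof (rule measure_eqI)
    fix A assume "A \<in> sets (distr site borel snd)"
    then have A: "A \<in> sets borel" by simp
    have [measurable]: "snd \<in> measurable site borel"
      using measurable_snd[of \<nu> \<mu>] unfolding measurable_cong_sets[OF refl sets_mu] .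
    have "emeasure (distr site borel snd) A = emeasure site (UNIV \<times> A)"
      using A by (subst emeasure_distr) (auto intro!: arg_cong2[where f=emeasure])
    then show "emeasure (distr site borel snd) A = emeasure \<mu> A"
      using A nu.emeasure_space_1 by (simp add: mu.emeasure_pair_measure_Times)
  qed simp
  finally show "distr P borel (\<lambda>x. snd (x n)) = \<mu>" .
qed

lemma AE_fst:
  assumes "AE t in \<nu>. R t"
  shows "AE x in P. R (fst (x n))"
proof (rule AE_distrD[where f="\<lambda>x. fst (x n)"])
  show "(\<lambda>x. fst (x n)) \<in> measurable P borel" by measurable
qed (subst distr_fst, rule assms)

lemma AE_snd:
  assumes "AE t in \<mu>. R t"
  shows "AE x in P. R (snd (x n))"
proof (rule AE_distrD[where f="\<lambda>x. snd (x n)"])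
  show "(\<lambda>x. snd (x n)) \<in> measurable P borel" by measurable
qed (subst distr_snd, rule assms)

lemma AE_positive_config:
  assumes "AE t in \<nu>. t > 0" "AE t in \<mu>. t > 0"
  shows "AE x in P. positive_config x"
  unfolding positive_config_def AE_all_countable using AE_fst[OF assms(1)] AE_snd[OF assms(2)] by auto

text \<open>Some half-line \<open>{..M}\<close> has positive mass. A run of \<open>N\<close>
  consecutive sites with \<open>I > M\<close> then has probability at most \<open>p ^ N\<close> with
  \<open>p < 1\<close>, so an infinite run to the left is a null event.\<close>

lemma AE_recurrent: "AE x in P. recurrent x"
proof -
  have "(\<lambda>n. measure \<nu> {..real n}) \<longlonglongrightarrow> measure \<nu> (\<Union>n. {..real n})"
    by (intro nu.finite_Lim_measure_incseq) (auto simp: incseq_def)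
  also have "(\<Union>n. {..real n}) = UNIV" using real_arch_simple by auto
  finally have "(\<lambda>n. measure \<nu> {..real n}) \<longlonglongrightarrow> 1" using nu.prob_space by simp
  then have "eventually (\<lambda>n. measure \<nu> {..real n} > 0) sequentially"
    by (rule order_tendstoD) simp
  then obtain n0 where "measure \<nu> {..real n0} > 0" by (auto simp: eventually_sequentially)
  then obtain M where M: "measure \<nu> {..M::real} > 0" by blast
  define p where "p = measure \<nu> {M<..}"
  have "p = 1 - measure \<nu> {..M}"
    using nu.prob_compl[of "{..M}"] by (simp add: p_def Compl_eq_Diff_UNIV[symmetric])
  then have p: "0 \<le> p" "p < 1" using M by (auto simp: p_def)
  let ?f = "\<lambda>z::real \<times> real. indicator {z. fst z > M} z :: ennreal"
  have ind: "(\<integral>\<^sup>+z. ?f z \<partial>site) = ennreal p"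
  proof -
    have "(\<integral>\<^sup>+z. ?f z \<partial>site) = emeasure site ({M<..} \<times> UNIV)"
    proof (subst nn_integral_indicator)
      have eq: "{z::real \<times> real. M < fst z} = {M<..} \<times> UNIV" by auto
      show "{z. M < fst z} \<in> sets site" unfolding eq by simp
      show "emeasure site {z. M < fst z} = emeasure site ({M<..} \<times> UNIV)" unfolding eq ..
    qed
    also have "\<dots> = ennreal p"
      using mu.emeasure_space_1 by (simp add: mu.emeasure_pair_measure_Times p_def nu.emeasure_eq_measure)
    finally show ?thesis .
  qed
  have "AE x in P. \<exists>k\<le>m. fst (x k) \<le> M" for m
  proof -
    let ?B = "{x \<in> space P. \<forall>k\<in>{..m}. fst (x k) > M}"
    have B [measurable]: "?B \<in> sets P" by measurable
    have "emeasure P ?B \<le> ennreal (p ^ N)" for N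
    proof -
      have "emeasure P ?B = (\<integral>\<^sup>+x. indicator ?B x \<partial>P)"
        by (rule nn_integral_indicator[symmetric]) measurable
      also have "\<dots> \<le> (\<integral>\<^sup>+x. (\<Prod>i<N. ?f (x (m + 1 - 1 - int i))) \<partial>P)"
        by (intro nn_integral_mono) (auto simp: indicator_def intro!: prod_nonneg)
      also have "\<dots> = ennreal p ^ N" using nn_integral_prod_sites[of ?f "m + 1" N] ind by simp
      finally show ?thesis using p by (simp add: ennreal_power)
    qed
    moreover have "(\<lambda>N. ennreal (p ^ N)) \<longlonglongrightarrow> ennreal 0"
      using p by (intro tendsto_ennrealI LIMSEQ_power_zero) auto
    ultimately have "emeasure P ?B \<le> ennreal 0" by (intro LIMSEQ_le_const) auto
    then have "?B \<in> null_sets P" by (intro null_setsI B) simp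
    from AE_not_in[OF this] show ?thesis
      by eventually_elim (auto simp: not_less)
  qed
  then have "AE x in P. \<forall>m. \<exists>k\<le>m. fst (x k) \<le> M"
    by (simp add: AE_all_countable)
  then show ?thesis by eventually_elim (auto simp: recurrent_def)
qed

text \<open>The powers \<open>toda_weight x n k powr s\<close> have geometrically decaying means,
  hence are almost surely summable. The weights are thus eventually below 1, where
  \<open>s \<le> 1\<close> makes them smaller than their own powers.\<close>

lemma AE_contractive:
  assumes pos: "AE t in \<nu>. t > 0" "AE t in \<mu>. t > 0"
    and s: "0 < s" "s \<le> 1" and r: "(\<integral>\<^sup>+z. ennreal ((snd z / fst z) powr s) \<partial>site) < 1"
  shows "AE x in P. contractive x"
proof -
  let ?f = "\<lambda>z::real \<times> real. ennreal ((snd z / fst z) powr s)"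
  obtain q where q: "(\<integral>\<^sup>+z. ?f z \<partial>site) = ennreal q" "0 \<le> q" "q < 1"
    using r by (cases "\<integral>\<^sup>+z. ?f z \<partial>site" rule: ennreal_cases) (auto simp: ennreal_less_one_iff)
  have w: "(\<integral>\<^sup>+x. ennreal (toda_weight x n k powr s) \<partial>P) = ennreal (q ^ k)" for n k
  proof -
    have "(\<integral>\<^sup>+x. ennreal (toda_weight x n k powr s) \<partial>P) = (\<integral>\<^sup>+x. (\<Prod>i<k. ?f (x (n - 1 - int i))) \<partial>P)"
    proof (rule nn_integral_cong_AE)
      show "AE x in P. ennreal (toda_weight x n k powr s) = (\<Prod>i<k. ?f (x (n - 1 - int i)))"
        using AE_positive_config[OF pos]
      proof eventually_elim
        case (elim x)
        then have "(\<Prod>i<k. ?f (x (n - 1 - int i))) = ennreal (\<Prod>i<k. (snd (x (n - 1 - int i)) / fst (x (n - 1 - int i))) powr s)"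
          by (intro prod_ennreal) auto
        also have "\<dots> = ennreal (toda_weight x n k powr s)"
          unfolding toda_weight_def using elim by (subst prod_powr_distrib) (auto simp: positive_config_def less_imp_le)
        finally show ?case ..
      qed
    qed
    also have "\<dots> = ennreal q ^ k" using nn_integral_prod_sites[of ?f n k] q by simp
    finally show ?thesis using q by (simp add: ennreal_power)
  qed
  have "AE x in P. summable (\<lambda>k. toda_weight x n k powr s)" for n
  proof -
    have "(\<integral>\<^sup>+x. (\<Sum>k. ennreal (toda_weight x n k powr s)) \<partial>P) = (\<Sum>k. ennreal (q ^ k))"
      by (subst nn_integral_suminf) (auto simp: w)
    also have "\<dots> < \<infinity>"
      using q by (subst suminf_ennreal2) (auto intro: summable_geometric)
    finally have "AE x in P. (\<Sum>k. ennreal (toda_weight x n k powr s)) \<noteq> \<infinity>"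
      by (intro nn_integral_PInf_AE) auto
    then show ?thesis by eventually_elim (auto intro: summable_suminf_not_top)
  qed
  then have "AE x in P. \<forall>n. summable (\<lambda>k. toda_weight x n k powr s)"
    by (simp add: AE_all_countable)
  with AE_positive_config[OF pos] show ?thesis
  proof eventually_elim
    case (elim x)
    have "summable (toda_weight x n)" for n
    proof (rule summable_comparison_test_ev)
      show "summable (\<lambda>k. toda_weight x n k powr s)" using elim by simp
      then have "eventually (\<lambda>k. toda_weight x n k powr s < 1) sequentially"
        by (intro order_tendstoD(2)[OF summable_LIMSEQ_zero]) auto
      then show "eventually (\<lambda>k. norm (toda_weight x n k) \<le> toda_weight x n k powr s) sequentially"
      proof eventually_elim
        case (elim k)
        have w0: "toda_weight x n k > 0" using toda_weight_pos \<open>positive_config x\<close> by blast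
        have "toda_weight x n k \<le> 1"
        proof (rule ccontr)
          assume "\<not> ?thesis"
          then have "1 powr s \<le> toda_weight x n k powr s" using s by (intro powr_mono2) auto
          with elim show False by simp
        qed
        then have "toda_weight x n k powr 1 \<le> toda_weight x n k powr s"
          using s w0 by (intro powr_mono') auto
        then show ?case using w0 by simp
      qed
    qed
    with elim show ?case by (simp add: contractive_def)
  qed
qed

end

subsection \<open>From the local map to the whole line\<close>

text \<open>Multiplication on \<open>ennreal\<close> is discontinuous at 0 times \<infinity>, so
  finiteness of the limit is carried through the induction.\<close>

lemma tendsto_prod_ennreal:
  fixes f :: "'i \<Rightarrow> 'a \<Rightarrow> ennreal"
  assumes "\<And>j. j \<in> F \<Longrightarrow> (f j \<longlongrightarrow> l j) G" "\<And>j. j \<in> F \<Longrightarrow> l j \<noteq> \<top>"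
  shows "((\<lambda>x. \<Prod>j\<in>F. f j x) \<longlongrightarrow> (\<Prod>j\<in>F. l j)) G"
proof -
  have "((\<lambda>x. \<Prod>j\<in>F. f j x) \<longlongrightarrow> (\<Prod>j\<in>F. l j)) G \<and> (\<Prod>j\<in>F. l j) \<noteq> \<top>"
    using assms
  proof (induction F rule: infinite_finite_induct)
    case (insert i F)
    then have "((\<lambda>x. f i x * (\<Prod>j\<in>F. f j x)) \<longlongrightarrow> l i * (\<Prod>j\<in>F. l j)) G"
      by (intro tendsto_mult_ennreal) auto
    with insert show ?case by (auto simp: ennreal_mult_eq_top_iff)
  qed auto
  then show ?thesis ..
qed

text \<open>The carrier started at site \<open>m\<close> from an independent value with law \<open>\<sigma>\<close> produces output with
  exactly the input law. As \<open>m \<rightarrow> -\<infinity>\<close> it forgets its initial value and converges to \<open>carrier_of\<close>.\<close>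

locale balanced = iid +
  fixes \<sigma> :: "real measure"
  assumes sigma: "prob_space \<sigma>" "sets \<sigma> = sets borel"
    and pos: "AE t in \<nu>. t > 0" "AE t in \<mu>. t > 0" "AE t in \<sigma>. t > 0"
    and balance: "\<And>h. h \<in> borel_measurable ((borel \<Otimes>\<^sub>M borel) \<Otimes>\<^sub>M borel) \<Longrightarrow>
      (\<integral>\<^sup>+z. \<integral>\<^sup>+u. h (toda_local (z, u)) \<partial>\<sigma> \<partial>(\<nu> \<Otimes>\<^sub>M \<mu>)) = (\<integral>\<^sup>+z. \<integral>\<^sup>+u. h (z, u) \<partial>\<sigma> \<partial>(\<nu> \<Otimes>\<^sub>M \<mu>))"
    and contr: "AE x in iid_law \<nu> \<mu>. contractive x"
begin

lemma sets_sigma [simp, measurable_cong]: "sets \<sigma> = sets borel"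
  by (rule sigma)

sublocale sigma: prob_space \<sigma> by (rule sigma)
sublocale joint: pair_prob_space P \<sigma> ..
sublocale site_sigma: pair_prob_space site \<sigma> ..

text \<open>Induction from the left end: \<open>balance\<close> exchanges site and carrier for
  output and outgoing carrier without changing the joint law. The output factor splits off, and an
  independent carrier of law \<sigma> enters site \<open>m + 1\<close>.\<close>

lemma window_law:
  assumes g [measurable]: "\<And>j. g j \<in> borel_measurable (borel \<Otimes>\<^sub>M borel)"
  shows "(\<integral>\<^sup>+u. \<integral>\<^sup>+x. (\<Prod>i<k. g (m + int i) (toda_next (x (m + int i)) (carrier_from x m u i))) \<partial>P \<partial>\<sigma>)
    = (\<Prod>i<k. \<integral>\<^sup>+z. g (m + int i) z \<partial>site)"
proof (induction k arbitrary: m)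
  case 0
  then show ?case using P.emeasure_space_1 sigma.emeasure_space_1 by simp
next
  case (Suc k)
  define H where "H m k u = (\<integral>\<^sup>+x. (\<Prod>i<k. g (m + int i) (toda_next (x (m + int i)) (carrier_from x m u i))) \<partial>P)" for m k u
  have H [measurable]: "H m k \<in> borel_measurable borel" for m k
    unfolding H_def by measurable
  \<comment> \<open>Site \<open>m\<close> is replaced by an independent copy \<open>z\<close>, which
    separates it from the sites to its right; these enter only through the outgoing carrier.\<close>
  have step: "H m (Suc k) u = (\<integral>\<^sup>+z. g m (fst (toda_local (z, u))) * H (m + 1) k (snd (toda_local (z, u))) \<partial>site)" for u
  proof -
    define F where "F x = (\<Prod>i<Suc k. g (m + int i) (toda_next (x (m + int i)) (carrier_from x m u i)))" for x
    have F [measurable]: "F \<in> borel_measurable config_space" unfolding F_def by measurable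
    have upd [measurable]: "(\<lambda>(z, x). x(m := z)) \<in> measurable (site \<Otimes>\<^sub>M P) config_space"
      unfolding fun_upd_def by (intro measurable_configI) (auto simp: split_beta')
    have "distr (site \<Otimes>\<^sub>M P) P (\<lambda>(z, x). x(m := z)) = P"
      using distr_pair_PiM_eq_PiM[of UNIV "\<lambda>_. site" m] site.prob_space_axioms by (simp add: iid_law_def)
    then have "H m (Suc k) u = (\<integral>\<^sup>+x. F x \<partial>distr (site \<Otimes>\<^sub>M P) P (\<lambda>(z, x). x(m := z)))"
      by (simp only: H_def F_def)
    also have "\<dots> = (\<integral>\<^sup>+zx. F ((snd zx)(m := fst zx)) \<partial>(site \<Otimes>\<^sub>M P))"
      by (subst nn_integral_distr) (auto simp: split_beta' cong: measurable_cong_sets)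
    also have "\<dots> = (\<integral>\<^sup>+z. \<integral>\<^sup>+x. F (x(m := z)) \<partial>P \<partial>site)"
      using upd by (subst P.nn_integral_fst[symmetric]) (auto simp: split_beta')
    also have "\<dots> = (\<integral>\<^sup>+z. g m (fst (toda_local (z, u))) * H (m + 1) k (snd (toda_local (z, u))) \<partial>site)"
    proof (rule nn_integral_cong)
      fix z
      have cf: "carrier_from (x(m := z)) (m + 1) v i = carrier_from x (m + 1) v i" for x v i
        by (rule carrier_from_cong) auto
      have "F (x(m := z)) = g m (fst (toda_local (z, u))) *
         (\<Prod>i<k. g (m + 1 + int i) (toda_next (x (m + 1 + int i)) (carrier_from x (m + 1) (snd (toda_local (z, u))) i)))" for x
        unfolding F_def prod.lessThan_Suc_shift
        by (simp add: cf cf[unfolded add.commute[of m 1]] toda_local_def algebra_simps)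
      then show "(\<integral>\<^sup>+x. F (x(m := z)) \<partial>P) = g m (fst (toda_local (z, u))) * H (m + 1) k (snd (toda_local (z, u)))"
        unfolding H_def by (simp add: nn_integral_cmult)
    qed
    finally show ?thesis .
  qed
  let ?h = "\<lambda>yv. g m (fst yv) * H (m + 1) k (snd yv)"
  have "(\<integral>\<^sup>+u. H m (Suc k) u \<partial>\<sigma>) = (\<integral>\<^sup>+z. \<integral>\<^sup>+u. ?h (toda_local (z, u)) \<partial>\<sigma> \<partial>site)"
    unfolding step by (intro site_sigma.Fubini') measurable
  also have "\<dots> = (\<integral>\<^sup>+z. \<integral>\<^sup>+u. ?h (z, u) \<partial>\<sigma> \<partial>site)"
    by (intro balance) measurable
  also have "\<dots> = (\<integral>\<^sup>+z. g m z \<partial>site) * (\<integral>\<^sup>+u. H (m + 1) k u \<partial>\<sigma>)"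
  proof -
    have "g m \<in> borel_measurable site" by (rule measurable_site) (rule g)
    then show ?thesis by (simp add: nn_integral_cmult nn_integral_multc)
  qed
  also have "(\<integral>\<^sup>+u. H (m + 1) k u \<partial>\<sigma>) = (\<Prod>i<k. \<integral>\<^sup>+z. g (m + 1 + int i) z \<partial>site)"
    unfolding H_def by (rule Suc)
  also have "(\<integral>\<^sup>+z. g m z \<partial>site) * \<dots> = (\<Prod>i<Suc k. \<integral>\<^sup>+z. g (m + int i) z \<partial>site)"
    unfolding prod.lessThan_Suc_shift by (simp add: algebra_simps)
  finally show ?case unfolding H_def .
qed

text \<open>Sites outside \<open>F\<close> receive the constant test function 1. Since
  \<open>shift_pair\<close> preserves the law, the sweep may run over \<open>shift_pair x\<close>,
  as the dynamics requires.\<close>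

lemma window_finite:
  assumes g [measurable]: "\<And>j. g j \<in> borel_measurable (borel \<Otimes>\<^sub>M borel)"
    and F: "finite F" "\<And>j. j \<in> F \<Longrightarrow> m \<le> j"
  shows "(\<integral>\<^sup>+xu. (\<Prod>j\<in>F. g j (toda_next (shift_pair (fst xu) j) (carrier_from (shift_pair (fst xu)) m (snd xu) (nat (j - m))))) \<partial>(P \<Otimes>\<^sub>M \<sigma>))
    = (\<Prod>j\<in>F. \<integral>\<^sup>+z. g j z \<partial>site)"
proof -
  obtain k where k: "\<And>j. j \<in> F \<Longrightarrow> j < m + int k"
  proof -
    show ?thesis by (rule that[of "nat (Max F - m + 1)"]) (use Max_ge[OF F(1)] in force)
  qed
  let ?g = "\<lambda>j. if j \<in> F then g j else (\<lambda>_. 1)"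
  let ?h = "\<lambda>i. m + int i"
  have gm [measurable]: "?g j \<in> borel_measurable (borel \<Otimes>\<^sub>M borel)" for j by simp
  have prod_eq: "(\<Prod>j\<in>F. f j) = (\<Prod>i<k. if ?h i \<in> F then f (?h i) else 1)" for f :: "int \<Rightarrow> ennreal"
  proof -
    have inj: "inj_on ?h {..<k}" by (auto simp: inj_on_def)
    have sub: "F \<subseteq> ?h ` {..<k}"
    proof
      fix j assume "j \<in> F"
      then show "j \<in> ?h ` {..<k}" using k[of j] F(2)[of j] by (intro image_eqI[of _ _ "nat (j - m)"]) auto
    qed
    have "(\<Prod>i<k. if ?h i \<in> F then f (?h i) else 1) = (\<Prod>j\<in>?h ` {..<k}. if j \<in> F then f j else 1)"
      by (simp add: prod.reindex[OF inj])
    also have "\<dots> = (\<Prod>j\<in>F. if j \<in> F then f j else 1)"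
      using sub by (intro prod.mono_neutral_right) auto
    finally show ?thesis by simp
  qed
  define G where "G x u = (\<Prod>j\<in>F. g j (toda_next (x j) (carrier_from x m u (nat (j - m)))))" for x u
  have Gm [measurable]: "(\<lambda>\<omega>. G (f \<omega>) (h \<omega>)) \<in> borel_measurable M"
    if [measurable]: "f \<in> measurable M config_space" "h \<in> borel_measurable M" for f h and M :: "'z measure"
    unfolding G_def by measurable
  have "(\<integral>\<^sup>+xu. G (shift_pair (fst xu)) (snd xu) \<partial>(P \<Otimes>\<^sub>M \<sigma>)) = (\<integral>\<^sup>+u. \<integral>\<^sup>+x. G (shift_pair x) u \<partial>P \<partial>\<sigma>)"
    by (subst joint.nn_integral_snd[symmetric]) auto
  also have "\<dots> = (\<integral>\<^sup>+u. \<integral>\<^sup>+x. G x u \<partial>distr P P shift_pair \<partial>\<sigma>)"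
    by (intro nn_integral_cong, subst nn_integral_distr) (auto cong: measurable_cong_sets)
  also have "\<dots> = (\<integral>\<^sup>+u. \<integral>\<^sup>+x. (\<Prod>i<k. ?g (m + int i) (toda_next (x (m + int i)) (carrier_from x m u i))) \<partial>P \<partial>\<sigma>)"
    unfolding distr_shift G_def prod_eq by (intro nn_integral_cong prod.cong) auto
  also have "\<dots> = (\<Prod>i<k. \<integral>\<^sup>+z. ?g (m + int i) z \<partial>site)"
    by (rule window_law) (rule gm)
  also have "\<dots> = (\<Prod>j\<in>F. \<integral>\<^sup>+z. g j z \<partial>site)"
    unfolding prod_eq using site.emeasure_space_1 by (intro prod.cong) auto
  finally show ?thesis unfolding G_def .
qed

text \<open>Sweeps started at site \<open>- N\<close> converge almost surely to
  \<open>toda_map\<close>, but no more than pointwise; bounded continuous test functions are what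
  carries the product formula to the limit.\<close>

lemma toda_map_continuous_test:
  fixes g :: "int \<Rightarrow> real \<times> real \<Rightarrow> real"
  assumes g: "\<And>j. continuous_on UNIV (g j)" "\<And>j z. 0 \<le> g j z" "\<And>j z. g j z \<le> 1" and F: "finite F"
  shows "(\<integral>\<^sup>+x. (\<Prod>j\<in>F. ennreal (g j (toda_map x j))) \<partial>P) = (\<Prod>j\<in>F. \<integral>\<^sup>+z. ennreal (g j z) \<partial>site)"
proof -
  have gm [measurable]: "g j \<in> borel_measurable (borel \<Otimes>\<^sub>M borel)" for j
    unfolding borel_prod by (intro borel_measurable_continuous_onI g)
  define A where "A N xu = (\<Prod>j\<in>F. ennreal (g j (toda_next (shift_pair (fst xu) j)
      (carrier_from (shift_pair (fst xu)) (- int N) (snd xu) (nat (j + int N))))))" for N :: nat and xu :: "config \<times> real"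
  define B where "B xu = (\<Prod>j\<in>F. ennreal (g j (toda_map (fst xu) j)))" for xu :: "config \<times> real"
  have [measurable]: "A N \<in> borel_measurable (P \<Otimes>\<^sub>M \<sigma>)" for N unfolding A_def by measurable
  have [measurable]: "B \<in> borel_measurable (P \<Otimes>\<^sub>M \<sigma>)" unfolding B_def by measurable
  obtain K where K: "\<And>j. j \<in> F \<Longrightarrow> - int K \<le> j"
  proof -
    show ?thesis by (rule that[of "nat (- Min F)"]) (use Min_le[OF F] in force)
  qed
  have A: "(\<integral>\<^sup>+xu. A N xu \<partial>(P \<Otimes>\<^sub>M \<sigma>)) = (\<Prod>j\<in>F. \<integral>\<^sup>+z. ennreal (g j z) \<partial>site)" if "N \<ge> K" for N
    using window_finite[of "\<lambda>j z. ennreal (g j z)" F "- int N"] F K that unfolding A_def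
    by (force intro: order_trans)
  have good: "AE xu in P \<Otimes>\<^sub>M \<sigma>. contractive (fst xu) \<and> contractive (shift_pair (fst xu)) \<and> snd xu > 0"
  proof -
    have "AE x in P. contractive (shift_pair x)"
    proof (rule AE_distrD[where f=shift_pair and M'=P])
      show "shift_pair \<in> measurable P P" by measurable
    qed (unfold distr_shift, rule contr)
    with contr have "AE x in distr (P \<Otimes>\<^sub>M \<sigma>) P fst. contractive x \<and> contractive (shift_pair x)"
      by (subst sigma.distr_pair_fst) auto
    then have 1: "AE xu in P \<Otimes>\<^sub>M \<sigma>. contractive (fst xu) \<and> contractive (shift_pair (fst xu))"
      by (rule AE_distrD[rotated]) simp
    have "AE xu in P \<Otimes>\<^sub>M \<sigma>. snd xu > 0"
    proof (rule joint.AE_pair_measure)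
      show "{xu \<in> space (P \<Otimes>\<^sub>M \<sigma>). snd xu > 0} \<in> sets (P \<Otimes>\<^sub>M \<sigma>)" by measurable
    qed (use pos in auto)
    with 1 show ?thesis by eventually_elim auto
  qed
  have lim: "(\<lambda>N. A N xu) \<longlonglongrightarrow> B xu"
    if c: "contractive (fst xu)" "contractive (shift_pair (fst xu))" "snd xu > 0" for xu
    unfolding A_def B_def
  proof (intro tendsto_prod_ennreal tendsto_ennrealI)
    fix j assume j: "j \<in> F"
    define x where "x = fst xu"
    let ?v = "\<lambda>M. carrier_from (shift_pair x) (j - int M) (snd xu) M"
    let ?w = "\<lambda>N. carrier_from (shift_pair x) (- int N) (snd xu) (nat (j + int N))"
    have "?v \<longlonglongrightarrow> carrier_of x j"
      using c by (intro carrier_from_limit) (auto simp: x_def)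
    moreover have "filterlim (\<lambda>N. nat (j + int N)) at_top sequentially"
      unfolding filterlim_at_top eventually_sequentially
      by (intro allI, rule_tac x="nat (\<bar>j\<bar> + int Z)" in exI) auto
    ultimately have "(\<lambda>N. ?v (nat (j + int N))) \<longlonglongrightarrow> carrier_of x j"
      by (rule filterlim_compose)
    \<comment> \<open>Once \<open>N \<ge> K\<close> the conversion by \<open>nat\<close> is exact,
      and \<open>j - int (nat (j + int N))\<close> is the starting site
      \<open>- int N\<close>.\<close>
    moreover have "eventually (\<lambda>N. ?v (nat (j + int N)) = ?w N) sequentially"
      using K[OF j] unfolding eventually_sequentially by (intro exI[of _ K]) auto
    ultimately have w: "?w \<longlonglongrightarrow> carrier_of x j"
      by (rule Lim_transform_eventually)
    have "snd (shift_pair x j) + carrier_of x j > 0"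
      using toda_step_toda_map[of x] c(1) unfolding x_def[symmetric] toda_step_def shift_pair_def by (auto intro: add_pos_pos)
    then have "(\<lambda>N. toda_next (shift_pair x j) (?w N)) \<longlonglongrightarrow> toda_map x j"
      unfolding toda_map_def toda_next_def by (intro tendsto_intros w) auto
    moreover have "isCont (g j) (toda_map x j)" using continuous_on_eq_continuous_at[OF open_UNIV, of "g j"] g(1)[of j] by blast
    ultimately show "(\<lambda>N. g j (toda_next (shift_pair (fst xu) j) (carrier_from (shift_pair (fst xu)) (- int N) (snd xu) (nat (j + int N)))))
       \<longlonglongrightarrow> g j (toda_map (fst xu) j)"
      unfolding x_def by (rule isCont_tendsto_compose[rotated])
  qed simp
  have "(\<lambda>N. \<integral>\<^sup>+xu. A N xu \<partial>(P \<Otimes>\<^sub>M \<sigma>)) \<longlonglongrightarrow> (\<integral>\<^sup>+xu. B xu \<partial>(P \<Otimes>\<^sub>M \<sigma>))"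
  proof (rule nn_integral_dominated_convergence[where w="\<lambda>_. 1"])
    show "AE xu in P \<Otimes>\<^sub>M \<sigma>. A N xu \<le> 1" for N
      unfolding A_def using g by (intro AE_I2 prod_le_1) auto
    show "(\<integral>\<^sup>+xu. 1 \<partial>(P \<Otimes>\<^sub>M \<sigma>)) < \<infinity>" by (simp add: joint.emeasure_space_1)
    show "AE xu in P \<Otimes>\<^sub>M \<sigma>. (\<lambda>N. A N xu) \<longlonglongrightarrow> B xu"
      using good by eventually_elim (auto intro: lim)
  qed auto
  moreover have "(\<lambda>N. \<integral>\<^sup>+xu. A N xu \<partial>(P \<Otimes>\<^sub>M \<sigma>)) \<longlonglongrightarrow> (\<Prod>j\<in>F. \<integral>\<^sup>+z. ennreal (g j z) \<partial>site)"
    by (rule tendsto_eventually) (auto simp: eventually_sequentially intro: exI[of _ K] A)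
  ultimately have "(\<integral>\<^sup>+xu. B xu \<partial>(P \<Otimes>\<^sub>M \<sigma>)) = (\<Prod>j\<in>F. \<integral>\<^sup>+z. ennreal (g j z) \<partial>site)"
    by (rule LIMSEQ_unique)
  moreover have "(\<integral>\<^sup>+xu. B xu \<partial>(P \<Otimes>\<^sub>M \<sigma>)) = (\<integral>\<^sup>+x. (\<Prod>j\<in>F. ennreal (g j (toda_map x j))) \<partial>P)"
    unfolding B_def using sigma.emeasure_space_1 by (subst sigma.nn_integral_fst[symmetric]) auto
  ultimately show ?thesis by simp
qed

text \<open>The indicator of an open set is the pointwise limit of the truncated multiples of the
  distance to its complement.\<close>

lemma toda_map_open:
  assumes A: "\<And>j. open (A j)" and F: "finite F"
  shows "emeasure P {x. \<forall>j\<in>F. toda_map x j \<in> A j} = (\<Prod>j\<in>F. emeasure site (A j))"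
proof -
  \<comment> \<open>The case \<open>A j = UNIV\<close> is separate because \<open>infdist\<close> to
    the empty set is 0 by convention, which would give the zero function instead of 1.\<close>
  define g where "g k j z = (if A j = UNIV then 1 else min 1 (real k * infdist z (- A j)))" for k :: nat and j z
  have g: "continuous_on UNIV (g k j)" "0 \<le> g k j z" "g k j z \<le> 1" for k j z
    unfolding g_def by (cases "A j = UNIV"; auto intro!: continuous_intros continuous_on_min mult_nonneg_nonneg infdist_nonneg)+
  have gm [measurable]: "g k j \<in> borel_measurable (borel \<Otimes>\<^sub>M borel)" for k j
    unfolding borel_prod by (intro borel_measurable_continuous_onI g)
  have Am [measurable]: "A j \<in> sets (borel \<Otimes>\<^sub>M borel)" for j
    unfolding borel_prod using A by auto
  have lim: "(\<lambda>k. ennreal (g k j z)) \<longlonglongrightarrow> indicator (A j) z" for j z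
  proof (cases "A j = UNIV")
    case False
    show ?thesis
    proof (cases "z \<in> A j")
      case True
      have "infdist z (- A j) > 0"
        using False True A[of j] in_closed_iff_infdist_zero[of "- A j" z] infdist_nonneg[of z "- A j"] by (auto simp: less_le)
      then obtain K where K: "1 < real K * infdist z (- A j)" using reals_Archimedean3 by blast
      have "g k j z = 1" if "k \<ge> K" for k
      proof -
        have "real K * infdist z (- A j) \<le> real k * infdist z (- A j)"
          using that infdist_nonneg by (intro mult_right_mono) auto
        with K show ?thesis by (simp add: g_def)
      qed
      then have "eventually (\<lambda>k. ennreal (g k j z) = indicator (A j) z) sequentially"
        using True by (auto simp: eventually_sequentially intro!: exI[of _ K])
      then show ?thesis by (rule tendsto_eventually)
    next
      case z: False
      then have "g k j z = 0" for k using False by (simp add: g_def infdist_zero)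
      then show ?thesis using z by simp
    qed
  qed (simp add: g_def)
  have "(\<lambda>k. \<integral>\<^sup>+x. (\<Prod>j\<in>F. ennreal (g k j (toda_map x j))) \<partial>P) \<longlonglongrightarrow> (\<integral>\<^sup>+x. (\<Prod>j\<in>F. indicator (A j) (toda_map x j)) \<partial>P)"
  proof (rule nn_integral_dominated_convergence[where w="\<lambda>_. 1"])
    show "AE x in P. (\<Prod>j\<in>F. ennreal (g k j (toda_map x j))) \<le> 1" for k
      using g by (intro AE_I2 prod_le_1) auto
    show "AE x in P. (\<lambda>k. \<Prod>j\<in>F. ennreal (g k j (toda_map x j))) \<longlonglongrightarrow> (\<Prod>j\<in>F. indicator (A j) (toda_map x j))"
      by (intro AE_I2 tendsto_prod_ennreal lim) (simp add: indicator_def)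
  qed (use P.emeasure_space_1 in simp_all)
  moreover have "(\<integral>\<^sup>+x. (\<Prod>j\<in>F. ennreal (g k j (toda_map x j))) \<partial>P) = (\<Prod>j\<in>F. \<integral>\<^sup>+z. ennreal (g k j z) \<partial>site)" for k
    by (intro toda_map_continuous_test g F)
  moreover have "(\<lambda>k. \<Prod>j\<in>F. \<integral>\<^sup>+z. ennreal (g k j z) \<partial>site) \<longlonglongrightarrow> (\<Prod>j\<in>F. \<integral>\<^sup>+z. indicator (A j) z \<partial>site)"
  proof (intro tendsto_prod_ennreal)
    fix j
    show "(\<lambda>k. \<integral>\<^sup>+z. ennreal (g k j z) \<partial>site) \<longlonglongrightarrow> (\<integral>\<^sup>+z. indicator (A j) z \<partial>site)"
      using g lim site.emeasure_space_1
      by (intro nn_integral_dominated_convergence[where w="\<lambda>_. 1"])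
        (auto intro!: measurable_site gm borel_measurable_indicator)
  qed simp
  ultimately have "(\<integral>\<^sup>+x. (\<Prod>j\<in>F. indicator (A j) (toda_map x j)) \<partial>P) = (\<Prod>j\<in>F. \<integral>\<^sup>+z. indicator (A j) z \<partial>site)"
    using LIMSEQ_unique by simp
  also have "(\<integral>\<^sup>+x. (\<Prod>j\<in>F. indicator (A j) (toda_map x j)) \<partial>P) = (\<integral>\<^sup>+x. indicator {x. \<forall>j\<in>F. toda_map x j \<in> A j} x \<partial>P)"
    using F by (intro nn_integral_cong) (auto simp: indicator_def intro: prod_zero)
  also have "\<dots> = emeasure P {x. \<forall>j\<in>F. toda_map x j \<in> A j}"
  proof (rule nn_integral_indicator)
    have "{x \<in> space config_space. \<forall>j\<in>F. toda_map x j \<in> A j} \<in> sets config_space"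
      using F by measurable
    then show "{x. \<forall>j\<in>F. toda_map x j \<in> A j} \<in> sets P" by simp
  qed
  finally show ?thesis by simp
qed

section \<open>From open sets to Borel sets, and from finitely many sites to the whole line\<close>

lemma sets_borel_pair: "sets (borel \<Otimes>\<^sub>M borel :: (real \<times> real) measure) = sigma_sets UNIV {S. open S}"
  unfolding borel_prod by (simp add: borel_def)

lemma toda_map_component: "distr P (borel \<Otimes>\<^sub>M borel) (\<lambda>x. toda_map x j) = site"
proof (rule measure_eqI_generator_eq[where E="{S. open S}" and \<Omega>=UNIV and A="\<lambda>_. UNIV"])
  show "Int_stable {S :: (real \<times> real) set. open S}" by (auto simp: Int_stable_def)
  show "sets (distr P (borel \<Otimes>\<^sub>M borel) (\<lambda>x. toda_map x j)) = sigma_sets UNIV {S. open S}"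
    by (simp add: sets_borel_pair)
  show "sets site = sigma_sets UNIV {S. open S}" by (simp add: sets_borel_pair)
  interpret D: prob_space "distr P (borel \<Otimes>\<^sub>M borel) (\<lambda>x. toda_map x j)"
    by (rule P.prob_space_distr) measurable
  show "emeasure (distr P (borel \<Otimes>\<^sub>M borel) (\<lambda>x. toda_map x j)) UNIV \<noteq> \<infinity>"
    using D.emeasure_finite by simp
  fix S :: "(real \<times> real) set" assume S: "S \<in> {S. open S}"
  then have "S \<in> sets (borel \<Otimes>\<^sub>M borel)" unfolding borel_prod by auto
  then have "emeasure (distr P (borel \<Otimes>\<^sub>M borel) (\<lambda>x. toda_map x j)) S = emeasure P {x. \<forall>j\<in>{j}. toda_map x j \<in> S}"
    by (subst emeasure_distr) (auto intro!: arg_cong2[where f=emeasure])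
  also have "\<dots> = emeasure site S"
    using toda_map_open[of "\<lambda>_. S" "{j}"] S by simp
  finally show "emeasure (distr P (borel \<Otimes>\<^sub>M borel) (\<lambda>x. toda_map x j)) S = emeasure site S" .
qed auto

lemma toda_map_indep:
  assumes "finite F" "F \<noteq> {}"
  shows "P.indep_vars (\<lambda>_. borel \<Otimes>\<^sub>M borel) (\<lambda>j x. toda_map x j) F"
proof (subst P.indep_vars_finite[where E="\<lambda>_. {S. open S}"])
  have o: "emeasure P {x. toda_map x j \<in> A} = emeasure site A" if "open A" for j A
    using toda_map_open[of "\<lambda>_. A" "{j}"] that by simp
  show "\<forall>A\<in>F \<rightarrow> {S. open S}. P.prob (\<Inter>j\<in>F. (\<lambda>x. toda_map x j) -` A j \<inter> space P) =
          (\<Prod>j\<in>F. P.prob ((\<lambda>x. toda_map x j) -` A j \<inter> space P))"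
  proof
    fix A :: "int \<Rightarrow> (real \<times> real) set" assume A: "A \<in> F \<rightarrow> {S. open S}"
    define B where "B j = (if j \<in> F then A j else UNIV)" for j
    have "(\<Inter>j\<in>F. (\<lambda>x. toda_map x j) -` A j \<inter> space P) = {x. \<forall>j\<in>F. toda_map x j \<in> B j}"
      using assms by (auto simp: B_def)
    moreover have "(\<lambda>x. toda_map x j) -` A j \<inter> space P = {x. toda_map x j \<in> B j}" if "j \<in> F" for j
      using that by (auto simp: B_def)
    moreover have oB: "open (B j)" for j using A by (auto simp: B_def)
    have "ennreal (P.prob {x. \<forall>j\<in>F. toda_map x j \<in> B j}) = ennreal (\<Prod>j\<in>F. P.prob {x. toda_map x j \<in> B j})"
      using toda_map_open[OF oB assms(1)]
      by (simp add: P.emeasure_eq_measure[symmetric] prod_ennreal[symmetric] o[OF oB])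
    then have "P.prob {x. \<forall>j\<in>F. toda_map x j \<in> B j} = (\<Prod>j\<in>F. P.prob {x. toda_map x j \<in> B j})"
      by (subst (asm) ennreal_inj) (auto intro: prod_nonneg)
    ultimately show "P.prob (\<Inter>j\<in>F. (\<lambda>x. toda_map x j) -` A j \<inter> space P) =
          (\<Prod>j\<in>F. P.prob ((\<lambda>x. toda_map x j) -` A j \<inter> space P))"
      by simp
  qed
qed (use assms in \<open>auto simp: Int_stable_def sets_borel_pair space_pair_measure\<close>)

theorem distr_toda_map: "distr P P toda_map = P"
proof -
  have "distr P P toda_map = PiM UNIV (\<lambda>_. site)"
  proof (rule prod.PiM_eq)
    show "sets (distr P P toda_map) = sets (PiM UNIV (\<lambda>_. site))"
      by (simp add: iid_law_def)
    fix J :: "int set" and F :: "int \<Rightarrow> (real \<times> real) set"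
    assume J: "finite J" and F: "\<And>j. j \<in> J \<Longrightarrow> F j \<in> sets site"
    have F' [measurable]: "\<And>j. j \<in> J \<Longrightarrow> F j \<in> sets (borel \<Otimes>\<^sub>M borel)" using F by simp
    have E: "prod_emb UNIV (\<lambda>_. site) J (PiE J F) = {x. \<forall>j\<in>J. x j \<in> F j}"
      by (auto simp: prod_emb_def PiE_iff)
    have m: "{x. \<forall>j\<in>J. x j \<in> F j} \<in> sets config_space"
    proof -
      have "{x \<in> space config_space. \<forall>j\<in>J. x j \<in> F j} \<in> sets config_space"
        using J by measurable
      then show ?thesis by simp
    qed
    show "emeasure (distr P P toda_map) (prod_emb UNIV (\<lambda>_. site) J (PiE J F)) = (\<Prod>j\<in>J. emeasure site (F j))"
    proof (cases "J = {}")
      case False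
      have "emeasure (distr P P toda_map) (prod_emb UNIV (\<lambda>_. site) J (PiE J F)) =
         emeasure P (\<Inter>j\<in>J. (\<lambda>x. toda_map x j) -` F j \<inter> space P)"
        unfolding E using m False by (subst emeasure_distr) (auto intro!: arg_cong2[where f=emeasure])
      also have "\<dots> = ennreal (\<Prod>j\<in>J. P.prob ((\<lambda>x. toda_map x j) -` F j \<inter> space P))"
        using P.indep_varsD[OF toda_map_indep[OF J False] False J subset_refl, of F] F'
        by (simp add: P.emeasure_eq_measure)
      also have "\<dots> = (\<Prod>j\<in>J. emeasure P ((\<lambda>x. toda_map x j) -` F j \<inter> space P))"
        by (simp add: prod_ennreal[symmetric] P.emeasure_eq_measure)
      also have "\<dots> = (\<Prod>j\<in>J. emeasure site (F j))"
      proof (intro prod.cong refl)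
        fix j assume "j \<in> J"
        then show "emeasure P ((\<lambda>x. toda_map x j) -` F j \<inter> space P) = emeasure site (F j)"
          using F' by (subst toda_map_component[of j, symmetric], subst emeasure_distr) auto
      qed
      finally show ?thesis .
    next
      case True
      interpret D: prob_space "distr P P toda_map" by (rule P.prob_space_distr) measurable
      show ?thesis unfolding E using D.emeasure_space_1 True by simp
    qed
  qed
  then show ?thesis by (simp add: iid_law_def)
qed

end

subsection \<open>Unique solvability and invariance\<close>

text \<open>\<open>toda_step_unique\<close> consumes the step that follows, and an infinite orbit
  always provides it; so the initial configuration determines the whole forward half.\<close>

lemma forward_orbit:
  assumes step: "\<And>k. toda_step (Z k) (V k) (Z (Suc k))"
    and rc: "\<And>k. recurrent ((toda_map ^^ k) (Z 0))"
  shows "Z k = (toda_map ^^ k) (Z 0)" "V k = carrier_of (Z k)"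
proof -
  show Z: "Z k = (toda_map ^^ k) (Z 0)" for k
  proof (induction k)
    case (Suc k)
    have "recurrent (Z k)" using rc[of k] Suc by simp
    from toda_step_unique(2)[OF step step this] Suc show ?case by simp
  qed simp
  show "V k = carrier_of (Z k)"
    using toda_step_unique(1)[OF step step, of k] rc[of k] Z[of k] by simp
qed

lemma uniquely_solvableI:
  assumes f: "\<And>k. contractive ((toda_map ^^ k) x)" "\<And>k. recurrent ((toda_map ^^ k) x)"
    and b: "\<And>k. contractive ((toda_map ^^ k) (reflect x))" "\<And>k. recurrent ((toda_map ^^ k) (reflect x))"
  shows "dT_uniquely_solvable x" "T_dT x = toda_map x"
proof -
  define X where "X t = (if t \<ge> 0 then (toda_map ^^ nat t) x else reflect ((toda_map ^^ nat (- t)) (reflect x)))" for t :: int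
  \<comment> \<open>\<open>W t\<close> acts between the times \<open>t\<close> and
    \<open>t + 1\<close>. At negative \<open>t\<close> the reversed dynamics leaves from time
    \<open>t + 1\<close>, hence the carrier of the reflected \<open>X (t + 1)\<close>.\<close>
  define W where "W t = (if t \<ge> 0 then carrier_of (X t) else (\<lambda>n. carrier_of (reflect (X (t + 1))) (- n)))" for t :: int
  have X: "X (int k) = (toda_map ^^ k) x" "X (- int k) = reflect ((toda_map ^^ k) (reflect x))" for k
    by (auto simp: X_def)
  have W: "W (int k) = carrier_of ((toda_map ^^ k) x)"
    "W (- int (Suc k)) = (\<lambda>n. carrier_of ((toda_map ^^ k) (reflect x)) (- n))" for k
    using X by (auto simp: W_def)
  have step: "toda_step (X t) (W t) (X (t + 1))" for t
  proof (cases t rule: int_cases)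
    case (nonneg k)
    have "toda_step ((toda_map ^^ k) x) (carrier_of ((toda_map ^^ k) x)) ((toda_map ^^ Suc k) x)"
      using toda_step_toda_map[OF f(1)] by simp
    moreover have "t + 1 = int (Suc k)" using nonneg by simp
    ultimately show ?thesis unfolding nonneg by (simp only: X W)
  next
    case (neg k)
    let ?y = "(toda_map ^^ k) (reflect x)"
    have "toda_step (reflect (toda_map ?y)) (\<lambda>n. carrier_of ?y (- n)) (reflect ?y)"
      by (rule toda_step_reflect) (rule toda_step_toda_map[OF b(1)])
    moreover have "t + 1 = - int k" using neg by simp
    moreover have "reflect (toda_map ?y) = reflect ((toda_map ^^ Suc k) (reflect x))" by simp
    ultimately show ?thesis unfolding neg by (simp only: X W)
  qed
  define s where "s = ((\<lambda>n t. fst (X t n)), (\<lambda>n t. snd (X t n)), (\<lambda>n t. W t n))"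
  have sol: "dT_solution x s"
    unfolding dT_solution_def s_def dT_eqs_iff_step using step X(1)[of 0] by simp
  have uniq: "s' = s" if "dT_solution x s'" for s'
  proof -
    obtain I J U where s': "s' = (I, J, U)" by (cases s')
    define Z where "Z t n = (I n t, J n t)" for t n
    define V where "V t n = U n t" for t n
    have st: "toda_step (Z t) (V t) (Z (t + 1))" for t
      using that unfolding s' dT_solution_def dT_eqs_iff_step Z_def V_def by simp
    have Z0: "Z 0 = x"
      using that unfolding s' dT_solution_def Z_def by (auto simp: fun_eq_iff)
    have F: "Z (int k) = (toda_map ^^ k) (Z 0)" "V (int k) = carrier_of (Z (int k))" for k
    proof -
      have "toda_step (Z (int k)) (V (int k)) (Z (int (Suc k)))" for k
        using st[of "int k"] by (simp add: add.commute)
      from forward_orbit[of "\<lambda>k. Z (int k)" "\<lambda>k. V (int k)", OF this] f(2) Z0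
      show "Z (int k) = (toda_map ^^ k) (Z 0)" "V (int k) = carrier_of (Z (int k))" by simp_all
    qed
    have B: "reflect (Z (- int k)) = (toda_map ^^ k) (reflect x)"
      "(\<lambda>n. V (- int (Suc k)) (- n)) = carrier_of (reflect (Z (- int k)))" for k
    proof -
      have "toda_step (reflect (Z (- int k))) (\<lambda>n. V (- int (Suc k)) (- n)) (reflect (Z (- int (Suc k))))" for k
        using toda_step_reflect[OF st[of "- int (Suc k)"]] by simp
      from forward_orbit[of "\<lambda>k. reflect (Z (- int k))" "\<lambda>k n. V (- int (Suc k)) (- n)", OF this] b(2) Z0
      show "reflect (Z (- int k)) = (toda_map ^^ k) (reflect x)"
        "(\<lambda>n. V (- int (Suc k)) (- n)) = carrier_of (reflect (Z (- int k)))" by simp_all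
    qed
    have "Z t = X t \<and> V t = W t" for t
    proof (cases t rule: int_cases)
      case (nonneg k)
      then show ?thesis using F[of k] Z0 X(1)[of k] W(1)[of k] by simp
    next
      case (neg k)
      have "Z t = reflect (reflect (Z t))" by simp
      also have "\<dots> = X t" unfolding neg B(1) X(2) ..
      finally have "Z t = X t" .
      moreover have "V t n = W t n" for n
        using fun_cong[OF B(2)[of k], of "- n"] unfolding neg W(2) B(1) by simp
      ultimately show ?thesis by (auto simp: fun_eq_iff)
    qed
    then have e: "Z = X" "V = W" by (auto simp: fun_eq_iff)
    have "I = (\<lambda>n t. fst (Z t n))" "J = (\<lambda>n t. snd (Z t n))" "U = (\<lambda>n t. V t n)"
      by (simp_all add: Z_def V_def)
    then show ?thesis unfolding s' s_def e by simp
  qed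
  show "dT_uniquely_solvable x" unfolding dT_uniquely_solvable_def using sol uniq by blast
  have "(THE s. dT_solution x s) = s" using sol uniq by (rule the_equality)
  then show "T_dT x = toda_map x"
    unfolding T_dT_def s_def using X(1)[of 1] by simp
qed

text \<open>The two-sided solution is used at the times -1, 0, 1 and 2. The steps from 0 to 2
  identify the carrier from the input; the reversed steps from 1 to -1 identify the same carrier
  from the output.\<close>

lemma solution_time_one:
  assumes rc: "recurrent x" and us: "dT_uniquely_solvable x"
  shows "T_dT x = toda_map x" "contractive x"
    "recurrent (reflect (toda_map x)) \<Longrightarrow> carrier_of x n = carrier_of (reflect (toda_map x)) (- n)"
proof -
  obtain s where s: "dT_solution x s" "(THE s. dT_solution x s) = s"
    using us unfolding dT_uniquely_solvable_def by (metis theI')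
  obtain I J U where sI: "s = (I, J, U)" by (cases s)
  define Z where "Z t n = (I n t, J n t)" for t n
  define V where "V t n = U n t" for t n
  have st: "toda_step (Z t) (V t) (Z (t + 1))" for t
    using s unfolding sI dT_solution_def dT_eqs_iff_step Z_def V_def by simp
  have Z0: "Z 0 = x"
    using s unfolding sI dT_solution_def Z_def by (auto simp: fun_eq_iff)
  have st0: "toda_step x (V 0) (Z 1)" and st1: "toda_step (Z 1) (V 1) (Z 2)"
    and stm: "toda_step (Z (- 1)) (V (- 1)) x"
    using st[of 0] st[of 1] st[of "- 1"] by (simp_all add: Z0)
  have e: "V 0 = carrier_of x" "Z 1 = toda_map x" using toda_step_unique[OF st0 st1 rc] .
  show "T_dT x = toda_map x"
    unfolding T_dT_def s(2) unfolding sI e(2)[symmetric] Z_def by simp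
  show "contractive x" by (rule toda_step_contractive[OF st0])
  assume r: "recurrent (reflect (toda_map x))"
  have "(\<lambda>n. V 0 (- n)) = carrier_of (reflect (toda_map x))"
    using toda_step_unique(1)[OF toda_step_reflect[OF st0] toda_step_reflect[OF stm]] r unfolding e(2) by simp
  from fun_cong[OF this, of "- n"] show "carrier_of x n = carrier_of (reflect (toda_map x)) (- n)"
    unfolding e(1) by simp
qed

section \<open>Passing between invariance under \<open>toda_map\<close> and under
  \<open>T_dT\<close>\<close>

context iid
begin

lemma distr_toda_map_funpow:
  assumes "distr P P toda_map = P"
  shows "distr P P (toda_map ^^ k) = P"
proof (induction k)
  case 0
  then show ?case by (simp add: distr_id)
next
  case (Suc k)
  have m: "(toda_map ^^ k) \<in> measurable P P"
    by (induction k) (auto intro: measurable_comp cong: measurable_cong_sets)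
  have "distr P P (toda_map ^^ Suc k) = distr (distr P P (toda_map ^^ k)) P toda_map"
    using m by (subst distr_distr) (auto cong: measurable_cong_sets)
  also have "\<dots> = P" unfolding Suc assms ..
  finally show ?case .
qed

lemma AE_transport:
  assumes "distr P P f = P" "f \<in> measurable P P" "AE x in P. R x"
  shows "AE x in P. R (f x)"
  by (rule AE_distrD[OF assms(2)]) (subst assms(1), rule assms(3))

lemma dT_invariantI:
  assumes c: "AE x in P. contractive x" and inv: "distr P P toda_map = P"
  shows "dT_invariant \<nu> \<mu>"
proof -
  have tm: "toda_map \<in> measurable P P" and rm: "reflect \<in> measurable P P"
    by (auto cong: measurable_cong_sets)
  have fm: "(toda_map ^^ k) \<in> measurable P P" for k
    by (induction k) (auto intro: measurable_comp[OF _ tm])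
  have good: "AE x in P. contractive x \<and> recurrent x"
    using c AE_recurrent by eventually_elim auto
  have f: "AE x in P. contractive ((toda_map ^^ k) x) \<and> recurrent ((toda_map ^^ k) x)" for k
    by (rule AE_transport[OF distr_toda_map_funpow[OF inv] fm good])
  have b: "AE x in P. contractive ((toda_map ^^ k) (reflect x)) \<and> recurrent ((toda_map ^^ k) (reflect x))" for k
    by (rule AE_transport[OF distr_reflect rm f])
  have "AE x in P. \<forall>k. (contractive ((toda_map ^^ k) x) \<and> recurrent ((toda_map ^^ k) x)) \<and>
      (contractive ((toda_map ^^ k) (reflect x)) \<and> recurrent ((toda_map ^^ k) (reflect x)))"
    unfolding AE_all_countable using f b by (auto simp: AE_conj_iff)
  then have all: "AE x in P. dT_uniquely_solvable x \<and> T_dT x = toda_map x"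
    by eventually_elim (auto intro: uniquely_solvableI)
  then have us: "AE x in P. dT_uniquely_solvable x" and eq: "AE x in P. T_dT x = toda_map x"
    by (eventually_elim, simp)+
  show ?thesis
    unfolding dT_invariant_def using us AE_eq_distr_completion[OF tm eq] inv by simp
qed

lemma dT_invariantD:
  assumes "dT_invariant \<nu> \<mu>"
  shows "distr P P toda_map = P" "AE x in P. contractive x"
    "AE x in P. \<forall>n. carrier_of x n = carrier_of (reflect (toda_map x)) (- n)"
proof -
  have tm: "toda_map \<in> measurable P P" and rm: "reflect \<in> measurable P P"
    by (auto cong: measurable_cong_sets)
  have us: "AE x in P. dT_uniquely_solvable x" and T: "distr (completion P) P T_dT = P"
    using assms unfolding dT_invariant_def by auto
  have eq: "AE x in P. T_dT x = toda_map x"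
    using us AE_recurrent by eventually_elim (rule solution_time_one)
  show inv: "distr P P toda_map = P"
    using AE_eq_distr_completion(2)[OF tm eq] T by simp
  show "AE x in P. contractive x"
    using us AE_recurrent by eventually_elim (rule solution_time_one)
  \<comment> \<open>The output has the input law by \<open>inv\<close>, so recurrence of its
    reflection reduces to recurrence of an i.i.d. configuration.\<close>
  have "AE x in P. recurrent (reflect (toda_map x))"
    by (rule AE_transport[OF inv tm]) (rule AE_transport[OF distr_reflect rm AE_recurrent])
  with us AE_recurrent show "AE x in P. \<forall>n. carrier_of x n = carrier_of (reflect (toda_map x)) (- n)"
    by eventually_elim (auto intro: solution_time_one(3))
qed

text \<open>The carrier at site \<open>0\<close> is a function of the input to its left, and, by time reversal, the carrier
  leaving site \<open>0\<close> is a function of the output to its right.\<close>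

lemma invariant_independence:
  assumes inv: "dT_invariant \<nu> \<mu>"
  obtains R where "R \<in> borel_measurable P"
    "P.indep_var borel (\<lambda>x. snd (x 0)) borel (\<lambda>x. carrier_of x 0)"
    "P.indep_var borel (\<lambda>x. fst (toda_map x 0)) borel R"
    "AE x in P. carrier_of x 0 > 0 \<and> fst (toda_map x 0) = snd (x 0) + carrier_of x 0 \<and>
        R x = snd (x 0) / (snd (x 0) + carrier_of x 0)"
    "distr P borel (\<lambda>x. fst (toda_map x 0)) = \<nu>"
proof -
  note D = dT_invariantD[OF inv]
  \<comment> \<open>At \<open>y = toda_map x\<close> the reflected carrier is
    \<open>carrier_of x 1\<close>. Output \<open>J 0\<close> and outgoing carrier are
    \<open>I 1\<close> times \<open>J 0 / (J 0 + U 0)\<close> and \<open>U 0 / (J 0 + U 0)\<close>,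
    so \<open>g\<close> recovers the ratio from the output alone.\<close>
  define g where "g y = snd (y 0) / (snd (y 0) + carrier_of (reflect y) (- 1))" for y
  have gm [measurable]: "g \<in> borel_measurable config_space" unfolding g_def by measurable
  show ?thesis
  proof (rule that[of "\<lambda>x. g (toda_map x)"])
    show "(\<lambda>x. g (toda_map x)) \<in> borel_measurable P" by measurable
    show "P.indep_var borel (\<lambda>x. snd (x 0)) borel (\<lambda>x. carrier_of x 0)"
    \<comment> \<open>\<open>carrier_of x 0\<close> reads \<open>I\<close> up to site 0 but
      \<open>J\<close> only strictly to the left of it.\<close>
    proof (rule indep_disjoint[where A="{(0, False)}" and B="{(n, b). n < 0 \<or> n = 0 \<and> b}"])
      fix x y :: config
      show "(\<And>i. i \<in> {(0, False)} \<Longrightarrow> unpair x i = unpair y i) \<Longrightarrow> snd (x 0) = snd (y 0)"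
        by (auto simp: unpair_def)
      assume xy: "\<And>i. i \<in> {(n, b). n < 0 \<or> n = 0 \<and> b} \<Longrightarrow> unpair x i = unpair y i"
      have "fst (x n) = fst (y n)" if "n \<le> 0" for n using xy[of "(n, True)"] that by (auto simp: unpair_def le_less)
      moreover have "snd (x n) = snd (y n)" if "n < 0" for n using xy[of "(n, False)"] that by (auto simp: unpair_def)
      ultimately show "carrier_of x 0 = carrier_of y 0"
        unfolding carrier_of_def toda_sum_def toda_weight_def by simp
    qed auto
    have "P.indep_var borel (\<lambda>y. fst (y 0)) borel g"
    \<comment> \<open>The offset in \<open>reflect\<close> makes the carrier at -1 read both
      components at the sites from 1 onwards; \<open>g\<close> adds only the \<open>J\<close>
      component of site 0.\<close>
    proof (rule indep_disjoint[where A="{(0, True)}" and B="{(n, b). n > 0 \<or> n = 0 \<and> \<not> b}"])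
      fix x y :: config
      show "(\<And>i. i \<in> {(0, True)} \<Longrightarrow> unpair x i = unpair y i) \<Longrightarrow> fst (x 0) = fst (y 0)"
        by (auto simp: unpair_def)
      assume xy: "\<And>i. i \<in> {(n, b). n > 0 \<or> n = 0 \<and> \<not> b} \<Longrightarrow> unpair x i = unpair y i"
      have "fst (x n) = fst (y n)" if "n > 0" for n using xy[of "(n, True)"] that by (auto simp: unpair_def)
      moreover have "snd (x n) = snd (y n)" if "n \<ge> 0" for n using xy[of "(n, False)"] that by (auto simp: unpair_def le_less)
      ultimately show "g x = g y"
        unfolding g_def carrier_of_def toda_sum_def toda_weight_def reflect_def by simp
    qed auto
    then have "distr P borel (\<lambda>y. fst (y 0)) \<Otimes>\<^sub>M distr P borel g = distr P (borel \<Otimes>\<^sub>M borel) (\<lambda>y. (fst (y 0), g y))"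
      unfolding P.indep_var_distribution_eq by simp
    then have "distr (distr P P toda_map) borel (\<lambda>y. fst (y 0)) \<Otimes>\<^sub>M distr (distr P P toda_map) borel g
        = distr (distr P P toda_map) (borel \<Otimes>\<^sub>M borel) (\<lambda>y. (fst (y 0), g y))"
      unfolding D(1) .
    then show "P.indep_var borel (\<lambda>x. fst (toda_map x 0)) borel (\<lambda>x. g (toda_map x))"
      unfolding P.indep_var_distribution_eq
      by (simp add: distr_distr comp_def cong: measurable_cong_sets)
    have "distr (distr P P toda_map) borel (\<lambda>y. fst (y 0)) = \<nu>"
      unfolding D(1) by (rule distr_fst)
    then show "distr P borel (\<lambda>x. fst (toda_map x 0)) = \<nu>"
      by (simp add: distr_distr comp_def cong: measurable_cong_sets)
    show "AE x in P. carrier_of x 0 > 0 \<and> fst (toda_map x 0) = snd (x 0) + carrier_of x 0 \<and>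
        g (toda_map x) = snd (x 0) / (snd (x 0) + carrier_of x 0)"
      using D(2,3)
    proof eventually_elim
      case (elim x)
      let ?u = "carrier_of x 0"
      note st = toda_step_toda_map[OF elim(1), unfolded toda_step_def]
      have pos: "?u > 0" "snd (x 0) > 0" "fst (x 1) > 0" using st by blast+
      have S: "fst (toda_map x 0) = snd (x 0) + ?u" using st by blast
      have u1: "carrier_of x 1 = fst (x 1) * ?u / (snd (x 0) + ?u)"
        using st[THEN spec, of 0] S by simp
      have j1: "snd (toda_map x 0) = fst (x 1) * snd (x 0) / (snd (x 0) + ?u)"
        using st[THEN spec, of 0] S by simp
      have "carrier_of (reflect (toda_map x)) (- 1) = carrier_of x 1" using elim(2) by simp
      then have "g (toda_map x) = (fst (x 1) * snd (x 0) / (snd (x 0) + ?u)) / (fst (x 1) * snd (x 0) / (snd (x 0) + ?u) + fst (x 1) * ?u / (snd (x 0) + ?u))"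
        unfolding g_def u1 j1 by simp
      also have "fst (x 1) * snd (x 0) / (snd (x 0) + ?u) + fst (x 1) * ?u / (snd (x 0) + ?u) = fst (x 1)"
        using pos by (simp add: add_divide_distrib[symmetric] distrib_left[symmetric])
      finally have "g (toda_map x) = snd (x 0) / (snd (x 0) + ?u)" using pos by simp
      then show ?case using pos S by simp
    qed
  qed
qed

end

lemma gamma_invariant:
  assumes "l1 > 0" "l2 > 0" "c > 0"
  shows "dT_invariant (gamma_measure (l1 + l2) c) (gamma_measure l1 c)"
proof -
  interpret iid "gamma_measure (l1 + l2) c" "gamma_measure l1 c"
    by (intro iid.intro prob_space_gamma_measure sets_gamma_measure) (use assms in auto)
  \<comment> \<open>\<open>AE_contractive\<close> asks for \<open>s \<le> 1\<close>, and
    \<open>Gamma_product_less\<close> for \<open>2 * s < l2\<close>.\<close>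
  define s where "s = min 1 (l2 / 3)"
  have s: "0 < s" "s \<le> 1" "l1 + s < l1 + l2 - s" using assms by (auto simp: s_def min_def)
  let ?b = "l1 + l2"
  have G: "Gamma ?b > 0" "Gamma l1 > 0" using assms by (auto intro: Gamma_real_pos)
  have "(\<integral>\<^sup>+z. ennreal ((snd z / fst z) powr s) \<partial>site) =
     (\<integral>\<^sup>+i. \<integral>\<^sup>+j. ennreal ((j / i) powr s) \<partial>gamma_measure l1 c \<partial>gamma_measure ?b c)"
    by (subst mu.nn_integral_fst[symmetric]) (auto simp: measurable_cong_sets[OF sets_site refl])
  also have "\<dots> = (\<integral>\<^sup>+i. ennreal (i powr (- s)) * (\<integral>\<^sup>+j. ennreal (j powr s) \<partial>gamma_measure l1 c) \<partial>gamma_measure ?b c)"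
  proof (rule nn_integral_cong_AE)
    show "AE i in gamma_measure ?b c. (\<integral>\<^sup>+j. ennreal ((j / i) powr s) \<partial>gamma_measure l1 c) =
        ennreal (i powr (- s)) * (\<integral>\<^sup>+j. ennreal (j powr s) \<partial>gamma_measure l1 c)"
      using AE_gamma_measure_pos
    proof eventually_elim
      case (elim i)
      have "(\<integral>\<^sup>+j. ennreal ((j / i) powr s) \<partial>gamma_measure l1 c) = (\<integral>\<^sup>+j. ennreal (i powr (- s)) * ennreal (j powr s) \<partial>gamma_measure l1 c)"
      proof (rule nn_integral_cong_AE)
        show "AE j in gamma_measure l1 c. ennreal ((j / i) powr s) = ennreal (i powr (- s)) * ennreal (j powr s)"
          using AE_gamma_measure_pos
          by eventually_elim (use elim in \<open>simp add: powr_divide powr_minus_divide ennreal_mult[symmetric]\<close>)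
      qed
      then show ?case by (simp add: nn_integral_cmult)
    qed
  qed
  also have "\<dots> = (\<integral>\<^sup>+i. ennreal (i powr (- s)) \<partial>gamma_measure ?b c) * (\<integral>\<^sup>+j. ennreal (j powr s) \<partial>gamma_measure l1 c)"
    by (simp add: nn_integral_multc)
  also have "\<dots> = ennreal (c powr ?b * Gamma (?b - s) / (Gamma ?b * c powr (?b - s))) *
       ennreal (c powr l1 * Gamma (l1 + s) / (Gamma l1 * c powr (l1 + s)))"
    using nn_integral_gamma_tilt[of ?b c "- s" 0] nn_integral_gamma_tilt[of l1 c s 0] assms s by simp
  also have "\<dots> = ennreal ((Gamma (l1 + s) * Gamma (?b - s)) / (Gamma l1 * Gamma ?b))"
    using assms s G by (subst ennreal_mult[symmetric]) (auto simp: powr_add powr_diff Gamma_real_pos less_imp_le mult_ac)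
  also have "\<dots> < 1"
  proof -
    have "Gamma (l1 + s) * Gamma (?b - s) < Gamma l1 * Gamma ?b"
      by (rule Gamma_product_less) (use assms s in auto)
    then show ?thesis using mult_pos_pos[OF G(2,1)] by (simp add: ennreal_less_one_iff)
  qed
  finally have contr: "AE x in P. contractive x"
    by (rule AE_contractive[OF AE_gamma_measure_pos AE_gamma_measure_pos s(1,2)])
  interpret balanced "gamma_measure (l1 + l2) c" "gamma_measure l1 c" "gamma_measure l2 c"
    by (intro balanced.intro balanced_axioms.intro iid_axioms prob_space_gamma_measure sets_gamma_measure
        AE_gamma_measure_pos contr gamma_detailed_balance) (use assms in auto)
  show ?thesis by (rule dT_invariantI[OF contr distr_toda_map])
qed

subsection \<open>Laplace transforms\<close>

text \<open>A single term of the series of \<open>exp (s * x)\<close> is at most the whole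
  sum.\<close>

lemma power_exp_bounded:
  fixes x s :: real
  assumes "x \<ge> 0" "s > 0"
  shows "x ^ k * exp (- s * x) \<le> fact k / s ^ k"
proof -
  have "(s * x) ^ k / fact k = (\<Sum>n\<in>{k}. (s * x) ^ n /\<^sub>R fact n)"
    by (simp add: field_simps)
  also have "\<dots> \<le> (\<Sum>n. (s * x) ^ n /\<^sub>R fact n)"
    using assms by (intro sum_le_suminf summable_exp_generic) (auto intro!: mult_nonneg_nonneg)
  also have "\<dots> = exp (s * x)" by (simp add: exp_def)
  finally have "s ^ k * x ^ k \<le> fact k * exp (s * x)"
    by (simp add: field_simps power_mult_distrib)
  then show ?thesis using assms by (simp add: exp_minus field_simps)
qed

lemma exp_minus_diff_le:
  fixes p q r :: real
  assumes "r \<le> p" "r \<le> q"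
  shows "\<bar>exp (- p) - exp (- q)\<bar> \<le> \<bar>p - q\<bar> * exp (- r)"
proof -
  have *: "\<bar>exp (- p) - exp (- q)\<bar> \<le> \<bar>p - q\<bar> * exp (- r)" if "r \<le> p" "p \<le> q" for p q :: real
  proof -
    have "1 - exp (- (q - p)) \<le> q - p" using exp_ge_add_one_self[of "- (q - p)"] by linarith
    then have "exp (- p) * (1 - exp (- (q - p))) \<le> exp (- r) * (q - p)"
      using that by (intro mult_mono) auto
    moreover have "exp (- p) * (1 - exp (- (q - p))) = exp (- p) - exp (- q)"
      by (simp add: right_diff_distrib exp_add[symmetric])
    ultimately show ?thesis using that by (simp add: mult.commute)
  qed
  show ?thesis
    using *[of p q] *[of q p] assms by (cases "p \<le> q") (auto simp: abs_minus_commute)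
qed

context prob_space
begin

text \<open>Up to the sign \<open>(-1) ^ k\<close> this is the \<open>k\<close>-th derivative of the
  Laplace transform. The exponential factor makes it finite at \<open>s > 0\<close> for positive
  \<open>X\<close>, even if \<open>X\<close> has no moments.\<close>

definition laplace :: "('a \<Rightarrow> real) \<Rightarrow> nat \<Rightarrow> real \<Rightarrow> real" where
  "laplace X k s = (\<integral>\<omega>. X \<omega> ^ k * exp (- s * X \<omega>) \<partial>M)"

lemma laplace_integrable:
  fixes X :: "'a \<Rightarrow> real" and s :: real
  assumes [measurable]: "X \<in> borel_measurable M" and "AE \<omega> in M. X \<omega> > 0" "s > 0"
  shows "integrable M (\<lambda>\<omega>. X \<omega> ^ k * exp (- s * X \<omega>))"
proof (rule integrable_const_bound[where B="fact k / s ^ k"])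
  show "AE \<omega> in M. norm (X \<omega> ^ k * exp (- s * X \<omega>)) \<le> fact k / s ^ k"
    using assms(2) by eventually_elim (use power_exp_bounded assms in \<open>simp add: less_imp_le\<close>)
qed measurable

lemma laplace_deriv:
  assumes [measurable]: "X \<in> borel_measurable M" and pos: "AE \<omega> in M. X \<omega> > 0" and s: "s > 0"
  shows "(laplace X k has_real_derivative - laplace X (Suc k) s) (at s)"
proof -
  let ?f = "\<lambda>s x::real. x ^ k * exp (- s * x)"
  \<comment> \<open>Staying above \<open>s / 2\<close> yields one integrable bound, with exponent
    \<open>s / 2\<close>, for all difference quotients.\<close>
  have open_half: "open {s / 2<..}" "s \<in> {s / 2<..}" using s by auto
  have "((\<lambda>y. (laplace X k y - laplace X k s) / (y - s)) \<longlongrightarrow> - laplace X (Suc k) s) (at s within {s / 2<..})"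
    unfolding tendsto_at_iff_sequentially
  proof (intro allI impI)
    fix t :: "nat \<Rightarrow> real" assume t: "\<forall>i. t i \<in> {s / 2<..} - {s}" "t \<longlonglongrightarrow> s"
    have tp: "t i > 0" "t i > s / 2" "t i \<noteq> s" for i
    proof -
      show "t i > s / 2" "t i \<noteq> s" using t(1) by auto
      then show "t i > 0" using s by (meson half_gt_zero less_trans)
    qed
    have "(\<lambda>i. \<integral>\<omega>. (?f (t i) (X \<omega>) - ?f s (X \<omega>)) / (t i - s) \<partial>M) \<longlonglongrightarrow> (\<integral>\<omega>. - (X \<omega> ^ Suc k * exp (- s * X \<omega>)) \<partial>M)"
    proof (rule integral_dominated_convergence[where w="\<lambda>\<omega>. X \<omega> ^ Suc k * exp (- (s / 2) * X \<omega>)"])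
      show "integrable M (\<lambda>\<omega>. X \<omega> ^ Suc k * exp (- (s / 2) * X \<omega>))"
        using s pos by (intro laplace_integrable) auto
      show "AE \<omega> in M. norm ((?f (t i) (X \<omega>) - ?f s (X \<omega>)) / (t i - s)) \<le> X \<omega> ^ Suc k * exp (- (s / 2) * X \<omega>)" for i
        using pos
      proof eventually_elim
        case (elim \<omega>)
        have "\<bar>exp (- (t i * X \<omega>)) - exp (- (s * X \<omega>))\<bar> \<le> \<bar>t i * X \<omega> - s * X \<omega>\<bar> * exp (- (s / 2 * X \<omega>))"
        proof (rule exp_minus_diff_le)
          show "s / 2 * X \<omega> \<le> t i * X \<omega>"
            by (rule mult_right_mono) (use tp[of i] elim in auto)
          show "s / 2 * X \<omega> \<le> s * X \<omega>"
            by (rule mult_right_mono) (use s elim in auto)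
        qed
        also have "\<bar>t i * X \<omega> - s * X \<omega>\<bar> = \<bar>t i - s\<bar> * X \<omega>"
          using elim by (simp add: left_diff_distrib[symmetric] abs_mult)
        finally have "X \<omega> ^ k * \<bar>exp (- (t i * X \<omega>)) - exp (- (s * X \<omega>))\<bar> \<le> X \<omega> ^ k * (\<bar>t i - s\<bar> * X \<omega> * exp (- (s / 2 * X \<omega>)))"
          using elim by (intro mult_left_mono) auto
        then have "X \<omega> ^ k * \<bar>exp (- (t i * X \<omega>)) - exp (- (s * X \<omega>))\<bar> / \<bar>t i - s\<bar> \<le> X \<omega> ^ Suc k * exp (- (s / 2) * X \<omega>)"
          using tp[of i] by (simp add: divide_le_eq mult_ac)
        moreover have "norm ((?f (t i) (X \<omega>) - ?f s (X \<omega>)) / (t i - s)) = X \<omega> ^ k * \<bar>exp (- (t i * X \<omega>)) - exp (- (s * X \<omega>))\<bar> / \<bar>t i - s\<bar>"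
          using elim by (simp add: right_diff_distrib[symmetric] abs_mult)
        ultimately show ?case by (simp only:)
      qed
      show "AE \<omega> in M. (\<lambda>i. (?f (t i) (X \<omega>) - ?f s (X \<omega>)) / (t i - s)) \<longlonglongrightarrow> - (X \<omega> ^ Suc k * exp (- s * X \<omega>))"
      proof (rule AE_I2)
        fix \<omega>
        have "((\<lambda>y. ?f y (X \<omega>)) has_real_derivative - (X \<omega> ^ Suc k * exp (- s * X \<omega>))) (at s within {s / 2<..})"
          by (auto intro!: derivative_eq_intros)
        then have "((\<lambda>y. (?f y (X \<omega>) - ?f s (X \<omega>)) / (y - s)) \<longlongrightarrow> - (X \<omega> ^ Suc k * exp (- s * X \<omega>))) (at s within {s / 2<..})"
          by (simp add: has_field_derivative_iff)
        then show "(\<lambda>i. (?f (t i) (X \<omega>) - ?f s (X \<omega>)) / (t i - s)) \<longlonglongrightarrow> - (X \<omega> ^ Suc k * exp (- s * X \<omega>))"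
          unfolding tendsto_at_iff_sequentially using t by (auto simp: o_def)
      qed
    qed measurable
    moreover have "(\<integral>\<omega>. (?f (t i) (X \<omega>) - ?f s (X \<omega>)) / (t i - s) \<partial>M) = (laplace X k (t i) - laplace X k s) / (t i - s)" for i
      unfolding laplace_def
      using laplace_integrable[OF assms(1) pos tp(1), of k i] laplace_integrable[OF assms(1) pos s, of k] by simp
    moreover have "(\<integral>\<omega>. - (X \<omega> ^ Suc k * exp (- s * X \<omega>)) \<partial>M) = - laplace X (Suc k) s"
      by (simp add: laplace_def)
    ultimately show "((\<lambda>y. (laplace X k y - laplace X k s) / (y - s)) \<circ> t) \<longlonglongrightarrow> - laplace X (Suc k) s"
      by (simp only: o_def)
  qed
  then show ?thesis
    unfolding has_field_derivative_iff using at_within_open[OF open_half(2,1)] by simp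
qed

lemma laplace_limit_0:
  assumes [measurable]: "X \<in> borel_measurable M" and pos: "AE \<omega> in M. X \<omega> > 0"
  shows "(\<lambda>n. laplace X 0 (1 / real (Suc n))) \<longlonglongrightarrow> 1"
proof -
  have "(\<lambda>n. \<integral>\<omega>. exp (- (1 / real (Suc n)) * X \<omega>) \<partial>M) \<longlonglongrightarrow> (\<integral>\<omega>. 1 \<partial>M)"
  proof (rule integral_dominated_convergence[where w="\<lambda>_. 1"])
    show "AE \<omega> in M. norm (exp (- (1 / real (Suc n)) * X \<omega>)) \<le> 1" for n
      using pos by eventually_elim auto
    show "AE \<omega> in M. (\<lambda>n. exp (- (1 / real (Suc n)) * X \<omega>)) \<longlonglongrightarrow> 1"
    proof (rule AE_I2)
      fix \<omega>
      have "(\<lambda>n. exp (- (1 / real (Suc n)) * X \<omega>)) \<longlonglongrightarrow> exp (- 0 * X \<omega>)"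
        by (intro tendsto_intros LIMSEQ_Suc lim_1_over_n)
      then show "(\<lambda>n. exp (- (1 / real (Suc n)) * X \<omega>)) \<longlonglongrightarrow> 1" by simp
    qed
  qed auto
  then show ?thesis unfolding laplace_def by (simp add: prob_space)
qed

lemma laplace_pos:
  assumes [measurable]: "X \<in> borel_measurable M" and pos: "AE \<omega> in M. X \<omega> > 0" and s: "s > 0"
  shows "laplace X k s > 0"
proof -
  have "laplace X k s \<ge> 0"
    unfolding laplace_def using pos by (intro integral_nonneg_AE) (auto elim!: eventually_mono)
  moreover have "laplace X k s \<noteq> 0"
  proof
    assume "laplace X k s = 0"
    then have "AE \<omega> in M. X \<omega> ^ k * exp (- s * X \<omega>) = 0"
      unfolding laplace_def using laplace_integrable[OF assms, of k] pos
      by (subst (asm) integral_nonneg_eq_0_iff_AE) (auto elim!: eventually_mono)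
    with pos have "AE \<omega> in M. False" by eventually_elim auto
    then show False by simp
  qed
  ultimately show ?thesis by simp
qed

lemma laplace_le_1:
  assumes [measurable]: "X \<in> borel_measurable M" and pos: "AE \<omega> in M. X \<omega> > 0" and s: "s > 0"
  shows "laplace X 0 s \<le> 1"
proof -
  have "laplace X 0 s \<le> (\<integral>\<omega>. 1 \<partial>M)"
    unfolding laplace_def using laplace_integrable[OF assms, of 0] pos s
    by (intro integral_mono_AE) (auto elim!: eventually_mono)
  then show ?thesis by (simp add: prob_space)
qed

text \<open>Up to normalisation the gap is the variance of \<open>X\<close> under the law tilted by
  \<open>exp (- s * X)\<close>, with mean \<open>m\<close>; it vanishes only for constant
  \<open>X\<close>.\<close>

lemma laplace_strict_log_convex:
  assumes [measurable]: "X \<in> borel_measurable M" and pos: "AE \<omega> in M. X \<omega> > 0" and s: "s > 0"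
    and nd: "\<And>b. \<not> (AE \<omega> in M. X \<omega> = b)"
  shows "(laplace X 1 s)\<^sup>2 < laplace X 0 s * laplace X 2 s"
proof -
  let ?L = "\<lambda>k. laplace X k s"
  note int = laplace_integrable[OF assms(1) pos s]
  define m where "m = ?L 1 / ?L 0"
  have L0: "?L 0 > 0" by (rule laplace_pos) fact+
  have eq: "(X \<omega> - m)\<^sup>2 * exp (- s * X \<omega>) = X \<omega> ^ 2 * exp (- s * X \<omega>) - 2 * m * (X \<omega> ^ 1 * exp (- s * X \<omega>))
      + m\<^sup>2 * (X \<omega> ^ 0 * exp (- s * X \<omega>))" for \<omega>
    by (simp add: power2_diff algebra_simps)
  have i: "integrable M (\<lambda>\<omega>. (X \<omega> - m)\<^sup>2 * exp (- s * X \<omega>))"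
    unfolding eq by (intro Bochner_Integration.integrable_add Bochner_Integration.integrable_diff integrable_mult_right int)
  have "(\<integral>\<omega>. (X \<omega> - m)\<^sup>2 * exp (- s * X \<omega>) \<partial>M) = ?L 2 - 2 * m * ?L 1 + m\<^sup>2 * ?L 0"
    unfolding eq laplace_def
    using int[of 2] int[of 1] int[of 0]
    by (simp only: Bochner_Integration.integral_add Bochner_Integration.integral_diff integrable_mult_right
        Bochner_Integration.integrable_diff integral_mult_right_zero)
  also have "\<dots> = ?L 2 - (?L 1)\<^sup>2 / ?L 0"
    using L0 by (simp add: m_def power2_eq_square field_simps)
  finally have I: "(\<integral>\<omega>. (X \<omega> - m)\<^sup>2 * exp (- s * X \<omega>) \<partial>M) = ?L 2 - (?L 1)\<^sup>2 / ?L 0" .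
  have "(\<integral>\<omega>. (X \<omega> - m)\<^sup>2 * exp (- s * X \<omega>) \<partial>M) \<noteq> 0"
  proof
    assume "(\<integral>\<omega>. (X \<omega> - m)\<^sup>2 * exp (- s * X \<omega>) \<partial>M) = 0"
    then have "AE \<omega> in M. (X \<omega> - m)\<^sup>2 * exp (- s * X \<omega>) = 0"
      by (subst (asm) integral_nonneg_eq_0_iff_AE[OF i]) auto
    then have "AE \<omega> in M. X \<omega> = m" by eventually_elim auto
    with nd show False by blast
  qed
  moreover have "(\<integral>\<omega>. (X \<omega> - m)\<^sup>2 * exp (- s * X \<omega>) \<partial>M) \<ge> 0" by (intro integral_nonneg_AE) auto
  ultimately have "(\<integral>\<omega>. (X \<omega> - m)\<^sup>2 * exp (- s * X \<omega>) \<partial>M) > 0" by linarith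
  then have "(?L 1)\<^sup>2 / ?L 0 < ?L 2" using I by linarith
  then show ?thesis using L0 by (simp add: pos_divide_less_eq mult.commute)
qed

end

text \<open>Weierstrass approximation on the unit interval extends equality from powers to
  continuous functions; cosine and sine then give equal characteristic functions.\<close>

lemma moments_determine:
  fixes M N :: "real measure"
  assumes M: "prob_space M" "sets M = sets borel" "AE x in M. x \<in> {0..1}"
    and N: "prob_space N" "sets N = sets borel" "AE x in N. x \<in> {0..1}"
    and eq: "\<And>k. (\<integral>x. x ^ k \<partial>M) = (\<integral>x. x ^ k \<partial>N)"
  shows "M = N"
proof (rule Levy_uniqueness)
  have rd: "real_distribution L" if "prob_space L" "sets L = sets borel" for L :: "real measure"
    using that sets_eq_imp_space_eq[OF that(2)] by (auto simp: real_distribution_def real_distribution_axioms_def)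
  show "real_distribution M" "real_distribution N" using rd M N by auto
  have int: "integrable L f" if L: "prob_space L" "sets L = sets borel" "AE x in L. x \<in> {0..1}"
      and f: "continuous_on UNIV f" for L :: "real measure" and f :: "real \<Rightarrow> real"
  proof -
    interpret prob_space L by fact
    have "compact (f ` {0..1})"
      by (intro compact_continuous_image continuous_on_subset[OF f]) auto
    then obtain B where "\<forall>y\<in>f ` {0..1}. norm y \<le> B"
      using compact_imp_bounded[THEN bounded_iff[THEN iffD1]] by fast
    then have B: "norm (f x) \<le> B" if "x \<in> {0..1}" for x using that by blast
    have "f \<in> borel_measurable borel" using f by (rule borel_measurable_continuous_onI)
    then have fm: "f \<in> borel_measurable L" unfolding measurable_cong_sets[OF L(2) refl] .
    show ?thesis
    proof (rule integrable_const_bound[OF _ fm])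
      show "AE x in L. norm (f x) \<le> B" using L(3) by eventually_elim (rule B)
    qed
  qed
  have cont: "(\<integral>x. f x \<partial>M) = (\<integral>x. f x \<partial>N)" if f: "continuous_on UNIV f" for f :: "real \<Rightarrow> real"
  proof -
    have "\<bar>(\<integral>x. f x \<partial>M) - (\<integral>x. f x \<partial>N)\<bar> \<le> 2 * e" if e: "e > 0" for e
    proof -
      obtain g where g: "real_polynomial_function g" "\<And>x. x \<in> {0..1} \<Longrightarrow> \<bar>f x - g x\<bar> < e"
        using Stone_Weierstrass_real_polynomial_function[OF compact_Icc continuous_on_subset[OF f subset_UNIV] e]
        by blast
      obtain a n where ga: "g = (\<lambda>x. \<Sum>i\<le>n. a i * x ^ i)"
        using g(1) unfolding real_polynomial_function_iff_sum by blast
      have gc: "continuous_on UNIV g" unfolding ga by (intro continuous_intros)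
      have gint: "(\<integral>x. g x \<partial>L) = (\<Sum>i\<le>n. a i * (\<integral>x. x ^ i \<partial>L))"
        if "prob_space L" "sets L = sets borel" "AE x in L. x \<in> {0..1}" for L
      proof -
        have "integrable L (\<lambda>x. x ^ i)" for i by (intro int[OF that] continuous_intros)
        then show ?thesis unfolding ga by (subst Bochner_Integration.integral_sum) auto
      qed
      have close: "\<bar>(\<integral>x. f x \<partial>L) - (\<integral>x. g x \<partial>L)\<bar> \<le> e"
        if L: "prob_space L" "sets L = sets borel" "AE x in L. x \<in> {0..1}" for L
      proof -
        interpret L: prob_space L by fact
        have "\<bar>(\<integral>x. f x \<partial>L) - (\<integral>x. g x \<partial>L)\<bar> = \<bar>\<integral>x. f x - g x \<partial>L\<bar>"
          using int[OF L f] int[OF L gc] by simp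
        also have "\<dots> \<le> (\<integral>x. \<bar>f x - g x\<bar> \<partial>L)" by (rule integral_abs_bound)
        also have "\<dots> \<le> (\<integral>x. e \<partial>L)"
        proof (rule integral_mono_AE)
          show "AE x in L. \<bar>f x - g x\<bar> \<le> e" using L(3) by eventually_elim (rule less_imp_le[OF g(2)])
        qed (use int[OF L f] int[OF L gc] in auto)
        finally show ?thesis by (simp add: L.prob_space)
      qed
      have "(\<integral>x. g x \<partial>M) = (\<integral>x. g x \<partial>N)" unfolding gint[OF M] gint[OF N] eq ..
      then show ?thesis using close[OF M] close[OF N] by linarith
    qed
    \<comment> \<open>With one third of the gap as \<open>e\<close>, the gap is at most two thirds
      of itself, hence zero.\<close>
    from this[of "\<bar>(\<integral>x. f x \<partial>M) - (\<integral>x. f x \<partial>N)\<bar> / 3"] show ?thesis by fastforce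
  qed
  show "char M = char N"
  proof
    fix t
    have ch: "char L t = Complex (\<integral>x. cos (t * x) \<partial>L) (\<integral>x. sin (t * x) \<partial>L)"
      if "prob_space L" "sets L = sets borel" "AE x in L. x \<in> {0..1}" for L
    proof -
      interpret L: real_distribution L using rd that by auto
      have i: "integrable L (\<lambda>x. iexp (t * x))"
        by (rule L.integrable_const_bound[where B=1]) auto
      have "Re (char L t) = (\<integral>x. cos (t * x) \<partial>L)" "Im (char L t) = (\<integral>x. sin (t * x) \<partial>L)"
        unfolding char_def integral_Re[OF i, symmetric] integral_Im[OF i, symmetric]
        by (simp_all add: Re_exp Im_exp)
      then show ?thesis by (simp add: complex_eq_iff)
    qed
    show "char M t = char N t"
      unfolding ch[OF M] ch[OF N]
      by (intro arg_cong2[where f=Complex] cont continuous_intros)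
  qed
qed

text \<open>The substitution \<open>y = exp (- x)\<close> maps into the unit interval and turns
  values of the Laplace transform into moments; \<open>- ln y\<close> undoes it.\<close>

lemma laplace_determines:
  fixes M N :: "real measure"
  assumes M: "prob_space M" "sets M = sets borel" "AE x in M. x > 0"
    and N: "prob_space N" "sets N = sets borel" "AE x in N. x > 0"
    and eq: "\<And>s. s > 0 \<Longrightarrow> (\<integral>x. exp (- s * x) \<partial>M) = (\<integral>x. exp (- s * x) \<partial>N)"
  shows "M = N"
proof -
  let ?e = "\<lambda>x::real. exp (- x)"
  have m: "f \<in> measurable L borel" if "sets L = sets borel" "f \<in> borel_measurable borel" for L :: "real measure" and f :: "real \<Rightarrow> real"
    using that(2) unfolding measurable_cong_sets[OF that(1) refl] .
  have recover: "L = distr (distr L borel ?e) borel (\<lambda>y. - ln y)" if "sets L = sets borel" for L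
  proof -
    have e: "?e \<in> measurable L borel" by (rule m[OF that]) measurable
    have "distr (distr L borel ?e) borel (\<lambda>y. - ln y) = distr L borel (\<lambda>x. x)"
      by (subst distr_distr[OF _ e]) (simp_all add: o_def)
    also have "\<dots> = distr L L (\<lambda>x. x)" using that by (intro distr_cong) auto
    finally show ?thesis by (simp add: distr_id)
  qed
  have "distr M borel ?e = distr N borel ?e"
  proof (rule moments_determine)
    have eM: "?e \<in> measurable M borel" by (rule m[OF M(2)]) measurable
    have eN: "?e \<in> measurable N borel" by (rule m[OF N(2)]) measurable
    show "prob_space (distr M borel ?e)" by (rule prob_space.prob_space_distr[OF M(1) eM])
    show "prob_space (distr N borel ?e)" by (rule prob_space.prob_space_distr[OF N(1) eN])
    show "AE y in distr M borel ?e. y \<in> {0..1}"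
    proof (subst AE_distr_iff[OF eM])
      show "AE x in M. ?e x \<in> {0..1}" using M(3) by eventually_elim auto
    qed auto
    show "AE y in distr N borel ?e. y \<in> {0..1}"
    proof (subst AE_distr_iff[OF eN])
      show "AE x in N. ?e x \<in> {0..1}" using N(3) by eventually_elim auto
    qed auto
    fix k
    have pw: "exp (- x) ^ k = exp (- real k * x)" for x :: real
      by (simp add: exp_of_nat_mult[symmetric])
    have "(\<integral>x. exp (- real k * x) \<partial>M) = (\<integral>x. exp (- real k * x) \<partial>N)"
    proof (cases "k = 0")
      case True
      then show ?thesis using prob_space.prob_space[OF M(1)] prob_space.prob_space[OF N(1)] by simp
    next
      case False
      then show ?thesis by (intro eq) simp
    qed
    then show "(\<integral>y. y ^ k \<partial>distr M borel ?e) = (\<integral>y. y ^ k \<partial>distr N borel ?e)"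
      by (simp add: integral_distr[OF eM] integral_distr[OF eN] pw)
  qed auto
  then show ?thesis using recover[OF M(2)] recover[OF N(2)] by simp
qed

lemma gamma_laplace:
  assumes "l > 0" "c > 0" "s > 0"
  shows "(\<integral>x. exp (- s * x) \<partial>gamma_measure l c) = (c / (c + s)) powr l"
proof -
  have G: "Gamma l \<noteq> 0" using Gamma_real_pos[OF assms(1)] by linarith
  have "(\<integral>\<^sup>+x. ennreal (exp (- s * x)) \<partial>gamma_measure l c) = (\<integral>\<^sup>+x. ennreal (x powr 0 * exp (- s * x)) \<partial>gamma_measure l c)"
    by (intro nn_integral_cong_AE) (use AE_gamma_measure_pos in \<open>eventually_elim, simp\<close>)
  also have "\<dots> = ennreal ((c / (c + s)) powr l)"
    using nn_integral_gamma_tilt[of l c 0 s] assms G by (simp add: powr_divide)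
  finally show ?thesis
    by (subst integral_eq_nn_integral) auto
qed

subsection \<open>Lukacs characterisation of the gamma laws\<close>

lemma DERIV_zero_halfline:
  fixes h :: "real \<Rightarrow> real"
  assumes "\<And>s. s > 0 \<Longrightarrow> (h has_real_derivative 0) (at s)" "a > 0" "b > 0"
  shows "h a = h b"
proof -
  have "\<exists>c. \<forall>x\<in>{0<..}. h x = c"
    using assms(1) by (intro has_field_derivative_zero_constant) (auto intro: has_field_derivative_at_within)
  then show ?thesis using assms(2,3) by auto
qed

text \<open>\<open>f0, f1, f2\<close> and \<open>g0, g1, g2\<close> stand for \<open>E[X^k exp (- s X)]\<close> and \<open>E[Y^k exp (- s Y)]\<close>, and \<open>r1, r2\<close>
  for the moments of \<open>X / (X + Y)\<close>. The first relation gives \<open>g0 = f0 powr \<kappa>\<close>; the second one then makes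
  \<open>f0 / f1\<close> an affine function.\<close>

lemma lukacs_ode:
  fixes f0 f1 f2 g0 g1 g2 :: "real \<Rightarrow> real"
  assumes pos: "\<And>s. s > 0 \<Longrightarrow> f0 s > 0 \<and> f1 s > 0 \<and> f2 s > 0 \<and> g0 s > 0 \<and> g1 s > 0"
    and df: "\<And>s. s > 0 \<Longrightarrow> (f0 has_real_derivative - f1 s) (at s)" "\<And>s. s > 0 \<Longrightarrow> (f1 has_real_derivative - f2 s) (at s)"
    and dg: "\<And>s. s > 0 \<Longrightarrow> (g0 has_real_derivative - g1 s) (at s)" "\<And>s. s > 0 \<Longrightarrow> (g1 has_real_derivative - g2 s) (at s)"
    and rel1: "\<And>s. s > 0 \<Longrightarrow> f1 s * g0 s = r1 * (f1 s * g0 s + f0 s * g1 s)"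
    and rel2: "\<And>s. s > 0 \<Longrightarrow> f2 s * g0 s = r2 * (f2 s * g0 s + 2 * (f1 s * g1 s) + f0 s * g2 s)"
    and conv: "\<And>s. s > 0 \<Longrightarrow> (f1 s)\<^sup>2 < f0 s * f2 s"
    and le1: "\<And>s. s > 0 \<Longrightarrow> f0 s \<le> 1"
    and lim: "(\<lambda>n. f0 (1 / real (Suc n))) \<longlonglongrightarrow> 1" "(\<lambda>n. g0 (1 / real (Suc n))) \<longlonglongrightarrow> 1"
  obtains l1 l2 c where "l1 > 0" "l2 > 0" "c > 0"
    "\<And>s. s > 0 \<Longrightarrow> f0 s = (c / (c + s)) powr l1" "\<And>s. s > 0 \<Longrightarrow> g0 s = (c / (c + s)) powr l2"
proof -
  \<comment> \<open>\<open>\<kappa>\<close> turns out to be the ratio of the two shapes,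
    \<open>l2 / l1\<close>.\<close>
  define \<kappa> where "\<kappa> = (1 - r1) / r1"
  have p1: "f0 1 > 0" "f1 1 > 0" "f2 1 > 0" "g0 1 > 0" "g1 1 > 0" using pos[of 1] by auto
  have "r1 * (f1 1 * g0 1 + f0 1 * g1 1) > 0" using rel1[of 1] p1 by (metis mult_pos_pos zero_less_one)
  then have r1: "r1 > 0" using p1 by (metis add_pos_pos mult_pos_pos zero_less_mult_pos2)
  have "(1 - r1) * (f1 1 * g0 1) = r1 * (f0 1 * g1 1)" using rel1[of 1] by (simp add: algebra_simps)
  also have "\<dots> > 0" using r1 p1 by simp
  finally have "1 - r1 > 0" using p1 by (metis mult_pos_pos zero_less_mult_pos2)
  then have k: "\<kappa> > 0" unfolding \<kappa>_def using r1 by simp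
  have G1: "f0 s * g1 s = \<kappa> * (f1 s * g0 s)" if "s > 0" for s
    using rel1[OF that] r1 unfolding \<kappa>_def by (simp add: field_simps)
  \<comment> \<open>The derivative of \<open>G1\<close>; it eliminates \<open>g2\<close> from
    \<open>rel2\<close>.\<close>
  have G2: "f0 s * g2 s = \<kappa> * (f2 s * g0 s) + (\<kappa> - 1) * (f1 s * g1 s)" if s: "s > 0" for s
  proof -
    have "((\<lambda>s. f0 s * g1 s - \<kappa> * (f1 s * g0 s)) has_real_derivative
        (- f1 s * g1 s + - g2 s * f0 s) - \<kappa> * (- f2 s * g0 s + - g1 s * f1 s)) (at s)"
      by (intro DERIV_diff DERIV_mult DERIV_cmult df dg s)
    moreover have "((\<lambda>s. f0 s * g1 s - \<kappa> * (f1 s * g0 s)) has_real_derivative 0) (at s)"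
    proof (rule has_field_derivative_transform_within_open[where S="{0<..}"])
      show "((\<lambda>s. 0::real) has_real_derivative 0) (at s)" by simp
    qed (use s G1 in auto)
    ultimately have "(- f1 s * g1 s + - g2 s * f0 s) - \<kappa> * (- f2 s * g0 s + - g1 s * f1 s) = 0"
      by (rule DERIV_unique)
    then show ?thesis by (simp add: algebra_simps)
  qed
  define q where "q = r2 * (1 + \<kappa>)"
  have F2: "f0 s * f2 s * (1 - q) = q * \<kappa> * (f1 s)\<^sup>2" if s: "s > 0" for s
  proof -
    have "f2 s * g0 s = r2 * (f2 s * g0 s + 2 * (f1 s * g1 s) + (\<kappa> * (f2 s * g0 s) + (\<kappa> - 1) * (f1 s * g1 s)))"
      using rel2[OF s] G2[OF s] by simp
    also have "\<dots> = q * (f2 s * g0 s + f1 s * g1 s)" by (simp add: q_def algebra_simps)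
    finally have "f0 s * (f2 s * g0 s) = f0 s * (q * (f2 s * g0 s + f1 s * g1 s))"
      by (rule arg_cong)
    then have "f0 s * (f2 s * g0 s) = q * (f0 s * (f2 s * g0 s) + f1 s * (f0 s * g1 s))"
      by (simp add: algebra_simps)
    then have "g0 s * (f0 s * f2 s * (1 - q)) = g0 s * (q * \<kappa> * (f1 s)\<^sup>2)"
      unfolding G1[OF s] by (simp add: algebra_simps power2_eq_square)
    then show ?thesis using pos[OF s] by simp
  qed
  \<comment> \<open>\<open>\<theta> + 1\<close> is the constant value of \<open>f0 * f2\<close> over
    the square of \<open>f1\<close>. The derivative of \<open>f0 / f1\<close> is this value minus 1,
    hence \<open>\<theta>\<close>, and \<open>1 / \<theta>\<close> will be the shape of
    \<open>X\<close>.\<close>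
  define \<theta> where "\<theta> = q * \<kappa> / (1 - q) - 1"
  have q1: "1 - q \<noteq> 0"
  proof
    assume "1 - q = 0"
    then have "\<kappa> * (f1 1)\<^sup>2 = 0" using F2[of 1] by simp
    then show False using k p1 by simp
  qed
  have F2': "f0 s * f2 s = (\<theta> + 1) * (f1 s)\<^sup>2" if s: "s > 0" for s
    using F2[OF s] q1 by (simp add: \<theta>_def field_simps)
  have th: "\<theta> > 0"
  proof -
    have "(f1 1)\<^sup>2 < (\<theta> + 1) * (f1 1)\<^sup>2" using conv[of 1] F2'[of 1] by simp
    then have "0 < \<theta> * (f1 1)\<^sup>2" by (simp add: algebra_simps)
    then show ?thesis using p1 by (simp add: zero_less_mult_iff)
  qed
  define d where "d = f0 1 / f1 1 - \<theta>"
  have w: "f0 s / f1 s = \<theta> * s + d" if s: "s > 0" for s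
  proof -
    have "((\<lambda>s. f0 s / f1 s - \<theta> * s) has_real_derivative 0) (at s)" if s: "s > 0" for s
    proof -
      have "((\<lambda>s. f0 s / f1 s - \<theta> * s) has_real_derivative (- f1 s * f1 s - f0 s * - f2 s) / (f1 s * f1 s) - \<theta> * 1) (at s)"
        using pos[OF s] by (intro DERIV_diff DERIV_divide DERIV_cmult df s DERIV_ident) auto
      moreover have "(- f1 s * f1 s - f0 s * - f2 s) / (f1 s * f1 s) - \<theta> * 1 = 0"
        using F2'[OF s] pos[OF s] by (simp add: field_simps power2_eq_square)
      ultimately show ?thesis by simp
    qed
    from DERIV_zero_halfline[OF this s zero_less_one] show ?thesis by (simp add: d_def)
  qed
  have wpos: "\<theta> * s + d > 0" if s: "s > 0" for s
    using w[OF s] pos[OF s] by (metis divide_pos_pos)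
  have d0: "d \<ge> 0"
  proof (rule ccontr)
    assume "\<not> ?thesis"
    \<comment> \<open>At this point \<open>\<theta> * s + d\<close> would equal
      \<open>d / 2 < 0\<close>.\<close>
    then have "- d / (2 * \<theta>) > 0" using th by (simp add: field_simps)
    from wpos[OF this] show False using th \<open>\<not> d \<ge> 0\<close> by (simp add: field_simps)
  qed
  define K where "K = ln (f0 1) + ln (\<theta> + d) / \<theta>"
  have lnf: "ln (f0 s) = K - ln (\<theta> * s + d) / \<theta>" if s: "s > 0" for s
  proof -
    have "((\<lambda>s. ln (f0 s) + ln (\<theta> * s + d) / \<theta>) has_real_derivative 0) (at s)" if s: "s > 0" for s
    proof -
      have "((\<lambda>s. ln (f0 s) + ln (\<theta> * s + d) / \<theta>) has_real_derivative (1 / f0 s * - f1 s + (1 / (\<theta> * s + d) * \<theta>) / \<theta>)) (at s)"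
        using pos[OF s] wpos[OF s] th
        by (auto intro!: derivative_eq_intros df s)
      moreover have "1 / f0 s * - f1 s + (1 / (\<theta> * s + d) * \<theta>) / \<theta> = 0"
        unfolding w[OF s, symmetric] using th pos[OF s] by simp
      ultimately show ?thesis by simp
    qed
    from DERIV_zero_halfline[OF this s zero_less_one] show ?thesis by (simp add: K_def)
  qed
  have dpos: "d > 0"
  proof (rule ccontr)
    assume "\<not> d > 0"
    with d0 have d: "d = 0" by simp
    \<comment> \<open>Chosen to make \<open>ln (f0 s) = K + \<bar>K\<bar> + 1\<close> positive,
      against \<open>f0 s \<le> 1\<close>. Excluding \<open>d = 0\<close> ensures that the rate
      \<open>d / \<theta>\<close> is positive.\<close>
    define s where "s = exp (- \<theta> * (\<bar>K\<bar> + 1)) / \<theta>"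
    have s: "s > 0" using th by (simp add: s_def)
    have "ln (\<theta> * s + d) = - \<theta> * (\<bar>K\<bar> + 1)" using th d by (simp add: s_def)
    then have "ln (f0 s) = K + \<bar>K\<bar> + 1" using lnf[OF s] th by simp
    then have "ln (f0 s) > 0" by simp
    then show False using le1[OF s] pos[OF s] by (simp add: ln_gt_zero_iff)
  qed
  have s0: "(\<lambda>n. 1 / real (Suc n)) \<longlonglongrightarrow> 0" by (intro LIMSEQ_Suc lim_1_over_n)
  have K: "K = ln d / \<theta>"
  proof (rule LIMSEQ_unique)
    have "(\<lambda>n. ln (f0 (1 / real (Suc n))) + ln (\<theta> * (1 / real (Suc n)) + d) / \<theta>) \<longlonglongrightarrow> ln 1 + ln (\<theta> * 0 + d) / \<theta>"
      using dpos th by (intro tendsto_intros lim s0) auto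
    then show "(\<lambda>n. ln (f0 (1 / real (Suc n))) + ln (\<theta> * (1 / real (Suc n)) + d) / \<theta>) \<longlonglongrightarrow> ln d / \<theta>" by simp
    show "(\<lambda>n. ln (f0 (1 / real (Suc n))) + ln (\<theta> * (1 / real (Suc n)) + d) / \<theta>) \<longlonglongrightarrow> K"
      by (simp add: lnf)
  qed
  define c where "c = d / \<theta>"
  have c: "c > 0" using dpos th by (simp add: c_def)
  have lnc: "ln (f0 s) = 1 / \<theta> * ln (c / (c + s))" if s: "s > 0" for s
  proof -
    have "c / (c + s) = d / (\<theta> * s + d)" using th dpos s by (simp add: c_def field_simps)
    then show ?thesis
      using lnf[OF s] wpos[OF s] dpos by (simp add: K ln_div diff_divide_distrib)
  qed
  have lng: "ln (g0 s) = \<kappa> * ln (f0 s)" if s: "s > 0" for s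
  proof -
    have dz: "((\<lambda>s. ln (g0 s) - \<kappa> * ln (f0 s)) has_real_derivative 0) (at s)" if s: "s > 0" for s
    proof -
      have "((\<lambda>s. ln (g0 s) - \<kappa> * ln (f0 s)) has_real_derivative (1 / g0 s * - g1 s - \<kappa> * (1 / f0 s * - f1 s))) (at s)"
        using pos[OF s] by (auto intro!: derivative_eq_intros df dg s)
      moreover have "1 / g0 s * - g1 s - \<kappa> * (1 / f0 s * - f1 s) = 0"
        using G1[OF s] pos[OF s] by (simp add: field_simps)
      ultimately show ?thesis by simp
    qed
    define C where "C = ln (g0 1) - \<kappa> * ln (f0 1)"
    have C: "ln (g0 s) - \<kappa> * ln (f0 s) = C" if "s > 0" for s
      using DERIV_zero_halfline[OF dz that zero_less_one] by (simp add: C_def)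
    have "(\<lambda>n. ln (g0 (1 / real (Suc n))) - \<kappa> * ln (f0 (1 / real (Suc n)))) \<longlonglongrightarrow> ln 1 - \<kappa> * ln 1"
      by (intro tendsto_intros lim) auto
    then have "(\<lambda>n::nat. C) \<longlonglongrightarrow> 0" by (simp add: C)
    then have "C = 0" by (simp add: LIMSEQ_const_iff)
    with C[OF s] show ?thesis by simp
  qed
  show ?thesis
  proof (rule that[of "1 / \<theta>" "\<kappa> / \<theta>" c])
    fix s :: real assume s: "s > 0"
    show "f0 s = (c / (c + s)) powr (1 / \<theta>)"
      using lnc[OF s] pos[OF s] c s exp_ln[of "f0 s"] by (simp add: powr_def)
    show "g0 s = (c / (c + s)) powr (\<kappa> / \<theta>)"
      using lnc[OF s] lng[OF s] pos[OF s] c s exp_ln[of "g0 s"] by (simp add: powr_def)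
  qed (use th k c in auto)
qed

text \<open>Since \<open>X ^ k = R ^ k * S ^ k\<close>, independence of \<open>S\<close> and
  \<open>R\<close> factors \<open>E[X ^ k exp (- s S)]\<close>, while independence of
  \<open>X\<close> and \<open>Y\<close> expands both sides in their transforms. The exponents 1 and
  2 are the two relations of \<open>lukacs_ode\<close>.\<close>

lemma (in prob_space) lukacs:
  assumes meas [measurable]: "X \<in> borel_measurable M" "Y \<in> borel_measurable M" "S \<in> borel_measurable M" "R \<in> borel_measurable M"
    and ae: "AE \<omega> in M. X \<omega> > 0 \<and> Y \<omega> > 0 \<and> S \<omega> = X \<omega> + Y \<omega> \<and> R \<omega> = X \<omega> / (X \<omega> + Y \<omega>)"
    and indXY: "indep_var borel X borel Y" and indSR: "indep_var borel S borel R"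
    and nd: "\<And>b. \<not> (AE \<omega> in M. X \<omega> = b)"
  obtains l1 l2 c where "l1 > 0" "l2 > 0" "c > 0"
    "distr M borel X = gamma_measure l1 c" "distr M borel S = gamma_measure (l1 + l2) c"
proof -
  have pX: "AE \<omega> in M. X \<omega> > 0" and pY: "AE \<omega> in M. Y \<omega> > 0" and pS: "AE \<omega> in M. S \<omega> > 0"
    using ae by (eventually_elim, simp)+
  have prodXY: "expectation (\<lambda>\<omega>. (X \<omega> ^ j * exp (- s * X \<omega>)) * (Y \<omega> ^ k * exp (- s * Y \<omega>))) = laplace X j s * laplace Y k s"
    "integrable M (\<lambda>\<omega>. (X \<omega> ^ j * exp (- s * X \<omega>)) * (Y \<omega> ^ k * exp (- s * Y \<omega>)))" if s: "s > 0" for j k s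
  proof -
    have "indep_var borel ((\<lambda>x. x ^ j * exp (- s * x)) \<circ> X) borel ((\<lambda>y. y ^ k * exp (- s * y)) \<circ> Y)"
      by (rule indep_var_compose[OF indXY]) measurable
    then have ind: "indep_var borel (\<lambda>\<omega>. X \<omega> ^ j * exp (- s * X \<omega>)) borel (\<lambda>\<omega>. Y \<omega> ^ k * exp (- s * Y \<omega>))"
      by (simp add: o_def)
    show "expectation (\<lambda>\<omega>. (X \<omega> ^ j * exp (- s * X \<omega>)) * (Y \<omega> ^ k * exp (- s * Y \<omega>))) = laplace X j s * laplace Y k s"
      unfolding laplace_def
      by (rule indep_var_lebesgue_integral[OF ind laplace_integrable[OF meas(1) pX s] laplace_integrable[OF meas(2) pY s]])
    show "integrable M (\<lambda>\<omega>. (X \<omega> ^ j * exp (- s * X \<omega>)) * (Y \<omega> ^ k * exp (- s * Y \<omega>)))"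
      by (rule indep_var_integrable[OF ind laplace_integrable[OF meas(1) pX s] laplace_integrable[OF meas(2) pY s]])
  qed
  have prodSR: "expectation (\<lambda>\<omega>. (S \<omega> ^ k * exp (- s * S \<omega>)) * R \<omega> ^ k) = laplace S k s * expectation (\<lambda>\<omega>. R \<omega> ^ k)" if s: "s > 0" for k s
  proof -
    have "indep_var borel ((\<lambda>x. x ^ k * exp (- s * x)) \<circ> S) borel ((\<lambda>y. y ^ k) \<circ> R)"
      by (rule indep_var_compose[OF indSR]) measurable
    then have ind: "indep_var borel (\<lambda>\<omega>. S \<omega> ^ k * exp (- s * S \<omega>)) borel (\<lambda>\<omega>. R \<omega> ^ k)"
      by (simp add: o_def)
    have "integrable M (\<lambda>\<omega>. R \<omega> ^ k)"
    proof (rule integrable_const_bound[where B=1])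
      show "AE \<omega> in M. norm (R \<omega> ^ k) \<le> 1"
        using ae
      proof eventually_elim
        case (elim \<omega>)
        then have "0 \<le> R \<omega>" "R \<omega> \<le> 1" using elim by auto
        then show ?case by (simp add: power_le_one)
      qed
    qed measurable
    then show ?thesis
      unfolding laplace_def
      by (rule indep_var_lebesgue_integral[OF ind laplace_integrable[OF meas(3) pS s]])
  qed
  have ee: "exp (- s * (x + y)) = exp (- s * x) * exp (- s * y)" for s x y :: real
    by (simp add: exp_add[symmetric] algebra_simps)
  have h: "laplace S 0 s = laplace X 0 s * laplace Y 0 s"
    "laplace S 1 s = laplace X 1 s * laplace Y 0 s + laplace X 0 s * laplace Y 1 s"
    "laplace S 2 s = laplace X 2 s * laplace Y 0 s + 2 * (laplace X 1 s * laplace Y 1 s) + laplace X 0 s * laplace Y 2 s"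
    if s: "s > 0" for s
  proof -
    let ?T = "\<lambda>j k \<omega>. (X \<omega> ^ j * exp (- s * X \<omega>)) * (Y \<omega> ^ k * exp (- s * Y \<omega>))"
    note e = prodXY(1)[OF s] and i = prodXY(2)[OF s]
    have S: "laplace S k s = expectation f"
      if [measurable]: "f \<in> borel_measurable M" and f: "\<And>\<omega>. (X \<omega> + Y \<omega>) ^ k * exp (- s * (X \<omega> + Y \<omega>)) = f \<omega>" for k f
      unfolding laplace_def
    proof (rule integral_cong_AE)
      show "AE \<omega> in M. S \<omega> ^ k * exp (- s * S \<omega>) = f \<omega>"
        using ae by eventually_elim (simp only: f[symmetric])
    qed measurable
    have "laplace S 0 s = expectation (?T 0 0)"
      by (rule S, measurable) (simp only: ee, simp)
    then show "laplace S 0 s = laplace X 0 s * laplace Y 0 s" unfolding e .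
    have "laplace S 1 s = expectation (\<lambda>\<omega>. ?T 1 0 \<omega> + ?T 0 1 \<omega>)"
      by (rule S, measurable) (simp only: ee, simp add: algebra_simps)
    then show "laplace S 1 s = laplace X 1 s * laplace Y 0 s + laplace X 0 s * laplace Y 1 s"
      unfolding Bochner_Integration.integral_add[OF i i] e .
    have "laplace S 2 s = expectation (\<lambda>\<omega>. (?T 2 0 \<omega> + 2 * ?T 1 1 \<omega>) + ?T 0 2 \<omega>)"
      by (rule S, measurable) (simp only: ee, simp add: power2_eq_square algebra_simps)
    then show "laplace S 2 s = laplace X 2 s * laplace Y 0 s + 2 * (laplace X 1 s * laplace Y 1 s) + laplace X 0 s * laplace Y 2 s"
      unfolding Bochner_Integration.integral_add[OF Bochner_Integration.integrable_add[OF i integrable_mult_right[OF i]] i]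
        Bochner_Integration.integral_add[OF i integrable_mult_right[OF i]] integral_mult_right_zero e .
  qed
  have rel: "laplace X k s * laplace Y 0 s = expectation (\<lambda>\<omega>. R \<omega> ^ k) * laplace S k s" if s: "s > 0" for k s
  proof -
    have "expectation (\<lambda>\<omega>. (X \<omega> ^ k * exp (- s * X \<omega>)) * (Y \<omega> ^ 0 * exp (- s * Y \<omega>))) =
        expectation (\<lambda>\<omega>. (S \<omega> ^ k * exp (- s * S \<omega>)) * R \<omega> ^ k)"
    proof (rule integral_cong_AE)
      show "AE \<omega> in M. (X \<omega> ^ k * exp (- s * X \<omega>)) * (Y \<omega> ^ 0 * exp (- s * Y \<omega>)) = (S \<omega> ^ k * exp (- s * S \<omega>)) * R \<omega> ^ k"
        using ae
      proof eventually_elim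
        case (elim \<omega>)
        have "X \<omega> ^ k = R \<omega> ^ k * S \<omega> ^ k" using elim by (simp add: power_mult_distrib[symmetric])
        moreover have "exp (- s * S \<omega>) = exp (- s * X \<omega>) * exp (- s * Y \<omega>)" using elim ee by simp
        ultimately show ?case by (simp add: mult_ac)
      qed
    qed measurable
    then show ?thesis unfolding prodXY(1)[OF s] prodSR[OF s] by (simp add: mult.commute)
  qed
  have pos: "laplace X k s > 0" "laplace Y k s > 0" if "s > 0" for k s
    using laplace_pos[OF meas(1) pX that] laplace_pos[OF meas(2) pY that] by auto
  obtain l1 l2 c where l: "l1 > 0" "l2 > 0" "c > 0"
    and LX: "\<And>s. s > 0 \<Longrightarrow> laplace X 0 s = (c / (c + s)) powr l1"
    and LY: "\<And>s. s > 0 \<Longrightarrow> laplace Y 0 s = (c / (c + s)) powr l2"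
  proof (rule lukacs_ode[of "laplace X 0" "laplace X 1" "laplace X 2" "laplace Y 0" "laplace Y 1" "laplace Y 2"
        "expectation (\<lambda>\<omega>. R \<omega> ^ 1)" "expectation (\<lambda>\<omega>. R \<omega> ^ 2)"], goal_cases)
    case (1 s)
    then show ?case using pos by auto
  next
    case (2 s)
    then show ?case using laplace_deriv[OF meas(1) pX, of s 0] by simp
  next
    case (3 s)
    then show ?case using laplace_deriv[OF meas(1) pX, of s 1] by (simp add: numeral_2_eq_2)
  next
    case (4 s)
    then show ?case using laplace_deriv[OF meas(2) pY, of s 0] by simp
  next
    case (5 s)
    then show ?case using laplace_deriv[OF meas(2) pY, of s 1] by (simp add: numeral_2_eq_2)
  next
    case (6 s)
    show ?case by (rule rel[OF 6(2), of 1, unfolded h(2)[OF 6(2)]])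
  next
    case (7 s)
    show ?case by (rule rel[OF 7(2), of 2, unfolded h(3)[OF 7(2)]])
  next
    case (8 s)
    then show ?case by (intro laplace_strict_log_convex[OF meas(1) pX _ nd])
  next
    case (9 s)
    then show ?case by (intro laplace_le_1[OF meas(1) pX])
  next
    case 10
    show ?case by (rule laplace_limit_0[OF meas(1) pX])
  next
    case 11
    show ?case by (rule laplace_limit_0[OF meas(2) pY])
  next
    case (12 l1 l2 c)
    then show ?case by (intro that)
  qed
  have law: "distr M borel Z = gamma_measure l c"
    if Z [measurable]: "Z \<in> borel_measurable M" "AE \<omega> in M. Z \<omega> > 0" and "l > 0"
      and LZ: "\<And>s. s > 0 \<Longrightarrow> laplace Z 0 s = (c / (c + s)) powr l" for Z l
  proof (rule laplace_determines)
    show "prob_space (distr M borel Z)" by (rule prob_space_distr) measurable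
    show "prob_space (gamma_measure l c)" by (rule prob_space_gamma_measure) fact+
    show "AE x in distr M borel Z. x > 0" using Z by (subst AE_distr_iff) auto
    show "AE x in gamma_measure l c. x > 0" by (rule AE_gamma_measure_pos)
    fix s :: real assume s: "s > 0"
    have "(\<integral>x. exp (- s * x) \<partial>distr M borel Z) = laplace Z 0 s"
      unfolding laplace_def by (subst integral_distr) auto
    then show "(\<integral>x. exp (- s * x) \<partial>distr M borel Z) = (\<integral>x. exp (- s * x) \<partial>gamma_measure l c)"
      using LZ[OF s] gamma_laplace[OF \<open>l > 0\<close> l(3) s] by simp
  qed auto
  show ?thesis
  proof (rule that[OF l])
    show "distr M borel X = gamma_measure l1 c" by (rule law[OF meas(1) pX l(1) LX])
    show "distr M borel S = gamma_measure (l1 + l2) c"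
      by (rule law[OF meas(3) pS]) (use l h(1) LX LY in \<open>auto simp: powr_add\<close>)
  qed
qed

text \<open>\<open>S\<close> is a function of \<open>R\<close> and independent of it, hence independent of itself.\<close>

lemma (in prob_space) indep_function_const:
  fixes S R :: "'a \<Rightarrow> real" and b :: real
  assumes ind: "indep_var borel S borel R"
    and ae: "AE \<omega> in M. S \<omega> > 0 \<and> S \<omega> = b / R \<omega>"
  shows "\<exists>a. AE \<omega> in M. S \<omega> = a"
proof -
  have [measurable]: "S \<in> borel_measurable M" "R \<in> borel_measurable M"
    using indep_var_rv1[OF ind] indep_var_rv2[OF ind] by auto
  \<comment> \<open>Bounded versions of the two variables, so that products are integrable. The
    absolute value keeps \<open>\<psi>\<close> bounded also off the almost sure event.\<close>
  define \<phi> where "\<phi> \<omega> = exp (- S \<omega>)" for \<omega>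
  define \<psi> where "\<psi> \<omega> = exp (- \<bar>b / R \<omega>\<bar>)" for \<omega>
  have pm [measurable]: "\<phi> \<in> borel_measurable M" "\<psi> \<in> borel_measurable M"
    unfolding \<phi>_def \<psi>_def by measurable
  have eq: "AE \<omega> in M. \<phi> \<omega> = \<psi> \<omega>"
    using ae by eventually_elim (auto simp: \<phi>_def \<psi>_def simp del: abs_divide)
  have pS: "AE \<omega> in M. S \<omega> > 0" using ae by eventually_elim simp
  have i1: "integrable M \<phi>"
    by (rule integrable_const_bound[where B=1]) (use pS in \<open>auto simp: \<phi>_def elim!: eventually_mono\<close>)
  have i2: "integrable M \<psi>"
    by (rule integrable_const_bound[where B=1]) (auto simp: \<psi>_def)
  have i3: "integrable M (\<lambda>\<omega>. (\<phi> \<omega>)\<^sup>2)"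
    by (rule integrable_const_bound[where B=1]) (use pS in \<open>auto simp: \<phi>_def power_le_one elim!: eventually_mono\<close>)
  have "indep_var borel ((\<lambda>x. exp (- x)) \<circ> S) borel ((\<lambda>x. exp (- \<bar>b / x\<bar>)) \<circ> R)"
    by (rule indep_var_compose[OF ind]) measurable
  then have "indep_var borel \<phi> borel \<psi>"
    by (simp add: o_def \<phi>_def[abs_def] \<psi>_def[abs_def])
  from indep_var_lebesgue_integral[OF this i1 i2]
  have "expectation (\<lambda>\<omega>. \<phi> \<omega> * \<psi> \<omega>) = expectation \<phi> * expectation \<psi>" .
  moreover have "expectation (\<lambda>\<omega>. \<phi> \<omega> * \<psi> \<omega>) = expectation (\<lambda>\<omega>. (\<phi> \<omega>)\<^sup>2)"
    by (rule integral_cong_AE) (use eq in \<open>auto simp: power2_eq_square elim!: eventually_mono\<close>)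
  moreover have "expectation \<psi> = expectation \<phi>"
    by (rule integral_cong_AE) (use eq in \<open>auto elim!: eventually_mono\<close>)
  ultimately have "variance \<phi> = 0"
    by (subst variance_eq[OF i1 i3]) (simp add: power2_eq_square)
  moreover have "integrable M (\<lambda>\<omega>. (\<phi> \<omega> - expectation \<phi>)\<^sup>2)"
    using i1 i3 by (simp add: power2_diff)
  ultimately have "AE \<omega> in M. (\<phi> \<omega> - expectation \<phi>)\<^sup>2 = 0"
    by (subst (asm) integral_nonneg_eq_0_iff_AE) auto
  then have "AE \<omega> in M. S \<omega> = - ln (expectation \<phi>)"
    by eventually_elim (metis \<phi>_def eq_iff_diff_eq_0 ln_exp minus_minus zero_eq_power2)
  then show ?thesis by blast
qed

lemma (in prob_space) distr_AE_const:
  assumes "X \<in> borel_measurable M" "AE \<omega> in M. X \<omega> = (a::real)"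
  shows "distr M borel X = return borel a"
proof -
  have "distr M borel X = distr M borel (\<lambda>_. a)"
    using assms by (intro distr_cong_AE) auto
  also have "\<dots> = return borel a"
    by (rule distr_const) simp
  finally show ?thesis .
qed

lemma invariant_imp_gamma:
  assumes nu: "prob_space \<nu>" "sets \<nu> = sets borel" "AE x in \<nu>. x > 0"
    and mu: "prob_space \<mu>" "sets \<mu> = sets borel" "AE x in \<mu>. x > 0"
    and nt: "\<not> ((\<exists>a. \<nu> = return borel a) \<and> (\<exists>b. \<mu> = return borel b))"
    and inv: "dT_invariant \<nu> \<mu>"
  shows "\<exists>l1 l2 c :: real. l1 > 0 \<and> l2 > 0 \<and> c > 0 \<and> \<nu> = gamma_measure (l1 + l2) c \<and> \<mu> = gamma_measure l1 c"
proof -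
  interpret iid \<nu> \<mu> by (intro iid.intro nu mu)
  define X where "X x = snd (x 0)" for x :: config
  define Y where "Y x = carrier_of x 0" for x :: config
  define S where "S x = fst (toda_map x 0)" for x :: config
  obtain R where R [measurable]: "R \<in> borel_measurable P"
    and XY': "P.indep_var borel (\<lambda>x. snd (x 0)) borel (\<lambda>x. carrier_of x 0)"
    and SR': "P.indep_var borel (\<lambda>x. fst (toda_map x 0)) borel R"
    and ae': "AE x in P. carrier_of x 0 > 0 \<and> fst (toda_map x 0) = snd (x 0) + carrier_of x 0 \<and>
        R x = snd (x 0) / (snd (x 0) + carrier_of x 0)"
    and lawS': "distr P borel (\<lambda>x. fst (toda_map x 0)) = \<nu>"
    by (rule invariant_independence[OF inv])
  have XY: "P.indep_var borel X borel Y" using XY' by (simp add: X_def[abs_def] Y_def[abs_def])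
  have SR: "P.indep_var borel S borel R" using SR' by (simp add: S_def[abs_def])
  have lawS: "distr P borel S = \<nu>" using lawS' by (simp add: S_def[abs_def])
  have m [measurable]: "X \<in> borel_measurable P" "Y \<in> borel_measurable P" "S \<in> borel_measurable P"
    unfolding X_def Y_def S_def by measurable
  have lawX: "distr P borel X = \<mu>" unfolding X_def by (rule distr_snd)
  have "AE x in P. X x > 0" unfolding X_def by (rule AE_snd[OF assms(6)])
  with ae' have ae: "AE x in P. X x > 0 \<and> Y x > 0 \<and> S x = X x + Y x \<and> R x = X x / (X x + Y x)"
    by eventually_elim (auto simp: X_def Y_def S_def)
  \<comment> \<open>For constant \<open>X = b\<close> the ratio determines the sum through
    \<open>S = b / R\<close>, so \<open>S\<close> is constant too and both laws are Dirac masses,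
    which \<open>nt\<close> excludes.\<close>
  have nd: "\<not> (AE x in P. X x = b)" for b
  proof
    assume b: "AE x in P. X x = b"
    have "AE x in P. S x > 0 \<and> S x = b / R x"
      using ae b
    proof eventually_elim
      case (elim x)
      then show ?case by auto
    qed
    then obtain a where "AE x in P. S x = a" using P.indep_function_const[OF SR] by blast
    then have "\<nu> = return borel a" "\<mu> = return borel b"
      using P.distr_AE_const[OF m(3)] P.distr_AE_const[OF m(1) b] lawS lawX by auto
    with nt show False by blast
  qed
  from P.lukacs[OF m R ae XY SR nd] obtain l1 l2 c where "l1 > 0" "l2 > 0" "c > 0"
    "distr P borel X = gamma_measure l1 c" "distr P borel S = gamma_measure (l1 + l2) c" by blast
  then show ?thesis using lawS lawX by auto
qed

theorem theorem4p8:
  shows "(\<forall>l1 l2 c :: real. l1 > 0 \<longrightarrow> l2 > 0 \<longrightarrow> c > 0 \<longrightarrow>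
            dT_invariant (gamma_measure (l1 + l2) c) (gamma_measure l1 c))
       \<and> (\<forall>\<nu> \<mu> :: real measure.
            prob_space \<nu> \<and> sets \<nu> = sets borel \<and> (AE x in \<nu>. x > 0) \<and>
            prob_space \<mu> \<and> sets \<mu> = sets borel \<and> (AE x in \<mu>. x > 0) \<and>
            \<not> ((\<exists>a. \<nu> = return borel a) \<and> (\<exists>b. \<mu> = return borel b)) \<and>
            dT_invariant \<nu> \<mu>
          \<longrightarrow> (\<exists>l1 l2 c :: real. l1 > 0 \<and> l2 > 0 \<and> c > 0 \<and>
                 \<nu> = gamma_measure (l1 + l2) c \<and> \<mu> = gamma_measure l1 c))"
  using gamma_invariant invariant_imp_gamma by blast

end
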